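(* Let $f:A\to B$ be an arbitrary object of $\mathcal S$ (an injective $R$-homomorphism of finitely generated $R$-modules) such that $A$ and $B$ are stable. Then $f$ is horizontally linked if and only if both $R$-modules $A$ and $B$ are horizontally linked.
   Context: $(R,\mathfrak m)$ is a commutative noetherian local ring of finite dimension; all modules are finitely generated. An $R$-module is stable if it has no non-trivial projective direct summand. $\mathcal M$ is the category whose objects are $R$-homomorphisms $f:A\to B$ of finitely generated $R$-modules and whose morphisms are commutative squares; $\mathcal S$ is its full subcategory of monomorphisms. The projective objects of $\mathcal M$ are the direct sums of objects $P\xrightarrow{1}P$ and $0\to P$ with $P$ finitely generated projective. Write $(-)'=\mathrm{Hom}_R(-,R)$. Modules: for $M$ with minimal projective presentation $P_1\to P_0\to M\to0$, $\mathrm{Tr}\,M=\mathrm{Cok}(P_0'\to P_1')$; $\Omega^1M$ is the first syzygy in a minimal projective resolution; $\lambda M=\Omega^1\mathrm{Tr}\,M$. $M$ is horizontally linked if $M\cong\lambda^2M$. Transpose in $\mathcal M$: let $\mathbf r=(R\xrightarrow{1}R)\oplus(0\to R)$, corresponding to the path algebra of the quiver $\bullet_1\to\bullet_2$ over $R$. For $f:A\to B$ in $\mathcal M$, the left module $f^*=\mathrm{Hom}_{\mathcal M}(f,\mathbf r)$ over the path algebra corresponds to the $R$-homomorphism $\mathrm{Hom}_{\mathcal M}(f,(0\to R))\to\mathrm{Hom}_{\mathcal M}(f,(R\xrightarrow{1}R))$ induced by the inclusion $(0\to R)\to(R\xrightarrow{1}R)$, i.e. to $(\mathrm{Cok} f)'\to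 B'$, regarded again as an object of the category of $R$-homomorphisms. If $f\in\mathcal S$ has minimal projective presentation $(P_1\to P_1\oplus Q_1)\to(P_0\to P_0\oplus Q_0)\to f\to0$ in $\mathcal M$, then $\mathrm{Tr}_{\mathcal M}(f)$ is the cokernel of the induced morphism $(Q_0'\to P_0'\oplus Q_0')\to(Q_1'\to P_1'\oplus Q_1')$. $\Omega^1_{\mathcal M}$ denotes the first syzygy (kernel of a projective cover) in the category of $R$-homomorphisms. An object $f\in\mathcal S$ is horizontally linked if $f\cong\lambda^2f$ in $\mathcal M$, where $\lambda=\Omega^1_{\mathcal M}\mathrm{Tr}_{\mathcal M}$. *)

theory Defs
  imports "HOL-Algebra.Module" "HOL-Algebra.Ring_Divisibility"
begin

section \<open>Rings\<close>

definition local_ring :: "('r, 'k) ring_scheme \<Rightarrow> bool" where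
  "local_ring R \<longleftrightarrow> cring R \<and> (\<exists>!m. maximalideal m R)"

definition finite_krull_dim :: "('r, 'k) ring_scheme \<Rightarrow> bool" where
  "finite_krull_dim R \<longleftrightarrow>
     (\<exists>n::nat. \<forall>C \<in> chains {p. primeideal p R}. finite C \<and> card C \<le> n)"


section \<open>Modules\<close>

text \<open>
  The record type of modules also has the fields \<^const>\<open>monoid.mult\<close> and \<^const>\<open>one\<close>, which play no role
  for modules; they are filled with arbitrary values in the constructions below.
\<close>

definition mod_hom ::
    "('r, 'k) ring_scheme \<Rightarrow> ('r, 'a) module \<Rightarrow> ('r, 'b) module \<Rightarrow> ('a \<Rightarrow> 'b) set" where
  "mod_hom R M N = {h \<in> carrier M \<rightarrow> carrier N.
     (\<forall>x \<in> carrier M. \<forall>y \<in> carrier M. h (x \<oplus>\<^bsub>M\<^esub> y) = h x \<oplus>\<^bsub>N\<^esub> h y) \<and>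
     (\<forall>r \<in> carrier R. \<forall>x \<in> carrier M. h (r \<odot>\<^bsub>M\<^esub> x) = r \<odot>\<^bsub>N\<^esub> h x)}"

definition mod_iso :: "('r, 'k) ring_scheme \<Rightarrow> ('r, 'a) module \<Rightarrow> ('r, 'b) module \<Rightarrow> bool" where
  "mod_iso R M N \<longleftrightarrow> module R M \<and> module R N \<and>
     (\<exists>h \<in> mod_hom R M N. bij_betw h (carrier M) (carrier N))"

definition fg_module :: "('r, 'k) ring_scheme \<Rightarrow> ('r, 'a) module \<Rightarrow> bool" where
  "fg_module R M \<longleftrightarrow> module R M \<and>
     (\<exists>S. finite S \<and> S \<subseteq> carrier M \<and>
        (\<forall>x \<in> carrier M. \<exists>c \<in> S \<rightarrow> carrier R. x = (\<Oplus>\<^bsub>M\<^esub>s\<in>S. c s \<odot>\<^bsub>M\<^esub> s)))"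

definition self_module :: "('r, 'k) ring_scheme \<Rightarrow> ('r, 'r) module" where
  "self_module R = \<lparr>carrier = carrier R, monoid.mult = monoid.mult R, one = \<one>\<^bsub>R\<^esub>,
     ring.zero = \<zero>\<^bsub>R\<^esub>, add = add R, smult = monoid.mult R\<rparr>"

definition zero_submodule :: "('r, 'a) module \<Rightarrow> ('r, 'a) module" where
  "zero_submodule M = M\<lparr>carrier := {\<zero>\<^bsub>M\<^esub>}\<rparr>"

definition mod_dsum :: "('r, 'a) module \<Rightarrow> ('r, 'b) module \<Rightarrow> ('r, 'a \<times> 'b) module" where
  "mod_dsum M N = \<lparr>carrier = carrier M \<times> carrier N,
     monoid.mult = (\<lambda>_ _. undefined), one = undefined,
     ring.zero = (\<zero>\<^bsub>M\<^esub>, \<zero>\<^bsub>N\<^esub>),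
     add = (\<lambda>(x, y) (x', y'). (x \<oplus>\<^bsub>M\<^esub> x', y \<oplus>\<^bsub>N\<^esub> y')),
     smult = (\<lambda>r (x, y). (r \<odot>\<^bsub>M\<^esub> x, r \<odot>\<^bsub>N\<^esub> y))\<rparr>"

definition quot_module :: "('r, 'a) module \<Rightarrow> 'a set \<Rightarrow> ('r, 'a set) module" where
  "quot_module M K = \<lparr>carrier = a_rcosets\<^bsub>M\<^esub> K,
     monoid.mult = (\<lambda>_ _. undefined), one = undefined,
     ring.zero = K, add = set_add M,
     smult = (\<lambda>r C. \<Union>x\<in>C. K +>\<^bsub>M\<^esub> (r \<odot>\<^bsub>M\<^esub> x))\<rparr>"

definition mod_ker :: "('r, 'a) module \<Rightarrow> ('r, 'b) module \<Rightarrow> ('a \<Rightarrow> 'b) \<Rightarrow> ('r, 'a) module" where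
  "mod_ker M N h = M\<lparr>carrier := a_kernel M N h\<rparr>"

definition mod_cok :: "('r, 'a) module \<Rightarrow> ('r, 'b) module \<Rightarrow> ('a \<Rightarrow> 'b) \<Rightarrow> ('r, 'b set) module" where
  "mod_cok M N h = quot_module N (h ` carrier M)"

text \<open>
  The elements of the Hom module are extensional functions, so that equality in it means
  equality on the carrier of the source.
\<close>

definition Hom_module ::
    "('r, 'k) ring_scheme \<Rightarrow> ('r, 'a) module \<Rightarrow> ('r, 'b) module \<Rightarrow> ('r, 'a \<Rightarrow> 'b) module" where
  "Hom_module R M N = \<lparr>carrier = mod_hom R M N \<inter> extensional (carrier M),
     monoid.mult = (\<lambda>_ _. undefined), one = undefined,
     ring.zero = (\<lambda>x\<in>carrier M. \<zero>\<^bsub>N\<^esub>),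
     add = (\<lambda>f g. \<lambda>x\<in>carrier M. f x \<oplus>\<^bsub>N\<^esub> g x),
     smult = (\<lambda>r f. \<lambda>x\<in>carrier M. r \<odot>\<^bsub>N\<^esub> f x)\<rparr>"

definition dual :: "('r, 'k) ring_scheme \<Rightarrow> ('r, 'a) module \<Rightarrow> ('r, 'a \<Rightarrow> 'r) module" where
  "dual R M = Hom_module R M (self_module R)"

text \<open>For \<open>d\<close> with source \<open>M\<close>.\<close>

definition dual_map :: "('r, 'a) module \<Rightarrow> ('a \<Rightarrow> 'b) \<Rightarrow> ('b \<Rightarrow> 'r) \<Rightarrow> ('a \<Rightarrow> 'r)" where
  "dual_map M d = (\<lambda>h. compose (carrier M) h d)"


section \<open>Projective modules, transpose, syzygy and linkage\<close>

text \<open>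
  A definition cannot quantify over types, so auxiliary modules are taken with carrier in the
  type of functions from \<open>nat\<close> to the ring.  This is no restriction: a finitely generated
  module is isomorphic to a quotient of some \<open>R^n\<close>, and a set of coset representatives in
  \<open>R^n\<close> with the transported operations is a copy of it over that type.
\<close>

type_synonym 'r umodule = "('r, nat \<Rightarrow> 'r) module"

definition projective_module :: "('r, 'k) ring_scheme \<Rightarrow> ('r, 'p) module \<Rightarrow> bool" where
  "projective_module R P \<longleftrightarrow> fg_module R P \<and>
     (\<forall>(U :: 'r umodule) (V :: 'r umodule) g h.
        fg_module R U \<and> fg_module R V \<and>
        g \<in> mod_hom R U V \<and> g ` carrier U = carrier V \<and> h \<in> mod_hom R P V \<longrightarrow>
        (\<exists>k \<in> mod_hom R P U. \<forall>x \<in> carrier P. g (k x) = h x))"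

definition direct_summand :: "('r, 'k) ring_scheme \<Rightarrow> ('r, 'a) module \<Rightarrow> 'a set \<Rightarrow> bool" where
  "direct_summand R M N \<longleftrightarrow> submodule N R M \<and>
     (\<exists>K. submodule K R M \<and> N \<inter> K = {\<zero>\<^bsub>M\<^esub>} \<and> N <+>\<^bsub>M\<^esub> K = carrier M)"

definition stable_module :: "('r, 'k) ring_scheme \<Rightarrow> ('r, 'a) module \<Rightarrow> bool" where
  "stable_module R M \<longleftrightarrow>
     (\<forall>N. direct_summand R M N \<and> projective_module R (M\<lparr>carrier := N\<rparr>) \<longrightarrow> N = {\<zero>\<^bsub>M\<^esub>})"

definition superfluous :: "('r, 'k) ring_scheme \<Rightarrow> ('r, 'a) module \<Rightarrow> 'a set \<Rightarrow> bool" where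
  "superfluous R M K \<longleftrightarrow>
     (\<forall>N. submodule N R M \<and> N <+>\<^bsub>M\<^esub> K = carrier M \<longrightarrow> N = carrier M)"

definition projective_cover ::
    "('r, 'k) ring_scheme \<Rightarrow> ('r, 'p) module \<Rightarrow> ('p \<Rightarrow> 'a) \<Rightarrow> ('r, 'a) module \<Rightarrow> bool" where
  "projective_cover R P \<pi> M \<longleftrightarrow> projective_module R P \<and>
     \<pi> \<in> mod_hom R P M \<and> \<pi> ` carrier P = carrier M \<and> superfluous R P (a_kernel P M \<pi>)"

text \<open>A minimal projective presentation \<open>P1 \<rightarrow> P0 \<rightarrow> M \<rightarrow> 0\<close> with maps \<open>d\<close> and \<open>\<pi>\<close>.\<close>

definition min_proj_presentation ::
    "('r, 'k) ring_scheme \<Rightarrow> ('r, 'q) module \<Rightarrow> ('q \<Rightarrow> 'p) \<Rightarrow> ('r, 'p) module \<Rightarrow>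
     ('p \<Rightarrow> 'a) \<Rightarrow> ('r, 'a) module \<Rightarrow> bool" where
  "min_proj_presentation R P1 d P0 \<pi> M \<longleftrightarrow>
     projective_cover R P0 \<pi> M \<and> projective_cover R P1 d (mod_ker P0 M \<pi>)"

text \<open>
  The transpose and the syzygy are determined only up to isomorphism; they are
  rendered as relations, \<open>is_transpose R M T\<close> meaning that \<open>T\<close> is a transpose of \<open>M\<close>.
\<close>

definition is_transpose :: "('r, 'k) ring_scheme \<Rightarrow> ('r, 'a) module \<Rightarrow> ('r, 't) module \<Rightarrow> bool" where
  "is_transpose R M T \<longleftrightarrow>
     (\<exists>(P1 :: 'r umodule) d (P0 :: 'r umodule) \<pi>.
        min_proj_presentation R P1 d P0 \<pi> M \<and>
        mod_iso R T (mod_cok (dual R P0) (dual R P1) (dual_map P1 d)))"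

definition is_syzygy :: "('r, 'k) ring_scheme \<Rightarrow> ('r, 'a) module \<Rightarrow> ('r, 's) module \<Rightarrow> bool" where
  "is_syzygy R M N \<longleftrightarrow>
     (\<exists>(P :: 'r umodule) \<pi>. projective_cover R P \<pi> M \<and> mod_iso R N (mod_ker P M \<pi>))"

definition is_lambda :: "('r, 'k) ring_scheme \<Rightarrow> ('r, 'a) module \<Rightarrow> ('r, 's) module \<Rightarrow> bool" where
  "is_lambda R M L \<longleftrightarrow> (\<exists>T :: 'r umodule. is_transpose R M T \<and> is_syzygy R T L)"

definition horizontally_linked_module :: "('r, 'k) ring_scheme \<Rightarrow> ('r, 'a) module \<Rightarrow> bool" where
  "horizontally_linked_module R M \<longleftrightarrow>
     (\<exists>(L :: 'r umodule) (N :: 'r umodule).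
        is_lambda R M L \<and> is_lambda R L N \<and> mod_iso R M N)"


section \<open>The category of homomorphisms\<close>

record ('r, 'a, 'b) arrow =
  Dom :: "('r, 'a) module"
  Cod :: "('r, 'b) module"
  Arr :: "'a \<Rightarrow> 'b"

definition is_arrow :: "('r, 'k) ring_scheme \<Rightarrow> ('r, 'a, 'b) arrow \<Rightarrow> bool" where
  "is_arrow R F \<longleftrightarrow> module R (Dom F) \<and> module R (Cod F) \<and> Arr F \<in> mod_hom R (Dom F) (Cod F)"

text \<open>The objects of \<open>\<M>\<close> and of its subcategory \<open>\<S>\<close>.\<close>

definition M_obj :: "('r, 'k) ring_scheme \<Rightarrow> ('r, 'a, 'b) arrow \<Rightarrow> bool" where
  "M_obj R F \<longleftrightarrow> is_arrow R F \<and> fg_module R (Dom F) \<and> fg_module R (Cod F)"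

definition S_obj :: "('r, 'k) ring_scheme \<Rightarrow> ('r, 'a, 'b) arrow \<Rightarrow> bool" where
  "S_obj R F \<longleftrightarrow> M_obj R F \<and> inj_on (Arr F) (carrier (Dom F))"

definition arrow_hom ::
    "('r, 'k) ring_scheme \<Rightarrow> ('r, 'a, 'b) arrow \<Rightarrow> ('r, 'c, 'd) arrow \<Rightarrow> (('a \<Rightarrow> 'c) \<times> ('b \<Rightarrow> 'd)) set" where
  "arrow_hom R F G = {(a, b). a \<in> mod_hom R (Dom F) (Dom G) \<and> b \<in> mod_hom R (Cod F) (Cod G) \<and>
     (\<forall>x \<in> carrier (Dom F). Arr G (a x) = b (Arr F x))}"

definition arrow_iso ::
    "('r, 'k) ring_scheme \<Rightarrow> ('r, 'a, 'b) arrow \<Rightarrow> ('r, 'c, 'd) arrow \<Rightarrow> bool" where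
  "arrow_iso R F G \<longleftrightarrow> is_arrow R F \<and> is_arrow R G \<and>
     (\<exists>(a, b) \<in> arrow_hom R F G.
        bij_betw a (carrier (Dom F)) (carrier (Dom G)) \<and>
        bij_betw b (carrier (Cod F)) (carrier (Cod G)))"

definition arrow_ker ::
    "('r, 'a, 'b) arrow \<Rightarrow> ('r, 'c, 'd) arrow \<Rightarrow> ('a \<Rightarrow> 'c) \<times> ('b \<Rightarrow> 'd) \<Rightarrow> ('r, 'a, 'b) arrow" where
  "arrow_ker F G = (\<lambda>(a, b).
     \<lparr>Dom = mod_ker (Dom F) (Dom G) a, Cod = mod_ker (Cod F) (Cod G) b, Arr = Arr F\<rparr>)"

definition arrow_cok ::
    "('r, 'a, 'b) arrow \<Rightarrow> ('r, 'c, 'd) arrow \<Rightarrow> ('a \<Rightarrow> 'c) \<times> ('b \<Rightarrow> 'd) \<Rightarrow>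
     ('r, 'c set, 'd set) arrow" where
  "arrow_cok F G = (\<lambda>(a, b).
     \<lparr>Dom = mod_cok (Dom F) (Dom G) a, Cod = mod_cok (Cod F) (Cod G) b,
      Arr = (\<lambda>C. \<Union>x\<in>C. (b ` carrier (Cod F)) +>\<^bsub>Cod G\<^esub> Arr G x)\<rparr>)"

text \<open>The objects \<open>P \<rightarrow> P\<close> (identity) and \<open>0 \<rightarrow> P\<close>.\<close>

definition id_arrow :: "('r, 'p) module \<Rightarrow> ('r, 'p, 'p) arrow" where
  "id_arrow P = \<lparr>Dom = P, Cod = P, Arr = (\<lambda>x. x)\<rparr>"

definition zero_arrow :: "('r, 'p) module \<Rightarrow> ('r, 'p, 'p) arrow" where
  "zero_arrow P = \<lparr>Dom = zero_submodule P, Cod = P, Arr = (\<lambda>x. x)\<rparr>"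

definition arrow_dsum ::
    "('r, 'a, 'b) arrow \<Rightarrow> ('r, 'c, 'd) arrow \<Rightarrow> ('r, 'a \<times> 'c, 'b \<times> 'd) arrow" where
  "arrow_dsum F G = \<lparr>Dom = mod_dsum (Dom F) (Dom G), Cod = mod_dsum (Cod F) (Cod G),
     Arr = map_prod (Arr F) (Arr G)\<rparr>"

definition projective_arrow :: "('r, 'k) ring_scheme \<Rightarrow> ('r, 'p, 'q) arrow \<Rightarrow> bool" where
  "projective_arrow R F \<longleftrightarrow>
     (\<exists>(P :: 'r umodule) (Q :: 'r umodule).
        projective_module R P \<and> projective_module R Q \<and>
        arrow_iso R F (arrow_dsum (id_arrow P) (zero_arrow Q)))"

definition subarrow :: "('r, 'k) ring_scheme \<Rightarrow> ('r, 'a, 'b) arrow \<Rightarrow> 'a set \<Rightarrow> 'b set \<Rightarrow> bool" where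
  "subarrow R F M N \<longleftrightarrow> submodule M R (Dom F) \<and> submodule N R (Cod F) \<and> Arr F ` M \<subseteq> N"

definition superfluous_arrow ::
    "('r, 'k) ring_scheme \<Rightarrow> ('r, 'a, 'b) arrow \<Rightarrow> 'a set \<Rightarrow> 'b set \<Rightarrow> bool" where
  "superfluous_arrow R F K L \<longleftrightarrow>
     (\<forall>M N. subarrow R F M N \<and>
        M <+>\<^bsub>Dom F\<^esub> K = carrier (Dom F) \<and> N <+>\<^bsub>Cod F\<^esub> L = carrier (Cod F) \<longrightarrow>
        M = carrier (Dom F) \<and> N = carrier (Cod F))"

definition projective_cover_arrow ::
    "('r, 'k) ring_scheme \<Rightarrow> ('r, 'p, 'q) arrow \<Rightarrow> ('p \<Rightarrow> 'a) \<times> ('q \<Rightarrow> 'b) \<Rightarrow>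
     ('r, 'a, 'b) arrow \<Rightarrow> bool" where
  "projective_cover_arrow R P \<pi> F \<longleftrightarrow> projective_arrow R P \<and> \<pi> \<in> arrow_hom R P F \<and>
     fst \<pi> ` carrier (Dom P) = carrier (Dom F) \<and> snd \<pi> ` carrier (Cod P) = carrier (Cod F) \<and>
     superfluous_arrow R P (a_kernel (Dom P) (Dom F) (fst \<pi>)) (a_kernel (Cod P) (Cod F) (snd \<pi>))"

definition min_proj_presentation_arrow ::
    "('r, 'k) ring_scheme \<Rightarrow> ('r, 'p1, 'q1) arrow \<Rightarrow> ('p1 \<Rightarrow> 'p0) \<times> ('q1 \<Rightarrow> 'q0) \<Rightarrow>
     ('r, 'p0, 'q0) arrow \<Rightarrow> ('p0 \<Rightarrow> 'a) \<times> ('q0 \<Rightarrow> 'b) \<Rightarrow> ('r, 'a, 'b) arrow \<Rightarrow> bool" where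
  "min_proj_presentation_arrow R P1 d P0 \<pi> F \<longleftrightarrow>
     projective_cover_arrow R P0 \<pi> F \<and> projective_cover_arrow R P1 d (arrow_ker P0 F \<pi>)"


section \<open>Transpose and linkage in the category of homomorphisms\<close>

definition arrow_Hom ::
    "('r, 'k) ring_scheme \<Rightarrow> ('r, 'a, 'b) arrow \<Rightarrow> ('r, 'c, 'd) arrow \<Rightarrow>
     ('r, ('a \<Rightarrow> 'c) \<times> ('b \<Rightarrow> 'd)) module" where
  "arrow_Hom R F G =
     (let H = mod_dsum (Hom_module R (Dom F) (Dom G)) (Hom_module R (Cod F) (Cod G))
      in H\<lparr>carrier := carrier H \<inter> arrow_hom R F G\<rparr>)"

text \<open>
  \<open>F^*\<close> is the homomorphism from \<open>Hom(F, 0 \<rightarrow> R)\<close> to \<open>Hom(F, R \<rightarrow> R)\<close> induced by the inclusion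
  of \<open>0 \<rightarrow> R\<close> into \<open>R \<rightarrow> R\<close>.  As \<open>0\<close> is the zero submodule of \<open>R\<close>, composing with the inclusion
  does not change the underlying functions.
\<close>

definition arrow_star ::
    "('r, 'k) ring_scheme \<Rightarrow> ('r, 'a, 'b) arrow \<Rightarrow>
     ('r, ('a \<Rightarrow> 'r) \<times> ('b \<Rightarrow> 'r), ('a \<Rightarrow> 'r) \<times> ('b \<Rightarrow> 'r)) arrow" where
  "arrow_star R F =
     \<lparr>Dom = arrow_Hom R F (zero_arrow (self_module R)),
      Cod = arrow_Hom R F (id_arrow (self_module R)),
      Arr = (\<lambda>h. h)\<rparr>"

text \<open>
  The morphism \<open>G^* \<rightarrow> F^*\<close> induced by \<open>(a, b) : F \<rightarrow> G\<close>; both of its components are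
  precomposition with \<open>(a, b)\<close>.
\<close>

definition arrow_star_map ::
    "('r, 'a, 'b) arrow \<Rightarrow> ('a \<Rightarrow> 'c) \<times> ('b \<Rightarrow> 'd) \<Rightarrow>
     (('c \<Rightarrow> 'r) \<times> ('d \<Rightarrow> 'r) \<Rightarrow> ('a \<Rightarrow> 'r) \<times> ('b \<Rightarrow> 'r)) \<times>
     (('c \<Rightarrow> 'r) \<times> ('d \<Rightarrow> 'r) \<Rightarrow> ('a \<Rightarrow> 'r) \<times> ('b \<Rightarrow> 'r))" where
  "arrow_star_map F = (\<lambda>(a, b).
     let pre = map_prod (dual_map (Dom F) a) (dual_map (Cod F) b) in (pre, pre))"

type_synonym 'r uarrow = "('r, nat \<Rightarrow> 'r, nat \<Rightarrow> 'r) arrow"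

definition is_transpose_arrow ::
    "('r, 'k) ring_scheme \<Rightarrow> ('r, 'a, 'b) arrow \<Rightarrow> ('r, 's, 't) arrow \<Rightarrow> bool" where
  "is_transpose_arrow R F T \<longleftrightarrow>
     (\<exists>(P1 :: 'r uarrow) d (P0 :: 'r uarrow) \<pi>.
        min_proj_presentation_arrow R P1 d P0 \<pi> F \<and>
        arrow_iso R T (arrow_cok (arrow_star R P0) (arrow_star R P1) (arrow_star_map P1 d)))"

definition is_syzygy_arrow ::
    "('r, 'k) ring_scheme \<Rightarrow> ('r, 'a, 'b) arrow \<Rightarrow> ('r, 's, 't) arrow \<Rightarrow> bool" where
  "is_syzygy_arrow R F N \<longleftrightarrow>
     (\<exists>(P :: 'r uarrow) \<pi>. projective_cover_arrow R P \<pi> F \<and> arrow_iso R N (arrow_ker P F \<pi>))"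

definition is_lambda_arrow ::
    "('r, 'k) ring_scheme \<Rightarrow> ('r, 'a, 'b) arrow \<Rightarrow> ('r, 's, 't) arrow \<Rightarrow> bool" where
  "is_lambda_arrow R F L \<longleftrightarrow>
     (\<exists>T :: 'r uarrow. is_transpose_arrow R F T \<and> is_syzygy_arrow R T L)"

definition horizontally_linked_arrow ::
    "('r, 'k) ring_scheme \<Rightarrow> ('r, 'a, 'b) arrow \<Rightarrow> bool" where
  "horizontally_linked_arrow R F \<longleftrightarrow>
     (\<exists>(L :: 'r uarrow) (N :: 'r uarrow).
        is_lambda_arrow R F L \<and> is_lambda_arrow R L N \<and> arrow_iso R F N)"

end

theory Submission
  imports Defs
begin

text \<open>
  Write \<open>F n\<close> for the free module \<open>R^n\<close>, so that \<open>F a\<close> is a submodule of \<open>F b\<close> for \<open>a \<le> b\<close>.  A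
  monomorphism \<open>A \<rightarrow> B\<close> is the image of the inclusion \<open>F a \<rightarrow> F b\<close> under its minimal projective cover;
  let \<open>K\<close> be the kernel of \<open>F b \<rightarrow> B\<close>.  Dualising a minimal presentation shows that \<open>\<lambda>\<close> of this object
  is \<open>F (b - a) / (K^\<bottom> \<inter> F (b - a)) \<rightarrow> F b / K^\<bottom>\<close>, where \<open>K^\<bottom>\<close> consists of the
  functionals on \<open>F b\<close> vanishing on \<open>K\<close>, functionals being identified with elements of \<open>F b\<close> in such
  a way that those vanishing on \<open>F a\<close> form \<open>F (b - a)\<close>.
  If \<open>B\<close> is stable, every functional on \<open>B\<close> takes values in the maximal ideal, whence the new cover is
  again minimal and \<open>\<lambda>^2\<close> of the object is given by \<open>K^\<bottom>^\<bottom>\<close>.  This equals \<open>K\<close> if \<open>B\<close> is torsionless,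
  i.e. if the functionals on \<open>B\<close> separate points.  Conversely, a horizontally linked object is a
  syzygy, and so its target is contained in a projective module and torsionless.  The same argument
  applies to single modules; thus linkage of \<open>A \<rightarrow> B\<close> and linkage of \<open>B\<close> both amount to \<open>B\<close> being
  torsionless, and then the submodule \<open>A\<close> is torsionless too.
\<close>

section \<open>Homomorphisms and submodules\<close>

text \<open>The obstacle is that a projective cover in the category of homomorphisms need not be
  minimal in its second component. The module \<open>F a\<close> covers \<open>A\<close> minimally,
  but \<open>F b\<close> covers \<open>B\<close> minimally only relative to \<open>A\<close>, so
  \<open>K\<close> may contain vectors with unit coordinates below \<open>a\<close>. Containment of
  \<open>K\<close> in \<open>\<mm>\<close> times \<open>F b\<close> is therefore replaced by two
  conditions: on all of \<open>K\<close> the coordinates from \<open>a\<close> on lie in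
  \<open>\<mm>\<close>, and on the intersection of \<open>K\<close> with \<open>F a\<close> all
  coordinates do. Passing to the adjoint of a presentation lets the two conditions exchange roles,
  and this is what makes the cover of the transpose minimal. The relations for transpose and syzygy
  ask for some minimal presentation, so linkage is proved by exhibiting presentations by free
  modules. All objects met on the way are images of a fixed \<open>F b\<close>, or of a fixed
  inclusion into it, under maps with a known kernel; isomorphisms are then obtained by comparing
  kernels.\<close>

lemma mod_homI:
  assumes "\<And>x. x \<in> carrier M \<Longrightarrow> h x \<in> carrier N"
    and "\<And>x y. x \<in> carrier M \<Longrightarrow> y \<in> carrier M \<Longrightarrow> h (x \<oplus>\<^bsub>M\<^esub> y) = h x \<oplus>\<^bsub>N\<^esub> h y"
    and "\<And>r x. r \<in> carrier R \<Longrightarrow> x \<in> carrier M \<Longrightarrow> h (r \<odot>\<^bsub>M\<^esub> x) = r \<odot>\<^bsub>N\<^esub> h x"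
  shows "h \<in> mod_hom R M N"
  using assms unfolding mod_hom_def by auto

lemma mod_homD:
  assumes "h \<in> mod_hom R M N"
  shows mod_hom_closed: "x \<in> carrier M \<Longrightarrow> h x \<in> carrier N"
    and mod_hom_add: "x \<in> carrier M \<Longrightarrow> y \<in> carrier M \<Longrightarrow> h (x \<oplus>\<^bsub>M\<^esub> y) = h x \<oplus>\<^bsub>N\<^esub> h y"
    and mod_hom_smult: "r \<in> carrier R \<Longrightarrow> x \<in> carrier M \<Longrightarrow> h (r \<odot>\<^bsub>M\<^esub> x) = r \<odot>\<^bsub>N\<^esub> h x"
  using assms unfolding mod_hom_def by auto

lemma mod_hom_zero:
  assumes "module R M" "module R N" "h \<in> mod_hom R M N"
  shows "h \<zero>\<^bsub>M\<^esub> = \<zero>\<^bsub>N\<^esub>"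
proof -
  interpret M: module R M by fact
  interpret N: module R N by fact
  have "h \<zero>\<^bsub>M\<^esub> = h (\<zero>\<^bsub>R\<^esub> \<odot>\<^bsub>M\<^esub> \<zero>\<^bsub>M\<^esub>)" by simp
  also have "\<dots> = \<zero>\<^bsub>N\<^esub>" using mod_homD[OF assms(3)]
    by (subst mod_hom_smult[OF assms(3)]) auto
  finally show ?thesis .
qed

lemma mod_hom_neg:
  assumes "module R M" "module R N" "h \<in> mod_hom R M N" "x \<in> carrier M"
  shows "h (\<ominus>\<^bsub>M\<^esub> x) = \<ominus>\<^bsub>N\<^esub> h x"
proof -
  interpret M: module R M by fact
  interpret N: module R N by fact
  have "h (\<ominus>\<^bsub>M\<^esub> x) \<oplus>\<^bsub>N\<^esub> h x = \<zero>\<^bsub>N\<^esub>"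
    using mod_hom_zero[OF assms(1-3)] assms(4)
    by (simp add: M.M.l_neg flip: mod_hom_add[OF assms(3)])
  then show ?thesis
    using assms(4) mod_hom_closed[OF assms(3)] by (simp add: N.M.minus_equality)
qed

lemma mod_hom_minus:
  assumes "module R M" "module R N" "h \<in> mod_hom R M N" "x \<in> carrier M" "y \<in> carrier M"
  shows "h (x \<ominus>\<^bsub>M\<^esub> y) = h x \<ominus>\<^bsub>N\<^esub> h y"
proof -
  interpret M: module R M by fact
  show ?thesis
    using assms(4,5) mod_hom_neg[OF assms(1-3)] mod_hom_add[OF assms(3)]
    by (simp add: a_minus_def)
qed

lemma mod_hom_compose:
  assumes "g \<in> mod_hom R M N" "h \<in> mod_hom R N P"
  shows "(\<lambda>x. h (g x)) \<in> mod_hom R M P"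
  using mod_homD[OF assms(1)] mod_homD[OF assms(2)] by (intro mod_homI) simp_all

lemma mod_hom_cong:
  assumes "h \<in> mod_hom R M N" "module R M" "\<And>x. x \<in> carrier M \<Longrightarrow> h x = h' x"
  shows "h' \<in> mod_hom R M N"
proof -
  interpret M: module R M by fact
  show ?thesis using mod_homD[OF assms(1)] by (intro mod_homI) (simp_all flip: assms(3))
qed

lemma mod_hom_carrier_update:
  assumes "h \<in> mod_hom R M N" "H \<subseteq> carrier M" "h ` H \<subseteq> K"
  shows "h \<in> mod_hom R (M\<lparr>carrier := H\<rparr>) (N\<lparr>carrier := K\<rparr>)"
proof -
  have "x \<in> carrier M" if "x \<in> H" for x using that assms(2) by blast
  then show ?thesis using assms(3) mod_homD[OF assms(1)] by (intro mod_homI) auto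
qed

lemma mod_hom_id: "(\<lambda>x. x) \<in> mod_hom R M M"
  unfolding mod_hom_def by auto

lemma mod_hom_inv:
  assumes "module R M" "h \<in> mod_hom R M N" "bij_betw h (carrier M) (carrier N)"
  shows "inv_into (carrier M) h \<in> mod_hom R N M"
proof -
  interpret M: module R M by fact
  have inj: "inj_on h (carrier M)" and im: "h ` carrier M = carrier N"
    using assms(3) by (auto simp: bij_betw_def)
  have c: "inv_into (carrier M) h y \<in> carrier M" "h (inv_into (carrier M) h y) = y"
    if "y \<in> carrier N" for y
    using that im by (auto intro: inv_into_into f_inv_into_f)
  show ?thesis
    by (rule mod_homI)
       (auto simp: c mod_homD[OF assms(2)] intro!: inv_into_f_eq[OF inj])
qed

section \<open>Submodules: images, kernels, intersections, sums\<close>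

lemma submoduleI':
  assumes "module R M" "H \<subseteq> carrier M" "\<zero>\<^bsub>M\<^esub> \<in> H"
    and "\<And>x y. x \<in> H \<Longrightarrow> y \<in> H \<Longrightarrow> x \<oplus>\<^bsub>M\<^esub> y \<in> H"
    and sm: "\<And>r x. r \<in> carrier R \<Longrightarrow> x \<in> H \<Longrightarrow> r \<odot>\<^bsub>M\<^esub> x \<in> H"
  shows "submodule H R M"
proof -
  interpret M: module R M by fact
  show ?thesis
  proof (rule M.submoduleI)
    fix a assume a: "a \<in> H"
    then have "\<ominus>\<^bsub>M\<^esub> a = (\<ominus>\<^bsub>R\<^esub> \<one>\<^bsub>R\<^esub>) \<odot>\<^bsub>M\<^esub> a"
      using assms(2) M.smult_l_minus[of "\<one>\<^bsub>R\<^esub>" a] by auto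
    then show "\<ominus>\<^bsub>M\<^esub> a \<in> H" using sm[of "\<ominus>\<^bsub>R\<^esub> \<one>\<^bsub>R\<^esub>" a] a by simp
  qed (use assms in auto)
qed

lemma submoduleD:
  assumes "module R M" "submodule H R M"
  shows submodule_sub: "x \<in> H \<Longrightarrow> x \<in> carrier M"
    and submodule_zero: "\<zero>\<^bsub>M\<^esub> \<in> H"
    and submodule_add: "x \<in> H \<Longrightarrow> y \<in> H \<Longrightarrow> x \<oplus>\<^bsub>M\<^esub> y \<in> H"
    and submodule_smult: "r \<in> carrier R \<Longrightarrow> x \<in> H \<Longrightarrow> r \<odot>\<^bsub>M\<^esub> x \<in> H"
    and submodule_neg: "x \<in> H \<Longrightarrow> \<ominus>\<^bsub>M\<^esub> x \<in> H"
    and submodule_minus: "x \<in> H \<Longrightarrow> y \<in> H \<Longrightarrow> x \<ominus>\<^bsub>M\<^esub> y \<in> H"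
proof -
  interpret M: module R M by fact
  note S = M.submoduleE[OF assms(2)]
  show "x \<in> H \<Longrightarrow> x \<in> carrier M" using S by auto
  show "\<zero>\<^bsub>M\<^esub> \<in> H"
    using subgroup.one_closed[OF submodule.axioms(1)[OF assms(2)]] by simp
qed (use module.submoduleE[OF assms] in \<open>auto simp: a_minus_def\<close>)

lemma submodule_module:
  assumes "module R M" "submodule H R M"
  shows "module R (M\<lparr>carrier := H\<rparr>)"
  using submodule.submodule_is_module[OF assms(2,1)] .

lemma submodule_of_submodule:
  assumes "module R M" "submodule H R M"
  shows "submodule N R (M\<lparr>carrier := H\<rparr>) \<longleftrightarrow> submodule N R M \<and> N \<subseteq> H"
proof -
  note mH = submodule_module[OF assms]
  show ?thesis
  proof (intro iffI conjI)
    assume N: "submodule N R (M\<lparr>carrier := H\<rparr>)"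
    note D = submoduleD[OF mH N]
    show "N \<subseteq> H" using D(1) by auto
    show "submodule N R M"
      by (rule submoduleI'[OF assms(1)]) (use D submodule_sub[OF assms] in auto)
  next
    assume N: "submodule N R M \<and> N \<subseteq> H"
    note D = submoduleD[OF assms(1) conjunct1[OF N]]
    show "submodule N R (M\<lparr>carrier := H\<rparr>)"
      by (rule submoduleI'[OF mH]) (use D N in auto)
  qed
qed

lemma submodule_image:
  assumes "module R M" "module R N" "h \<in> mod_hom R M N" "submodule H R M"
  shows "submodule (h ` H) R N"
proof (rule submoduleI'[OF assms(2)])
  note D = submoduleD[OF assms(1,4)]
  note h = mod_homD[OF assms(3)]
  show "h ` H \<subseteq> carrier N" using D h by auto
  show "\<zero>\<^bsub>N\<^esub> \<in> h ` H" using D(2) mod_hom_zero[OF assms(1-3)] by force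
  show "x \<oplus>\<^bsub>N\<^esub> y \<in> h ` H" if a: "x \<in> h ` H" "y \<in> h ` H" for x y
  proof -
    obtain x' y' where xy: "x' \<in> H" "y' \<in> H" "x = h x'" "y = h y'" using a by blast
    then have "x \<oplus>\<^bsub>N\<^esub> y = h (x' \<oplus>\<^bsub>M\<^esub> y')" using h D(1) by simp
    then show ?thesis using D(3) xy by auto
  qed
  show "r \<odot>\<^bsub>N\<^esub> x \<in> h ` H" if a: "r \<in> carrier R" "x \<in> h ` H" for r x
  proof -
    obtain x' where xy: "x' \<in> H" "x = h x'" using a by blast
    then have "r \<odot>\<^bsub>N\<^esub> x = h (r \<odot>\<^bsub>M\<^esub> x')" using h D(1) a by simp
    then show ?thesis using D(4) xy a by auto
  qed
qed

lemma submodule_kernel: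
  assumes "module R M" "module R N" "h \<in> mod_hom R M N"
  shows "submodule {x \<in> carrier M. h x = \<zero>\<^bsub>N\<^esub>} R M"
proof -
  interpret M: module R M by fact
  interpret N: module R N by fact
  note h = mod_homD[OF assms(3)]
  show ?thesis
    by (rule submoduleI'[OF assms(1)]) (auto simp: h mod_hom_zero[OF assms])
qed

lemma submodule_Int:
  assumes "module R M" "submodule H R M" "submodule K R M"
  shows "submodule (H \<inter> K) R M"
  using submoduleD[OF assms(1,2)] submoduleD[OF assms(1,3)]
  by (intro submoduleI'[OF assms(1)]) auto

lemma submodule_zero_set:
  assumes "module R M"
  shows "submodule {\<zero>\<^bsub>M\<^esub>} R M"
proof -
  interpret M: module R M by fact
  show ?thesis by (rule submoduleI'[OF assms]) auto
qed

lemma submodule_carrier: "module R M \<Longrightarrow> submodule (carrier M) R M"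
  by (rule module.carrier_is_submodule)

lemma set_add_iff: "x \<in> H <+>\<^bsub>M\<^esub> K \<longleftrightarrow> (\<exists>a\<in>H. \<exists>b\<in>K. x = a \<oplus>\<^bsub>M\<^esub> b)"
  by (auto simp: set_add_def')

lemma submodule_sum:
  assumes "module R M" "submodule H R M" "submodule K R M"
  shows "submodule (H <+>\<^bsub>M\<^esub> K) R M"
proof -
  interpret M: module R M by fact
  note H = submoduleD[OF assms(1,2)] note K = submoduleD[OF assms(1,3)]
  show ?thesis
  proof (rule submoduleI'[OF assms(1)])
    show "H <+>\<^bsub>M\<^esub> K \<subseteq> carrier M" using H(1) K(1) by (auto simp: set_add_iff)
    show "\<zero>\<^bsub>M\<^esub> \<in> H <+>\<^bsub>M\<^esub> K"
      unfolding set_add_iff using H(2) K(2) M.M.r_zero[OF M.M.zero_closed] by metis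
    fix x y assume "x \<in> H <+>\<^bsub>M\<^esub> K" "y \<in> H <+>\<^bsub>M\<^esub> K"
    then obtain a b c d where abcd: "a \<in> H" "b \<in> K" "c \<in> H" "d \<in> K" "x = a \<oplus>\<^bsub>M\<^esub> b" "y = c \<oplus>\<^bsub>M\<^esub> d"
      unfolding set_add_iff by blast
    then have "x \<oplus>\<^bsub>M\<^esub> y = (a \<oplus>\<^bsub>M\<^esub> c) \<oplus>\<^bsub>M\<^esub> (b \<oplus>\<^bsub>M\<^esub> d)"
      using H(1) K(1) by (simp add: M.M.a_ac)
    then show "x \<oplus>\<^bsub>M\<^esub> y \<in> H <+>\<^bsub>M\<^esub> K"
      unfolding set_add_iff using H(3)[OF abcd(1,3)] K(3)[OF abcd(2,4)] by blast
  next
    fix r x assume r: "r \<in> carrier R" and "x \<in> H <+>\<^bsub>M\<^esub> K"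
    then obtain a b where ab: "a \<in> H" "b \<in> K" "x = a \<oplus>\<^bsub>M\<^esub> b" unfolding set_add_iff by blast
    then have "r \<odot>\<^bsub>M\<^esub> x = r \<odot>\<^bsub>M\<^esub> a \<oplus>\<^bsub>M\<^esub> r \<odot>\<^bsub>M\<^esub> b"
      using H(1) K(1) r by (simp add: M.smult_r_distr)
    then show "r \<odot>\<^bsub>M\<^esub> x \<in> H <+>\<^bsub>M\<^esub> K"
      unfolding set_add_iff using H(4)[OF r ab(1)] K(4)[OF r ab(2)] by blast
  qed
qed

lemma subset_set_add:
  assumes "module R M" "submodule H R M" "submodule K R M"
  shows "H \<subseteq> H <+>\<^bsub>M\<^esub> K" "K \<subseteq> H <+>\<^bsub>M\<^esub> K"
proof -
  interpret M: module R M by fact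
  note H = submoduleD[OF assms(1,2)] note K = submoduleD[OF assms(1,3)]
  show "H \<subseteq> H <+>\<^bsub>M\<^esub> K"
    unfolding set_add_iff subset_iff using K(2) H(1) M.M.r_zero by metis
  show "K \<subseteq> H <+>\<^bsub>M\<^esub> K"
    unfolding set_add_iff subset_iff using H(2) K(1) M.M.l_zero by metis
qed

text \<open>The module axioms are identities and the existence of negatives, so they pass to the
  image of a surjection respecting the operations. As \<open>Q\<close> is not assumed to be a
  module, this one lemma serves quotients, duals, Hom modules in the category of homomorphisms and
  copies.\<close>

lemma module_image:
  assumes "module R M" and im: "q ` carrier M = carrier Q"
    and add: "\<And>x y. x \<in> carrier M \<Longrightarrow> y \<in> carrier M \<Longrightarrow> q (x \<oplus>\<^bsub>M\<^esub> y) = q x \<oplus>\<^bsub>Q\<^esub> q y"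
    and smult: "\<And>r x. r \<in> carrier R \<Longrightarrow> x \<in> carrier M \<Longrightarrow> q (r \<odot>\<^bsub>M\<^esub> x) = r \<odot>\<^bsub>Q\<^esub> q x"
    and zero: "q \<zero>\<^bsub>M\<^esub> = \<zero>\<^bsub>Q\<^esub>"
  shows "module R Q" and "q \<in> mod_hom R M Q"
proof -
  interpret M: module R M by fact
  have cl: "q x \<in> carrier Q" if "x \<in> carrier M" for x using that by (simp flip: im)
  have all: "(\<And>x. x \<in> carrier M \<Longrightarrow> P (q x)) \<Longrightarrow> y \<in> carrier Q \<Longrightarrow> P y" for P y
    by (auto simp flip: im)
  have pre: "\<exists>x\<in>carrier M. y = q x" if "y \<in> carrier Q" for y
    using that by (auto simp flip: im)
  have inv: "\<exists>y\<in>carrier Q. y \<oplus>\<^bsub>Q\<^esub> q x = \<zero>\<^bsub>Q\<^esub>" if "x \<in> carrier M" for x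
    using that cl by (intro bexI[of _ "q (\<ominus>\<^bsub>M\<^esub> x)"]) (simp_all add: M.M.l_neg zero flip: add)
  show "module R Q"
  proof (rule moduleI)
    show "cring R" by unfold_locales
    show "abelian_group Q"
    proof (rule abelian_groupI)
      show "x \<oplus>\<^bsub>Q\<^esub> y \<in> carrier Q" if "x \<in> carrier Q" "y \<in> carrier Q" for x y
        using that(1) by (rule all[rotated]) (use that(2) in \<open>rule all[rotated], simp add: cl flip: add\<close>)
      show "\<zero>\<^bsub>Q\<^esub> \<in> carrier Q" using cl zero by fastforce
      show "x \<oplus>\<^bsub>Q\<^esub> y \<oplus>\<^bsub>Q\<^esub> z = x \<oplus>\<^bsub>Q\<^esub> (y \<oplus>\<^bsub>Q\<^esub> z)"
        if xyz: "x \<in> carrier Q" "y \<in> carrier Q" "z \<in> carrier Q" for x y z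
      proof -
        obtain x' y' z' where "x = q x'" "y = q y'" "z = q z'" "x' \<in> carrier M" "y' \<in> carrier M" "z' \<in> carrier M"
          using pre[OF xyz(1)] pre[OF xyz(2)] pre[OF xyz(3)] by blast
        then show ?thesis by (simp add: M.M.a_assoc flip: add)
      qed
      show "x \<oplus>\<^bsub>Q\<^esub> y = y \<oplus>\<^bsub>Q\<^esub> x" if xyz: "x \<in> carrier Q" "y \<in> carrier Q" for x y
      proof -
        obtain x' y' where "x = q x'" "y = q y'" "x' \<in> carrier M" "y' \<in> carrier M"
          using pre[OF xyz(1)] pre[OF xyz(2)] by blast
        then show ?thesis by (simp add: M.M.a_comm flip: add)
      qed
      show "\<zero>\<^bsub>Q\<^esub> \<oplus>\<^bsub>Q\<^esub> x = x" if "x \<in> carrier Q" for x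
        using that by (rule all[rotated]) (simp flip: add zero)
      show "\<exists>y\<in>carrier Q. y \<oplus>\<^bsub>Q\<^esub> x = \<zero>\<^bsub>Q\<^esub>" if "x \<in> carrier Q" for x
        using that by (rule all[rotated]) (rule inv)
    qed
  next
    fix a x assume a: "a \<in> carrier R" and x: "x \<in> carrier Q"
    obtain x' where x': "x = q x'" "x' \<in> carrier M" using pre[OF x] by blast
    show "a \<odot>\<^bsub>Q\<^esub> x \<in> carrier Q" using a x' cl by (simp flip: smult)
    show "(a \<oplus>\<^bsub>R\<^esub> b) \<odot>\<^bsub>Q\<^esub> x = (a \<odot>\<^bsub>Q\<^esub> x) \<oplus>\<^bsub>Q\<^esub> (b \<odot>\<^bsub>Q\<^esub> x)" if "b \<in> carrier R" for b
      using a x' that by (simp add: M.smult_l_distr flip: add smult)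
    show "a \<odot>\<^bsub>Q\<^esub> (x \<oplus>\<^bsub>Q\<^esub> y) = (a \<odot>\<^bsub>Q\<^esub> x) \<oplus>\<^bsub>Q\<^esub> (a \<odot>\<^bsub>Q\<^esub> y)" if "y \<in> carrier Q" for y
      using pre[OF that] a x' by (auto simp: M.smult_r_distr simp flip: add smult)
    show "(a \<otimes>\<^bsub>R\<^esub> b) \<odot>\<^bsub>Q\<^esub> x = a \<odot>\<^bsub>Q\<^esub> (b \<odot>\<^bsub>Q\<^esub> x)" if "b \<in> carrier R" for b
      using a x' that by (simp add: M.smult_assoc1 flip: add smult)
  next
    fix x assume "x \<in> carrier Q"
    from pre[OF this] show "\<one>\<^bsub>R\<^esub> \<odot>\<^bsub>Q\<^esub> x = x" by (auto simp flip: smult)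
  qed
  show "q \<in> mod_hom R M Q" using cl add smult by (intro mod_homI)
qed

lemma (in abelian_group) minus_eq_zero_iff:
  assumes "x \<in> carrier G" "y \<in> carrier G"
  shows "x \<ominus> y = \<zero> \<longleftrightarrow> x = y"
  using assms unfolding a_minus_def
  by (metis a_inv_closed minus_equality minus_minus r_neg)

text \<open>The induced map is \<open>g\<close> after a set-theoretic section \<open>s\<close> of
  \<open>q\<close>. It is linear because two preimages of one element differ by a member of the
  kernel of \<open>q\<close>, on which \<open>g\<close> vanishes.\<close>

lemma mod_hom_factor:
  assumes "module R P" "module R M" "module R N" "q \<in> mod_hom R P M" "g \<in> mod_hom R P N"
    and surj: "q ` carrier P = carrier M"
    and ker: "\<And>x. x \<in> carrier P \<Longrightarrow> q x = \<zero>\<^bsub>M\<^esub> \<Longrightarrow> g x = \<zero>\<^bsub>N\<^esub>"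
  obtains h where "h \<in> mod_hom R M N" "\<And>x. x \<in> carrier P \<Longrightarrow> h (q x) = g x"
proof -
  interpret P: module R P by fact
  interpret M: module R M by fact
  interpret N: module R N by fact
  note q = mod_homD[OF assms(4)] note g = mod_homD[OF assms(5)]
  define s where "s = inv_into (carrier P) q"
  have s: "s y \<in> carrier P" "q (s y) = y" if "y \<in> carrier M" for y
    using that surj by (auto simp: s_def intro: inv_into_into f_inv_into_f)
  have eq: "g x = g y" if xy: "x \<in> carrier P" "y \<in> carrier P" "q x = q y" for x y
  proof -
    have "q (x \<ominus>\<^bsub>P\<^esub> y) = \<zero>\<^bsub>M\<^esub>"
      using xy q(1) M.M.minus_eq_zero_iff[of "q x" "q y"] by (simp add: mod_hom_minus[OF assms(1,2,4)])
    then have "g (x \<ominus>\<^bsub>P\<^esub> y) = \<zero>\<^bsub>N\<^esub>" using xy by (intro ker) simp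
    then show ?thesis
      using xy g(1) N.M.minus_eq_zero_iff[of "g x" "g y"] by (simp add: mod_hom_minus[OF assms(1,3,5)])
  qed
  have gs: "g (s (q x)) = g x" if "x \<in> carrier P" for x
    using that s q by (intro eq) auto
  show thesis
  proof
    show "(\<lambda>y. g (s y)) (q x) = g x" if "x \<in> carrier P" for x using gs that .
    show "(\<lambda>y. g (s y)) \<in> mod_hom R M N"
    proof (rule mod_homI)
      fix x y assume xy: "x \<in> carrier M" "y \<in> carrier M"
      have "g (s (x \<oplus>\<^bsub>M\<^esub> y)) = g (s x \<oplus>\<^bsub>P\<^esub> s y)"
        using gs[of "s x \<oplus>\<^bsub>P\<^esub> s y"] xy s q by simp
      then show "g (s (x \<oplus>\<^bsub>M\<^esub> y)) = g (s x) \<oplus>\<^bsub>N\<^esub> g (s y)" using xy s g by simp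
    next
      fix r x assume xy: "r \<in> carrier R" "x \<in> carrier M"
      have "g (s (r \<odot>\<^bsub>M\<^esub> x)) = g (r \<odot>\<^bsub>P\<^esub> s x)"
        using gs[of "r \<odot>\<^bsub>P\<^esub> s x"] xy s q by simp
      then show "g (s (r \<odot>\<^bsub>M\<^esub> x)) = r \<odot>\<^bsub>N\<^esub> g (s x)" using xy s g by simp
    qed (use s g in auto)
  qed
qed

text \<open>Factoring each surjection through the other gives two mutually inverse maps. The
  isomorphisms required for linkage are produced in this way, from quotients of one free
  module.\<close>

lemma mod_iso_from_equal_kernels:
  assumes "module R P" "module R M" "module R N" "q \<in> mod_hom R P M" "q' \<in> mod_hom R P N"
    and q: "q ` carrier P = carrier M" and q': "q' ` carrier P = carrier N"
    and ker: "\<And>x. x \<in> carrier P \<Longrightarrow> q x = \<zero>\<^bsub>M\<^esub> \<longleftrightarrow> q' x = \<zero>\<^bsub>N\<^esub>"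
  obtains h where "h \<in> mod_hom R M N" "bij_betw h (carrier M) (carrier N)"
    "\<And>x. x \<in> carrier P \<Longrightarrow> h (q x) = q' x"
proof -
  obtain h where h: "h \<in> mod_hom R M N" "\<And>x. x \<in> carrier P \<Longrightarrow> h (q x) = q' x"
    using mod_hom_factor[OF assms(1-5) q] ker by metis
  obtain h' where h': "h' \<in> mod_hom R N M" "\<And>x. x \<in> carrier P \<Longrightarrow> h' (q' x) = q x"
    using mod_hom_factor[OF assms(1,3,2,5,4) q'] ker by metis
  have "bij_betw h (carrier M) (carrier N)"
    by (rule bij_betw_byWitness[where f' = h'])
       (use h h' in \<open>auto simp flip: q q'\<close>)
  from that[OF h(1) this h(2)] show thesis .
qed

section \<open>Free modules of finite rank\<close>

text \<open>
  Neither the zero nor the operations of \<open>free_mod R n\<close> depend on \<open>n\<close>: the modules form an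
  increasing chain of submodules.
\<close>

definition free_mod :: "('r, 'k) ring_scheme \<Rightarrow> nat \<Rightarrow> 'r umodule" where
  "free_mod R n = \<lparr>carrier = {v. (\<forall>i. v i \<in> carrier R) \<and> (\<forall>i\<ge>n. v i = \<zero>\<^bsub>R\<^esub>)},
     monoid.mult = (\<lambda>_ _. undefined), one = undefined,
     ring.zero = (\<lambda>_. \<zero>\<^bsub>R\<^esub>), add = (\<lambda>v w i. v i \<oplus>\<^bsub>R\<^esub> w i),
     smult = (\<lambda>r v i. r \<otimes>\<^bsub>R\<^esub> v i)\<rparr>"

definition unit_vec :: "('r, 'k) ring_scheme \<Rightarrow> nat \<Rightarrow> nat \<Rightarrow> 'r" where
  "unit_vec R i = (\<lambda>j. if j = i then \<one>\<^bsub>R\<^esub> else \<zero>\<^bsub>R\<^esub>)"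

definition truncate :: "('r, 'k) ring_scheme \<Rightarrow> nat \<Rightarrow> (nat \<Rightarrow> 'r) \<Rightarrow> nat \<Rightarrow> 'r" where
  "truncate R n v = (\<lambda>i. if i < n then v i else \<zero>\<^bsub>R\<^esub>)"

text \<open>The coefficient vector comes last, so that \<open>lin_comb M y n\<close> is itself the
  homomorphism from \<open>R^n\<close> that sends the unit vectors to the
  \<open>y i\<close>.\<close>

definition lin_comb :: "('r, 'a) module \<Rightarrow> (nat \<Rightarrow> 'a) \<Rightarrow> nat \<Rightarrow> (nat \<Rightarrow> 'r) \<Rightarrow> 'a" where
  "lin_comb M y n v = (\<Oplus>\<^bsub>M\<^esub>i\<in>{..<n}. v i \<odot>\<^bsub>M\<^esub> y i)"

lemma free_mod_simps [simp]:
  "\<zero>\<^bsub>free_mod R n\<^esub> = (\<lambda>_. \<zero>\<^bsub>R\<^esub>)"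
  "v \<oplus>\<^bsub>free_mod R n\<^esub> w = (\<lambda>i. v i \<oplus>\<^bsub>R\<^esub> w i)"
  "r \<odot>\<^bsub>free_mod R n\<^esub> v = (\<lambda>i. r \<otimes>\<^bsub>R\<^esub> v i)"
  by (simp_all add: free_mod_def)

lemma free_mod_carrier:
  "v \<in> carrier (free_mod R n) \<longleftrightarrow> (\<forall>i. v i \<in> carrier R) \<and> (\<forall>i\<ge>n. v i = \<zero>\<^bsub>R\<^esub>)"
  by (simp add: free_mod_def)

lemma free_mod_carrier_update: "free_mod R n\<lparr>carrier := carrier (free_mod R k)\<rparr> = free_mod R k"
  by (simp add: free_mod_def)

lemma free_mod_mono: "k \<le> n \<Longrightarrow> v \<in> carrier (free_mod R k) \<Longrightarrow> v \<in> carrier (free_mod R n)"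
  by (auto simp: free_mod_carrier)

lemma mod_hom_free_mod_mono:
  "k \<le> n \<Longrightarrow> q \<in> mod_hom R (free_mod R n) M \<Longrightarrow> q \<in> mod_hom R (free_mod R k) M"
  by (rule mod_homI) (auto dest: mod_homD free_mod_mono)

context cring
begin

lemma free_mod_module: "module R (free_mod R n)"
proof (rule moduleI)
  show "cring R" by unfold_locales
  show "abelian_group (free_mod R n)"
  proof (rule abelian_groupI)
    fix x assume x: "x \<in> carrier (free_mod R n)"
    show "\<exists>y\<in>carrier (free_mod R n). y \<oplus>\<^bsub>free_mod R n\<^esub> x = \<zero>\<^bsub>free_mod R n\<^esub>"
      using x by (intro bexI[of _ "\<lambda>i. \<ominus> x i"]) (auto simp: free_mod_carrier l_neg)
  qed (auto simp: free_mod_carrier a_ac)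
qed (auto simp: free_mod_carrier l_distr r_distr m_assoc)

lemma free_mod_neg: "v \<in> carrier (free_mod R n) \<Longrightarrow> \<ominus>\<^bsub>free_mod R n\<^esub> v = (\<lambda>i. \<ominus> v i)"
proof -
  assume v: "v \<in> carrier (free_mod R n)"
  interpret F: module R "free_mod R n" by (rule free_mod_module)
  show ?thesis
    by (rule F.M.minus_equality) (use v in \<open>auto simp: free_mod_carrier l_neg\<close>)
qed

lemma free_mod_minus:
  assumes "v \<in> carrier (free_mod R n)" "w \<in> carrier (free_mod R n)"
  shows "v \<ominus>\<^bsub>free_mod R n\<^esub> w = (\<lambda>i. v i \<ominus> w i)"
  using assms by (simp add: a_minus_def free_mod_neg)

lemma unit_vec_carrier [simp]: "i < n \<Longrightarrow> unit_vec R i \<in> carrier (free_mod R n)"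
  by (auto simp: unit_vec_def free_mod_carrier)

lemma truncate_carrier:
  "v \<in> carrier (free_mod R n) \<Longrightarrow> truncate R k v \<in> carrier (free_mod R k)"
  "v \<in> carrier (free_mod R n) \<Longrightarrow> truncate R k v \<in> carrier (free_mod R n)"
  by (auto simp: truncate_def free_mod_carrier)

lemma truncate_id: "v \<in> carrier (free_mod R n) \<Longrightarrow> truncate R n v = v"
  by (auto simp: truncate_def free_mod_carrier fun_eq_iff)

lemma submodule_free_mod: "k \<le> n \<Longrightarrow> submodule (carrier (free_mod R k)) R (free_mod R n)"
  by (rule submoduleI'[OF free_mod_module]) (auto simp: free_mod_carrier)

section \<open>Homomorphisms out of free modules as linear combinations\<close>

lemma lin_comb_closed:
  assumes "module R M" "\<And>i. i < n \<Longrightarrow> y i \<in> carrier M" "\<And>i. i < n \<Longrightarrow> v i \<in> carrier R"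
  shows "lin_comb M y n v \<in> carrier M"
proof -
  interpret M: module R M by fact
  show ?thesis unfolding lin_comb_def using assms by (intro M.M.finsum_closed) auto
qed

lemma lin_comb_0 [simp]: "module R M \<Longrightarrow> lin_comb M y 0 v = \<zero>\<^bsub>M\<^esub>"
proof -
  assume "module R M"
  then interpret M: module R M .
  show ?thesis by (simp add: lin_comb_def)
qed

lemma lin_comb_Suc:
  assumes "module R M" "\<And>i. i < Suc n \<Longrightarrow> y i \<in> carrier M" "\<And>i. i < Suc n \<Longrightarrow> v i \<in> carrier R"
  shows "lin_comb M y (Suc n) v = lin_comb M y n v \<oplus>\<^bsub>M\<^esub> v n \<odot>\<^bsub>M\<^esub> y n"
proof -
  interpret M: module R M by fact
  show ?thesis unfolding lin_comb_def lessThan_Suc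
    using assms by (subst M.M.finsum_insert) (auto intro!: M.M.a_comm M.M.finsum_closed)
qed

lemma lin_comb_hom:
  assumes "module R M" "\<And>i. i < n \<Longrightarrow> y i \<in> carrier M"
  shows "lin_comb M y n \<in> mod_hom R (free_mod R n) M"
proof -
  interpret M: module R M by fact
  show ?thesis
  proof (rule mod_homI)
    fix v w assume "v \<in> carrier (free_mod R n)" "w \<in> carrier (free_mod R n)"
    then have vw: "v i \<in> carrier R" "w i \<in> carrier R" for i by (auto simp: free_mod_carrier)
    have "lin_comb M y k (\<lambda>i. v i \<oplus> w i) = lin_comb M y k v \<oplus>\<^bsub>M\<^esub> lin_comb M y k w" if "k \<le> n" for k
      using that
    proof (induction k)
      case (Suc k)
      then show ?case using assms(2) vw lin_comb_closed[OF assms(1), of k y]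
        by (simp add: assms(1) lin_comb_Suc M.smult_l_distr M.M.a_ac)
    qed (simp add: assms(1))
    then show "lin_comb M y n (v \<oplus>\<^bsub>free_mod R n\<^esub> w) = lin_comb M y n v \<oplus>\<^bsub>M\<^esub> lin_comb M y n w" by simp
  next
    fix r v assume r: "r \<in> carrier R" and "v \<in> carrier (free_mod R n)"
    then have v: "v i \<in> carrier R" for i by (auto simp: free_mod_carrier)
    have "lin_comb M y k (\<lambda>i. r \<otimes> v i) = r \<odot>\<^bsub>M\<^esub> lin_comb M y k v" if "k \<le> n" for k
      using that
    proof (induction k)
      case (Suc k)
      then show ?case using assms(2) v r lin_comb_closed[OF assms(1), of k y v]
        by (simp add: assms(1) lin_comb_Suc M.smult_r_distr M.smult_assoc1)
    qed (simp add: assms(1) r)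
    then show "lin_comb M y n (r \<odot>\<^bsub>free_mod R n\<^esub> v) = r \<odot>\<^bsub>M\<^esub> lin_comb M y n v" by simp
  qed (use lin_comb_closed[OF assms(1)] assms(2) in \<open>auto simp: free_mod_carrier\<close>)
qed

lemma lin_comb_unit_vec:
  assumes "module R M" "\<And>i. i < n \<Longrightarrow> y i \<in> carrier M" "j < n"
  shows "lin_comb M y n (unit_vec R j) = y j"
proof -
  interpret M: module R M by fact
  have *: "lin_comb M y k (unit_vec R j) = (if j < k then y j else \<zero>\<^bsub>M\<^esub>)" if "k \<le> n" for k
    using that
  proof (induction k)
    case (Suc k)
    have "lin_comb M y (Suc k) (unit_vec R j)
        = lin_comb M y k (unit_vec R j) \<oplus>\<^bsub>M\<^esub> unit_vec R j k \<odot>\<^bsub>M\<^esub> y k"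
      using Suc assms by (intro lin_comb_Suc) (auto simp: unit_vec_def)
    then show ?case using Suc assms(2)[of k] assms(2)[of j] assms(3)
      by (cases "j = k") (auto simp: unit_vec_def)
  qed (simp add: assms(1))
  show ?thesis using *[of n] assms(3) by simp
qed

lemma hom_eq_lin_comb:
  assumes "module R M" "h \<in> mod_hom R (free_mod R n) M" "v \<in> carrier (free_mod R n)"
  shows "h v = lin_comb M (\<lambda>i. h (unit_vec R i)) n v"
proof -
  interpret M: module R M by fact
  note h = mod_homD[OF assms(2)]
  have v: "v i \<in> carrier R" for i using assms(3) by (auto simp: free_mod_carrier)
  \<comment> \<open>Induction on the number of coordinates kept: passing from \<open>k\<close> to
    \<open>Suc k\<close> adds the multiple \<open>v k\<close> of the unit vector at
    \<open>k\<close>, and truncation at \<open>n\<close> leaves \<open>v\<close> unchanged.\<close>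
  have "h (truncate R k v) = lin_comb M (\<lambda>i. h (unit_vec R i)) k v" if "k \<le> n" for k
    using that
  proof (induction k)
    case 0
    have "truncate R 0 v = \<zero>\<^bsub>free_mod R n\<^esub>" by (simp add: truncate_def)
    then show ?case using mod_hom_zero[OF free_mod_module assms(1,2)] by (simp add: assms(1))
  next
    case (Suc k)
    have tr: "truncate R k v \<in> carrier (free_mod R n)" using truncate_carrier assms(3) by auto
    have "truncate R (Suc k) v = truncate R k v \<oplus>\<^bsub>free_mod R n\<^esub> v k \<odot>\<^bsub>free_mod R n\<^esub> unit_vec R k"
      using v by (auto simp: truncate_def unit_vec_def fun_eq_iff less_Suc_eq)
    moreover have "v k \<odot>\<^bsub>free_mod R n\<^esub> unit_vec R k \<in> carrier (free_mod R n)"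
      using Suc.prems v by (intro module.smult_closed[OF free_mod_module]) auto
    ultimately have "h (truncate R (Suc k) v) = h (truncate R k v) \<oplus>\<^bsub>M\<^esub> v k \<odot>\<^bsub>M\<^esub> h (unit_vec R k)"
      using h(2)[OF tr] h(3)[OF v[of k], of "unit_vec R k"] Suc.prems by simp
    also have "\<dots> = lin_comb M (\<lambda>i. h (unit_vec R i)) (Suc k) v"
      using Suc v h(1) by (simp add: lin_comb_Suc[OF assms(1)])
    finally show ?case .
  qed
  from this[of n] show ?thesis by (simp add: truncate_id[OF assms(3)])
qed

lemma hom_eqI:
  assumes "module R M" "h \<in> mod_hom R (free_mod R n) M" "h' \<in> mod_hom R (free_mod R n) M"
    and "\<And>i. i < n \<Longrightarrow> h (unit_vec R i) = h' (unit_vec R i)" "v \<in> carrier (free_mod R n)"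
  shows "h v = h' v"
proof -
  interpret M: module R M by fact
  have v: "v i \<in> carrier R" for i using assms(5) by (auto simp: free_mod_carrier)
  show ?thesis
    unfolding hom_eq_lin_comb[OF assms(1,2,5)] hom_eq_lin_comb[OF assms(1,3,5)] lin_comb_def
    using assms(4) mod_hom_closed[OF assms(3)] v by (intro M.M.finsum_cong) (auto simp: simp_implies_def)
qed

end

section \<open>The reversed pairing\<close>

text \<open>
  Reversing the order of the coordinates in one argument makes the annihilator of \<open>free_mod R a\<close> in
  \<open>free_mod R n\<close> equal to \<open>free_mod R (n - a)\<close>; this turns \<open>F^*\<close>, for the inclusion \<open>F\<close> of the former
  module into \<open>free_mod R n\<close>, into an inclusion of the same kind.
\<close>

definition pairing :: "('r, 'k) ring_scheme \<Rightarrow> nat \<Rightarrow> (nat \<Rightarrow> 'r) \<Rightarrow> (nat \<Rightarrow> 'r) \<Rightarrow> 'r" where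
  "pairing R n v w = lin_comb (self_module R) (\<lambda>i. w (n - 1 - i)) n v"

definition annihilator :: "('r, 'k) ring_scheme \<Rightarrow> nat \<Rightarrow> (nat \<Rightarrow> 'r) set \<Rightarrow> (nat \<Rightarrow> 'r) set" where
  "annihilator R n K = {w \<in> carrier (free_mod R n). \<forall>v\<in>K. pairing R n v w = \<zero>\<^bsub>R\<^esub>}"

text \<open>The matrix of \<open>d\<close> reflected in its antidiagonal, i.e. the transpose with
  respect to the reversed pairings on both sides. Coordinate \<open>i\<close> is recovered by
  pairing with the unit vector at \<open>k - 1 - i\<close>, hence the index.\<close>

definition adjoint ::
    "('r, 'k) ring_scheme \<Rightarrow> nat \<Rightarrow> nat \<Rightarrow> ((nat \<Rightarrow> 'r) \<Rightarrow> (nat \<Rightarrow> 'r)) \<Rightarrow> (nat \<Rightarrow> 'r) \<Rightarrow> (nat \<Rightarrow> 'r)" where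
  "adjoint R k n d w =
     (\<lambda>i. if i < k then pairing R n (d (unit_vec R (k - 1 - i))) w else \<zero>\<^bsub>R\<^esub>)"

text \<open>Generation is expressed by containment in submodules rather than by linear combinations,
  and relative to the ambient module; statements about generators then reduce to exhibiting suitable
  submodules.\<close>

definition fin_gen :: "('r, 'k) ring_scheme \<Rightarrow> ('r, 'a) module \<Rightarrow> 'a set \<Rightarrow> bool" where
  "fin_gen R M H \<longleftrightarrow> (\<exists>Y. finite Y \<and> Y \<subseteq> H \<and> (\<forall>N. submodule N R M \<longrightarrow> Y \<subseteq> N \<longrightarrow> H \<subseteq> N))"

lemma self_module_simps [simp]:
  "carrier (self_module R) = carrier R" "\<zero>\<^bsub>self_module R\<^esub> = \<zero>\<^bsub>R\<^esub>"
  "x \<oplus>\<^bsub>self_module R\<^esub> y = x \<oplus>\<^bsub>R\<^esub> y" "x \<odot>\<^bsub>self_module R\<^esub> y = x \<otimes>\<^bsub>R\<^esub> y"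
  by (simp_all add: self_module_def)

lemma free_mod_carrierI:
  "(\<And>i. v i \<in> carrier R) \<Longrightarrow> (\<And>i. n \<le> i \<Longrightarrow> v i = \<zero>\<^bsub>R\<^esub>) \<Longrightarrow> v \<in> carrier (free_mod R n)"
  by (simp add: free_mod_carrier)

context cring
begin

lemma self_module_module: "module R (self_module R)"
proof (rule moduleI)
  show "cring R" by unfold_locales
  show "abelian_group (self_module R)"
    by (rule abelian_groupI) (auto simp: a_ac intro: l_neg)
qed (auto simp: l_distr r_distr m_assoc)

lemma pairing_hom:
  assumes "w \<in> carrier (free_mod R n)"
  shows "(\<lambda>v. pairing R n v w) \<in> mod_hom R (free_mod R n) (self_module R)"
  unfolding pairing_def using assms
  by (intro lin_comb_hom[OF self_module_module]) (auto simp: free_mod_carrier)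

lemma lin_comb_self_module:
  assumes "\<And>i. i < n \<Longrightarrow> y i \<in> carrier R" "\<And>i. i < n \<Longrightarrow> v i \<in> carrier R"
  shows "lin_comb (self_module R) y n v = (\<Oplus>i\<in>{..<n}. v i \<otimes> y i)"
  using assms
proof (induction n)
  case (Suc n)
  have "(\<Oplus>i\<in>{..<Suc n}. v i \<otimes> y i) = v n \<otimes> y n \<oplus> (\<Oplus>i\<in>{..<n}. v i \<otimes> y i)"
    unfolding lessThan_Suc using Suc.prems by (intro finsum_insert) auto
  moreover have "(\<Oplus>i\<in>{..<n}. v i \<otimes> y i) \<in> carrier R"
    using Suc.prems by (intro finsum_closed) auto
  ultimately show ?case
    using Suc by (simp add: lin_comb_Suc[OF self_module_module] a_comm)
qed (simp add: self_module_module)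

lemma pairing_eq_sum:
  assumes "v \<in> carrier (free_mod R n)" "w \<in> carrier (free_mod R n)"
  shows "pairing R n v w = (\<Oplus>i\<in>{..<n}. v i \<otimes> w (n - 1 - i))"
  unfolding pairing_def using assms
  by (intro lin_comb_self_module) (auto simp: free_mod_carrier)

text \<open>The reflection \<open>i \<mapsto> n - 1 - i\<close> permutes the summation range and
  exchanges the roles of the two arguments.\<close>

lemma pairing_sym:
  assumes "v \<in> carrier (free_mod R n)" "w \<in> carrier (free_mod R n)"
  shows "pairing R n v w = pairing R n w v"
proof -
  have vw: "v i \<in> carrier R" "w i \<in> carrier R" for i using assms by (auto simp: free_mod_carrier)
  have im: "(\<lambda>i. n - 1 - i) ` {..<n} = {..<n}"
  proof (intro equalityI subsetI)
    fix x assume "x \<in> {..<n}"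
    then show "x \<in> (\<lambda>i. n - 1 - i) ` {..<n}" by (intro image_eqI[of _ _ "n - 1 - x"]) auto
  qed auto
  have inj: "inj_on (\<lambda>i. n - 1 - i) {..<n}" by (rule inj_onI) auto
  have "pairing R n v w = (\<Oplus>i\<in>(\<lambda>i. n - 1 - i) ` {..<n}. v i \<otimes> w (n - 1 - i))"
    by (simp only: im pairing_eq_sum[OF assms])
  also have "\<dots> = (\<Oplus>i\<in>{..<n}. v (n - 1 - i) \<otimes> w (n - 1 - (n - 1 - i)))"
    by (rule add.finprod_reindex) (use vw inj in auto)
  also have "\<dots> = (\<Oplus>i\<in>{..<n}. w i \<otimes> v (n - 1 - i))"
    using vw by (intro finsum_cong) (auto simp: simp_implies_def m_comm)
  finally show ?thesis by (simp add: pairing_eq_sum[OF assms(2,1)])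
qed

lemma pairing_hom_right:
  assumes "v \<in> carrier (free_mod R n)"
  shows "pairing R n v \<in> mod_hom R (free_mod R n) (self_module R)"
  by (rule mod_hom_cong[OF pairing_hom[OF assms] free_mod_module]) (rule pairing_sym[OF _ assms])

lemma pairing_unit_vec:
  assumes "w \<in> carrier (free_mod R n)" "j < n"
  shows "pairing R n (unit_vec R j) w = w (n - 1 - j)"
  unfolding pairing_def using assms
  by (intro lin_comb_unit_vec[OF self_module_module]) (auto simp: free_mod_carrier)

lemma pairing_nondegenerate:
  assumes "w \<in> carrier (free_mod R n)" "w' \<in> carrier (free_mod R n)"
    and "\<And>v. v \<in> carrier (free_mod R n) \<Longrightarrow> pairing R n v w = pairing R n v w'"
  shows "w = w'"
proof
  fix i
  show "w i = w' i"
  proof (cases "i < n")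
    case True
    have "pairing R n (unit_vec R (n - 1 - i)) w = pairing R n (unit_vec R (n - 1 - i)) w'"
      using True by (intro assms(3)) simp
    then show ?thesis using True by (simp add: pairing_unit_vec assms)
  qed (use assms(1,2) in \<open>simp add: free_mod_carrier\<close>)
qed

lemma functional_pairing:
  assumes "h \<in> mod_hom R (free_mod R n) (self_module R)"
  obtains w where "w \<in> carrier (free_mod R n)"
    "\<And>v. v \<in> carrier (free_mod R n) \<Longrightarrow> h v = pairing R n v w"
proof
  \<comment> \<open>The unit vector at \<open>j\<close> pairs with \<open>w\<close> to
    \<open>w (n - 1 - j)\<close>, so the values of \<open>h\<close> on the unit vectors have to be
    listed in reverse order.\<close>
  define w where "w = (\<lambda>i. if i < n then h (unit_vec R (n - 1 - i)) else \<zero>)"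
  show w: "w \<in> carrier (free_mod R n)"
    unfolding w_def using mod_hom_closed[OF assms] by (intro free_mod_carrierI) auto
  show "h v = pairing R n v w" if "v \<in> carrier (free_mod R n)" for v
    by (rule hom_eqI[OF self_module_module assms pairing_hom[OF w] _ that])
       (subst pairing_unit_vec[OF w], auto simp: w_def)
qed

lemma free_mod_annihilator:
  assumes "a \<le> n"
  shows "annihilator R n (carrier (free_mod R a)) = carrier (free_mod R (n - a))"
proof (intro equalityI subsetI)
  fix w assume "w \<in> annihilator R n (carrier (free_mod R a))"
  then have w: "w \<in> carrier (free_mod R n)"
    "\<And>v. v \<in> carrier (free_mod R a) \<Longrightarrow> pairing R n v w = \<zero>"
    by (auto simp: annihilator_def)
  have "w i = \<zero>" if "n - a \<le> i" for i
  proof (cases "i < n")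
    case True
    \<comment> \<open>From \<open>n - a \<le> i < n\<close> it follows that
      \<open>n - 1 - i < a\<close>, so this unit vector belongs to \<open>F a\<close> and detects
      the coordinate \<open>w i\<close>.\<close>
    then have "pairing R n (unit_vec R (n - 1 - i)) w = \<zero>" using that by (intro w(2)) auto
    then show ?thesis using True pairing_unit_vec[OF w(1), of "n - 1 - i"] by simp
  qed (use w(1) in \<open>simp add: free_mod_carrier\<close>)
  then show "w \<in> carrier (free_mod R (n - a))" using w(1) by (simp add: free_mod_carrier)
next
  fix w assume w: "w \<in> carrier (free_mod R (n - a))"
  have "pairing R n v w = \<zero>" if v: "v \<in> carrier (free_mod R a)" for v
  proof -
    \<comment> \<open>For \<open>i < a\<close> the partner index \<open>n - 1 - i\<close> is at
      least \<open>n - a\<close>, where \<open>w\<close> vanishes; for the other indices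
      \<open>v\<close> vanishes.\<close>
    have "v i \<otimes> w (n - 1 - i) = \<zero>" if "i < n" for i
      using v w that by (cases "i < a") (auto simp: free_mod_carrier)
    moreover have "v \<in> carrier (free_mod R n)" "w \<in> carrier (free_mod R n)"
      using v w assms free_mod_mono diff_le_self by blast+
    ultimately have "pairing R n v w = (\<Oplus>i\<in>{..<n}. \<zero>)"
      by (simp only: pairing_eq_sum, intro finsum_cong) (auto simp: simp_implies_def)
    then show ?thesis by (simp add: finsum_zero)
  qed
  then show "w \<in> annihilator R n (carrier (free_mod R a))"
    using w assms by (auto simp: annihilator_def free_mod_carrier)
qed

lemma annihilator_sub: "annihilator R n K \<subseteq> carrier (free_mod R n)"
  by (auto simp: annihilator_def)

section \<open>Adjoint maps between free modules\<close>

lemma adjoint_carrier: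
  assumes "d \<in> mod_hom R (free_mod R k) (free_mod R n)" "w \<in> carrier (free_mod R n)"
  shows "adjoint R k n d w \<in> carrier (free_mod R k)"
  unfolding adjoint_def using mod_hom_closed[OF pairing_hom[OF assms(2)]] mod_hom_closed[OF assms(1)]
  by (intro free_mod_carrierI) auto

lemma pairing_adjoint:
  assumes "d \<in> mod_hom R (free_mod R k) (free_mod R n)" "w \<in> carrier (free_mod R n)"
    and "v \<in> carrier (free_mod R k)"
  shows "pairing R n (d v) w = pairing R k v (adjoint R k n d w)"
proof (rule hom_eqI[OF self_module_module _ _ _ assms(3)])
  show "(\<lambda>v. pairing R n (d v) w) \<in> mod_hom R (free_mod R k) (self_module R)"
    using mod_hom_compose[OF assms(1) pairing_hom[OF assms(2)]] .
  show "(\<lambda>v. pairing R k v (adjoint R k n d w)) \<in> mod_hom R (free_mod R k) (self_module R)"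
    by (rule pairing_hom[OF adjoint_carrier[OF assms(1,2)]])
  show "pairing R n (d (unit_vec R i)) w = pairing R k (unit_vec R i) (adjoint R k n d w)" if "i < k" for i
    using that by (subst pairing_unit_vec[OF adjoint_carrier[OF assms(1,2)]]) (auto simp: adjoint_def)
qed

lemma adjoint_hom:
  assumes "d \<in> mod_hom R (free_mod R k) (free_mod R n)"
  shows "adjoint R k n d \<in> mod_hom R (free_mod R n) (free_mod R k)"
proof (rule mod_homI)
  note d = mod_hom_closed[OF assms]
  show "adjoint R k n d x \<in> carrier (free_mod R k)" if "x \<in> carrier (free_mod R n)" for x
    using adjoint_carrier[OF assms that] .
  show "adjoint R k n d (x \<oplus>\<^bsub>free_mod R n\<^esub> y)
      = adjoint R k n d x \<oplus>\<^bsub>free_mod R k\<^esub> adjoint R k n d y"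
    if "x \<in> carrier (free_mod R n)" "y \<in> carrier (free_mod R n)" for x y
    using mod_hom_add[OF pairing_hom_right[OF d]] that by (auto simp: adjoint_def fun_eq_iff)
  show "adjoint R k n d (r \<odot>\<^bsub>free_mod R n\<^esub> x) = r \<odot>\<^bsub>free_mod R k\<^esub> adjoint R k n d x"
    if "r \<in> carrier R" "x \<in> carrier (free_mod R n)" for r x
    using mod_hom_smult[OF pairing_hom_right[OF d]] that by (auto simp: adjoint_def fun_eq_iff)
qed

text \<open>By nondegeneracy, \<open>adjoint R k n d w\<close> is zero once it pairs to zero with
  everything, and these pairings are those of \<open>w\<close> with the image of \<open>d\<close>.
  The image of the adjoint is thus a copy of \<open>F n\<close> modulo the annihilator of that
  image.\<close>

lemma adjoint_eq_zero_iff: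
  assumes "d \<in> mod_hom R (free_mod R k) (free_mod R n)" "w \<in> carrier (free_mod R n)"
  shows "adjoint R k n d w = (\<lambda>_. \<zero>) \<longleftrightarrow> w \<in> annihilator R n (d ` carrier (free_mod R k))"
proof -
  have z: "(\<lambda>_. \<zero>) \<in> carrier (free_mod R k)" by (simp add: free_mod_carrier)
  have pz: "pairing R k v (\<lambda>_. \<zero>) = \<zero>" if "v \<in> carrier (free_mod R k)" for v
    using mod_hom_zero[OF free_mod_module self_module_module pairing_hom_right[OF that]] by simp
  have "adjoint R k n d w = (\<lambda>_. \<zero>)
      \<longleftrightarrow> (\<forall>v\<in>carrier (free_mod R k). pairing R k v (adjoint R k n d w) = \<zero>)"
    using pz pairing_nondegenerate[OF adjoint_carrier[OF assms] z] by auto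
  then show ?thesis using assms(2) by (simp add: annihilator_def pairing_adjoint[OF assms(1)])
qed

section \<open>Generation\<close>

lemma finsum_smult_in_submodule:
  assumes "module R M" "submodule N R M" "finite S" "S \<subseteq> N" "c \<in> S \<rightarrow> carrier R"
  shows "(\<Oplus>\<^bsub>M\<^esub>s\<in>S. c s \<odot>\<^bsub>M\<^esub> s) \<in> N"
proof -
  interpret M: module R M by fact
  note N = submoduleD[OF assms(1,2)]
  show ?thesis using assms(3-5)
  proof (induction S rule: finite_induct)
    case (insert x F)
    have "(\<Oplus>\<^bsub>M\<^esub>s\<in>insert x F. c s \<odot>\<^bsub>M\<^esub> s) = c x \<odot>\<^bsub>M\<^esub> x \<oplus>\<^bsub>M\<^esub> (\<Oplus>\<^bsub>M\<^esub>s\<in>F. c s \<odot>\<^bsub>M\<^esub> s)"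
      using insert N(1) by (intro M.M.finsum_insert) auto
    then show ?case using insert N(3,4) by auto
  qed (simp add: N(2))
qed

text \<open>The linear combinations of a finite set \<open>Y\<close> form the least submodule that
  contains \<open>Y\<close>; Kronecker coefficients show that \<open>Y\<close> is contained in
  it.\<close>

lemma fg_module_iff: "fg_module R M \<longleftrightarrow> module R M \<and> fin_gen R M (carrier M)"
proof (intro iffI conjI)
  assume fg: "fg_module R M"
  then show m: "module R M" by (simp add: fg_module_def)
  obtain S where S: "finite S" "S \<subseteq> carrier M"
    "\<And>x. x \<in> carrier M \<Longrightarrow> \<exists>c \<in> S \<rightarrow> carrier R. x = (\<Oplus>\<^bsub>M\<^esub>s\<in>S. c s \<odot>\<^bsub>M\<^esub> s)"
    using fg unfolding fg_module_def by blast
  have "carrier M \<subseteq> N" if "submodule N R M" "S \<subseteq> N" for N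
    using S(3) finsum_smult_in_submodule[OF m that(1) S(1) that(2)] by blast
  then show "fin_gen R M (carrier M)" unfolding fin_gen_def using S(1,2) by blast
next
  assume "module R M \<and> fin_gen R M (carrier M)"
  then obtain Y where m: "module R M" and Y: "finite Y" "Y \<subseteq> carrier M"
    "\<And>N. submodule N R M \<Longrightarrow> Y \<subseteq> N \<Longrightarrow> carrier M \<subseteq> N"
    unfolding fin_gen_def by blast
  interpret M: module R M by fact
  define N where "N = {(\<Oplus>\<^bsub>M\<^esub>s\<in>Y. c s \<odot>\<^bsub>M\<^esub> s) | c. c \<in> Y \<rightarrow> carrier R}"
  have Yc: "s \<in> carrier M" if "s \<in> Y" for s using that Y(2) by blast
  have "submodule N R M"
  proof (rule submoduleI'[OF m])
    show "N \<subseteq> carrier M" unfolding N_def using Yc by (auto intro!: M.M.finsum_closed)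
    have "(\<Oplus>\<^bsub>M\<^esub>s\<in>Y. \<zero> \<odot>\<^bsub>M\<^esub> s) = (\<Oplus>\<^bsub>M\<^esub>s\<in>Y. \<zero>\<^bsub>M\<^esub>)"
      using Yc by (intro M.M.finsum_cong) (auto simp: simp_implies_def)
    then have "\<zero>\<^bsub>M\<^esub> = (\<Oplus>\<^bsub>M\<^esub>s\<in>Y. \<zero> \<odot>\<^bsub>M\<^esub> s)" by (simp add: M.M.finsum_zero)
    then show "\<zero>\<^bsub>M\<^esub> \<in> N" unfolding N_def by (intro CollectI exI[of _ "\<lambda>_. \<zero>"]) simp
  next
    fix x y assume "x \<in> N" "y \<in> N"
    then obtain c c' where c: "c \<in> Y \<rightarrow> carrier R" "c' \<in> Y \<rightarrow> carrier R"
      "x = (\<Oplus>\<^bsub>M\<^esub>s\<in>Y. c s \<odot>\<^bsub>M\<^esub> s)" "y = (\<Oplus>\<^bsub>M\<^esub>s\<in>Y. c' s \<odot>\<^bsub>M\<^esub> s)"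
      unfolding N_def by blast
    have "x \<oplus>\<^bsub>M\<^esub> y = (\<Oplus>\<^bsub>M\<^esub>s\<in>Y. c s \<odot>\<^bsub>M\<^esub> s \<oplus>\<^bsub>M\<^esub> c' s \<odot>\<^bsub>M\<^esub> s)"
      unfolding c(3,4) using c(1,2) Yc by (intro M.M.finsum_addf[symmetric]) auto
    also have "\<dots> = (\<Oplus>\<^bsub>M\<^esub>s\<in>Y. (c s \<oplus> c' s) \<odot>\<^bsub>M\<^esub> s)"
      using c(1,2) Yc by (intro M.M.finsum_cong) (auto simp: simp_implies_def M.smult_l_distr Pi_iff)
    finally show "x \<oplus>\<^bsub>M\<^esub> y \<in> N"
      unfolding N_def using c(1,2) by (intro CollectI exI[of _ "\<lambda>s. c s \<oplus> c' s"]) auto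
  next
    fix r x assume r: "r \<in> carrier R" and "x \<in> N"
    then obtain c where c: "c \<in> Y \<rightarrow> carrier R" "x = (\<Oplus>\<^bsub>M\<^esub>s\<in>Y. c s \<odot>\<^bsub>M\<^esub> s)"
      unfolding N_def by blast
    have "r \<odot>\<^bsub>M\<^esub> x = (\<Oplus>\<^bsub>M\<^esub>s\<in>Y. r \<odot>\<^bsub>M\<^esub> (c s \<odot>\<^bsub>M\<^esub> s))"
      unfolding c(2) using c(1) Yc r Y(1) by (intro M.finsum_smult_ldistr) auto
    also have "\<dots> = (\<Oplus>\<^bsub>M\<^esub>s\<in>Y. (r \<otimes> c s) \<odot>\<^bsub>M\<^esub> s)"
      using c(1) Yc r by (intro M.M.finsum_cong) (auto simp: simp_implies_def M.smult_assoc1 Pi_iff)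
    finally show "r \<odot>\<^bsub>M\<^esub> x \<in> N"
      unfolding N_def using c(1) r by (intro CollectI exI[of _ "\<lambda>s. r \<otimes> c s"]) auto
  qed
  moreover have "Y \<subseteq> N"
  proof
    fix y assume y: "y \<in> Y"
    have "(\<Oplus>\<^bsub>M\<^esub>s\<in>Y. (if y = s then \<one> else \<zero>) \<odot>\<^bsub>M\<^esub> s) = (\<Oplus>\<^bsub>M\<^esub>s\<in>Y. if y = s then s else \<zero>\<^bsub>M\<^esub>)"
      using Yc by (intro M.M.finsum_cong) (auto simp: simp_implies_def)
    also have "\<dots> = y" using M.M.add.finprod_singleton[OF y Y(1), of "\<lambda>s. s"] Yc by simp
    finally show "y \<in> N"
      unfolding N_def by (intro CollectI exI[of _ "\<lambda>s. if y = s then \<one> else \<zero>"]) auto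
  qed
  ultimately have "carrier M \<subseteq> N" by (rule Y(3))
  then show "fg_module R M"
    unfolding fg_module_def using m Y(1,2) by (auto simp: N_def intro!: exI[of _ Y])
qed

text \<open>Membership of \<open>y i\<close> is asked for only where the coefficient is nonzero, so
  that a generator possibly outside \<open>N\<close> can be switched off by its coefficient.\<close>

lemma lin_comb_in_submodule:
  assumes "module R M" "submodule N R M" "\<And>i. i < n \<Longrightarrow> y i \<in> carrier M"
    and "\<And>i. i < n \<Longrightarrow> v i \<in> carrier R" "\<And>i. i < n \<Longrightarrow> v i \<noteq> \<zero> \<Longrightarrow> y i \<in> N"
  shows "lin_comb M y n v \<in> N"
  using assms(3-5)
proof (induction n)
  case 0
  then show ?case using submodule_zero[OF assms(1,2)] assms(1) by simp
next
  case (Suc n)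
  interpret M: module R M by fact
  note N = submoduleD[OF assms(1,2)]
  have "v n \<odot>\<^bsub>M\<^esub> y n \<in> N"
    using Suc.prems[of n] N(2,4) by (cases "v n = \<zero>") auto
  then show ?case using Suc N(3) by (auto simp: lin_comb_Suc[OF assms(1)])
qed

lemma lin_comb_cong:
  assumes "module R M" "\<And>i. i < n \<Longrightarrow> y i = y' i" "\<And>i. i < n \<Longrightarrow> v i = v' i"
    and "\<And>i. i < n \<Longrightarrow> y' i \<in> carrier M" "\<And>i. i < n \<Longrightarrow> v' i \<in> carrier R"
  shows "lin_comb M y n v = lin_comb M y' n v'"
proof -
  interpret M: module R M by fact
  show ?thesis unfolding lin_comb_def
    using assms by (intro M.M.finsum_cong) (auto simp: simp_implies_def)
qed

lemma lin_comb_append: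
  assumes "module R M" "\<And>i. i < a + c \<Longrightarrow> z i \<in> carrier M" "\<And>i. i < a + c \<Longrightarrow> v i \<in> carrier R"
  shows "lin_comb M z (a + c) v
    = lin_comb M z a v \<oplus>\<^bsub>M\<^esub> lin_comb M (\<lambda>i. z (a + i)) c (\<lambda>i. v (a + i))"
  using assms(2,3)
proof (induction c)
  case 0
  interpret M: module R M by fact
  show ?case using lin_comb_closed[OF assms(1), of a z v] 0 assms(1) by simp
next
  case (Suc c)
  interpret M: module R M by fact
  have "lin_comb M z (a + c) v \<in> carrier M" "lin_comb M z a v \<in> carrier M"
    "lin_comb M (\<lambda>i. z (a + i)) c (\<lambda>i. v (a + i)) \<in> carrier M"
    using Suc.prems by (auto intro!: lin_comb_closed[OF assms(1)])
  then show ?case using Suc by (simp add: lin_comb_Suc[OF assms(1)] M.M.a_assoc)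
qed

lemma fin_gen_image:
  assumes "module R M" "q \<in> mod_hom R (free_mod R n) M"
  shows "fin_gen R M (q ` carrier (free_mod R n))"
  unfolding fin_gen_def
proof (intro exI conjI allI impI)
  show "(\<lambda>i. q (unit_vec R i)) ` {..<n} \<subseteq> q ` carrier (free_mod R n)" by auto
  fix N assume N: "submodule N R M" "(\<lambda>i. q (unit_vec R i)) ` {..<n} \<subseteq> N"
  show "q ` carrier (free_mod R n) \<subseteq> N"
  proof
    fix x assume "x \<in> q ` carrier (free_mod R n)"
    then obtain v where v: "v \<in> carrier (free_mod R n)" "x = q v" by blast
    show "x \<in> N"
      unfolding v(2) hom_eq_lin_comb[OF assms v(1)]
    proof (rule lin_comb_in_submodule[OF assms(1) N(1)])
      show "q (unit_vec R i) \<in> carrier M" if "i < n" for i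
        using that mod_hom_closed[OF assms(2)] by simp
    qed (use N(2) v(1) in \<open>auto simp: free_mod_carrier\<close>)
  qed
qed simp

lemma fg_module_image:
  assumes "module R M" "q \<in> mod_hom R (free_mod R n) M" "q ` carrier (free_mod R n) = carrier M"
  shows "fg_module R M"
  using fin_gen_image[OF assms(1,2)] assms by (simp add: fg_module_iff)

text \<open>A test submodule \<open>N\<close> of \<open>M\<close> may be replaced by
  \<open>N \<inter> H\<close>, so generation does not depend on whether it is tested inside
  \<open>M\<close> or inside \<open>H\<close>.\<close>

lemma fin_gen_carrier_update:
  assumes "module R M" "submodule H R M"
  shows "fg_module R (M\<lparr>carrier := H\<rparr>) \<longleftrightarrow> fin_gen R M H"
proof
  assume "fg_module R (M\<lparr>carrier := H\<rparr>)"
  then have "\<exists>Y. finite Y \<and> Y \<subseteq> H \<and> (\<forall>N. submodule N R M \<and> N \<subseteq> H \<longrightarrow> Y \<subseteq> N \<longrightarrow> H \<subseteq> N)"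
    unfolding fg_module_iff fin_gen_def submodule_of_submodule[OF assms] by simp
  then obtain Y where Y: "finite Y" "Y \<subseteq> H" "\<forall>N. submodule N R M \<and> N \<subseteq> H \<longrightarrow> Y \<subseteq> N \<longrightarrow> H \<subseteq> N"
    by (elim exE conjE)
  have HN: "H \<subseteq> N" if "submodule N R M" "Y \<subseteq> N" for N
  proof -
    have "submodule (N \<inter> H) R M" using submodule_Int[OF assms(1) that(1) assms(2)] .
    moreover have "Y \<subseteq> N \<inter> H" using Y(2) that(2) by (rule Int_greatest[rotated])
    ultimately have "H \<subseteq> N \<inter> H" using Y(3) Int_lower2 by metis
    then show ?thesis using Int_lower1 by (rule subset_trans)
  qed
  show "fin_gen R M H"
    unfolding fin_gen_def by (intro exI[of _ Y] conjI allI impI Y(1,2) HN)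
next
  assume "fin_gen R M H"
  then have "\<exists>Y. finite Y \<and> Y \<subseteq> H \<and> (\<forall>N. submodule N R M \<and> N \<subseteq> H \<longrightarrow> Y \<subseteq> N \<longrightarrow> H \<subseteq> N)"
    unfolding fin_gen_def by metis
  then show "fg_module R (M\<lparr>carrier := H\<rparr>)"
    unfolding fg_module_iff fin_gen_def submodule_of_submodule[OF assms]
    using submodule_module[OF assms] by simp
qed

end

section \<open>Noetherian local rings\<close>

text \<open>Locality is recorded in the form in which the arguments use it: elements outside the
  maximal ideal can be inverted.\<close>

locale noetherian_local_ring = cring R + noetherian_ring R for R (structure) +
  fixes \<mm>
  assumes maximal: "maximalideal \<mm> R"
    and nonmember_unit: "x \<in> carrier R \<Longrightarrow> x \<notin> \<mm> \<Longrightarrow> x \<in> Units R"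

text \<open>Zorn's lemma for the proper ideals above \<open>I\<close>. In a noetherian ring the
  union of a nonempty chain of ideals is a member of the chain, so it is proper and an upper
  bound.\<close>

lemma (in noetherian_ring) exists_maximalideal_supset:
  assumes I: "ideal I R" "\<one> \<notin> I"
  obtains J where "maximalideal J R" "I \<subseteq> J"
proof -
  define A where "A = {J. ideal J R \<and> I \<subseteq> J \<and> \<one> \<notin> J}"
  have "\<exists>M\<in>A. \<forall>X\<in>A. M \<subseteq> X \<longrightarrow> X = M"
  proof (rule subset_Zorn_nonempty)
    show "A \<noteq> {}" using I by (auto simp: A_def)
    fix C assume C: "C \<noteq> {}" "subset.chain A C"
    then have "subset.chain {I. ideal I R} C"
      by (auto simp: A_def subset.chain_def)
    then show "\<Union>C \<in> A" using ideal_chain_is_trivial[OF C(1)] C(2) by (auto simp: subset.chain_def)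
  qed
  then obtain J where J: "J \<in> A" "\<And>X. X \<in> A \<Longrightarrow> J \<subseteq> X \<Longrightarrow> X = J" by blast
  have "maximalideal J R"
  proof (rule maximalidealI)
    show "ideal J R" "carrier R \<noteq> J" using J(1) one_closed by (auto simp: A_def)
    fix X assume X: "ideal X R" "J \<subseteq> X" "X \<subseteq> carrier R"
    show "X = J \<or> X = carrier R"
    proof (cases "\<one> \<in> X")
      case True
      then show ?thesis using ideal.one_imp_carrier[OF X(1)] by simp
    next
      case False
      then show ?thesis using J X(1,2) by (auto simp: A_def)
    qed
  qed
  then show thesis using that J(1) by (auto simp: A_def)
qed

text \<open>The principal ideal of a non-unit is proper, hence contained in a maximal ideal, which
  by uniqueness is \<open>m\<close>.\<close>

lemma noetherian_local_ringI:
  fixes R (structure)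
  assumes "local_ring R" "noetherian_ring R"
  obtains m where "noetherian_local_ring R m"
proof -
  interpret cring R using assms(1) by (simp add: local_ring_def)
  interpret noetherian_ring R by fact
  obtain m where m: "maximalideal m R" and uniq: "\<And>J. maximalideal J R \<Longrightarrow> J = m"
    using assms(1) unfolding local_ring_def by blast
  have unit: "x \<in> Units R" if x: "x \<in> carrier R" "x \<notin> m" for x
    proof (rule ccontr)
      assume nu: "x \<notin> Units R"
      have "\<one> \<notin> PIdl x"
      proof
        assume "\<one> \<in> PIdl x"
        then obtain y where "y \<in> carrier R" "\<one> = y \<otimes> x" by (auto simp: cgenideal_def)
        then have "x \<in> Units R" using x(1) m_comm by (auto simp: Units_def)
        then show False using nu by simp
      qed
      then obtain J where "maximalideal J R" "PIdl x \<subseteq> J"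
        using exists_maximalideal_supset[OF cgenideal_ideal[OF x(1)]] by blast
      then show False using uniq cgenideal_self[OF x(1)] x(2) by blast
    qed
  show thesis
    by (rule that[OF noetherian_local_ring.intro[OF is_cring noetherian_ring_axioms
          noetherian_local_ring_axioms.intro[OF m unit]]])
qed

lemma (in abelian_group) eq_minus_if_sum_eq:
  assumes "x = a \<oplus> b" "a \<in> carrier G" "b \<in> carrier G"
  shows "b = x \<ominus> a"
proof -
  have "x \<ominus> a = b \<oplus> (a \<oplus> \<ominus> a)"
    using assms by (simp add: a_minus_def a_ac del: r_neg)
  then show ?thesis using assms by (simp add: r_neg)
qed

context noetherian_local_ring
begin

sublocale max: maximalideal \<mm> R by (rule maximal)

lemma max_sub: "x \<in> \<mm> \<Longrightarrow> x \<in> carrier R"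
  using max.a_subset by blast

lemma max_add: "x \<in> \<mm> \<Longrightarrow> y \<in> \<mm> \<Longrightarrow> x \<oplus> y \<in> \<mm>"
  by (rule max.a_closed)

lemma max_mult: "x \<in> \<mm> \<Longrightarrow> r \<in> carrier R \<Longrightarrow> x \<otimes> r \<in> \<mm>" "x \<in> \<mm> \<Longrightarrow> r \<in> carrier R \<Longrightarrow> r \<otimes> x \<in> \<mm>"
  by (simp_all add: max.I_l_closed max.I_r_closed)

lemma max_zero [simp]: "\<zero> \<in> \<mm>"
  using max.zero_closed by simp

lemma one_notin_max: "\<one> \<notin> \<mm>"
  using max.one_imp_carrier max.I_notcarr by blast

lemma max_sum:
  assumes "finite A" "\<And>i. i \<in> A \<Longrightarrow> f i \<in> \<mm>"
  shows "(\<Oplus>i\<in>A. f i) \<in> \<mm>"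
  using assms
proof (induction A)
  case (insert x F)
  then have "(\<Oplus>i\<in>insert x F. f i) = f x \<oplus> (\<Oplus>i\<in>F. f i)"
    by (intro finsum_insert) (auto intro: max_sub)
  then show ?case using insert by (auto intro: max_add)
qed simp

subsection \<open>Nakayama's lemma\<close>

text \<open>Elimination of the error term one coordinate at a time, from the last one down. Applying
  the hypothesis to the unit vector at \<open>p\<close> yields an element of \<open>N\<close> whose
  coordinate at \<open>p\<close> is one minus an element of \<open>\<mm>\<close>, hence a unit, and
  a multiple of it clears coordinate \<open>p\<close> of any other error.\<close>

lemma nakayama_free_mod:
  assumes N: "submodule N R (free_mod R n)"
    and gen: "\<And>v. v \<in> carrier (free_mod R n) \<Longrightarrow>
      \<exists>x\<in>N. \<exists>k\<in>carrier (free_mod R n). (\<forall>i. k i \<in> \<mm>) \<and> v = (\<lambda>i. x i \<oplus> k i)"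
  shows "N = carrier (free_mod R n)"
proof -
  note N = submoduleD[OF free_mod_module N]
  have Nc: "x i \<in> carrier R" if "x \<in> N" for x i using N(1)[OF that] by (simp add: free_mod_carrier)
  have "j \<le> n \<Longrightarrow> \<forall>v\<in>carrier (free_mod R n).
      \<exists>x\<in>N. \<exists>k\<in>carrier (free_mod R (n - j)). (\<forall>i. k i \<in> \<mm>) \<and> v = (\<lambda>i. x i \<oplus> k i)" for j
  proof (induction j)
    case 0
    then show ?case using gen by simp
  next
    case (Suc j)
    define p where "p = n - Suc j"
    have p: "n - j = Suc p" "p < n" using Suc.prems by (auto simp: p_def)
    note IH = Suc.IH[OF Suc_leD[OF Suc.prems], unfolded p(1)]
    show ?case unfolding p_def[symmetric]
    proof
      fix v assume "v \<in> carrier (free_mod R n)"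
      then obtain x k where x: "x \<in> N" and k: "k \<in> carrier (free_mod R (Suc p))" "\<And>i. k i \<in> \<mm>"
        and v: "v = (\<lambda>i. x i \<oplus> k i)" using IH by blast
      obtain x' k' where x': "x' \<in> N" and k': "k' \<in> carrier (free_mod R (Suc p))" "\<And>i. k' i \<in> \<mm>"
        and e: "unit_vec R p = (\<lambda>i. x' i \<oplus> k' i)" using bspec[OF IH unit_vec_carrier[OF p(2)]] by blast
      note kc = max_sub[OF k(2)] max_sub[OF k'(2)]
      note xc = Nc[OF x] Nc[OF x']
      have x'p: "x' p = \<one> \<ominus> k' p"
        using fun_cong[OF e, of p] xc kc by (simp add: unit_vec_def) algebra
      have "x' p \<notin> \<mm>"
      proof
        assume "x' p \<in> \<mm>"
        then have "x' p \<oplus> k' p \<in> \<mm>" using k'(2) by (intro max_add)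
        then show False using fun_cong[OF e, of p] one_notin_max by (simp add: unit_vec_def)
      qed
      then have u: "x' p \<in> Units R" using nonmember_unit xc by blast
      \<comment> \<open>The multiple of \<open>x'\<close> whose coordinate at \<open>p\<close> is
        \<open>k p\<close>. As \<open>k p\<close> lies in \<open>\<mm>\<close>, so does
        \<open>c\<close>, and the new error keeps its coordinates in \<open>\<mm>\<close>.\<close>
      define c where "c = k p \<otimes> inv (x' p)"
      have c: "c \<in> \<mm>" "c \<in> carrier R" using u k(2) max_sub by (auto simp: c_def intro: max_mult)
      have cx: "c \<otimes> x' p = k p" using u kc xc by (simp add: c_def m_assoc)
      \<comment> \<open>This is the new error \<open>k - c x'\<close>: below \<open>p\<close> one
        has \<open>x' i = - k' i\<close>, at \<open>p\<close> the terms cancel by the choice of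
        \<open>c\<close>, and above \<open>p\<close> both \<open>k\<close> and \<open>k'\<close>
        vanish.\<close>
      define l where "l = (\<lambda>i. if i < p then k i \<oplus> c \<otimes> k' i else \<zero>)"
      define y where "y = (\<lambda>i. x i \<oplus> c \<otimes> x' i)"
      have "y \<in> N" using N(3)[OF x N(4)[OF c(2) x']] by (simp add: y_def)
      moreover have "l \<in> carrier (free_mod R p)" using kc c by (intro free_mod_carrierI) (auto simp: l_def)
      moreover have "l i \<in> \<mm>" for i using k(2) k'(2) c by (auto simp: l_def intro: max_add max_mult max_sub)
      moreover have "v i = y i \<oplus> l i" for i
      proof (cases "i = p")
        case True
        then show ?thesis using xc kc(1)[of p] c cx by (simp add: v y_def l_def)
      next
        case False
        have z: "x' i \<oplus> k' i = \<zero>" using fun_cong[OF e, of i] False by (simp add: unit_vec_def)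
        have "y i \<oplus> (k i \<oplus> c \<otimes> k' i) = x i \<oplus> k i \<oplus> c \<otimes> (x' i \<oplus> k' i)"
          unfolding y_def using xc kc c(2) by algebra
        also have "\<dots> = v i" using xc kc c(2) by (simp add: z v)
        finally show ?thesis
          using False k(1) k'(1) c(2) by (cases "i < p") (auto simp: l_def free_mod_carrier)
      qed
      ultimately show "\<exists>x\<in>N. \<exists>k\<in>carrier (free_mod R p). (\<forall>i. k i \<in> \<mm>) \<and> v = (\<lambda>i. x i \<oplus> k i)"
        by blast
    qed
  qed
  \<comment> \<open>After \<open>n\<close> rounds the error lies in \<open>F 0\<close>, which is
    zero.\<close>
  note step = this[of n]
  have *: "\<exists>x\<in>N. \<exists>k\<in>carrier (free_mod R 0). (\<forall>i. k i \<in> \<mm>) \<and> v = (\<lambda>i. x i \<oplus> k i)"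
    if "v \<in> carrier (free_mod R n)" for v using step that by simp
  have "v \<in> N" if v: "v \<in> carrier (free_mod R n)" for v
  proof -
    obtain x k where xk: "x \<in> N" "k \<in> carrier (free_mod R 0)" "v = (\<lambda>i. x i \<oplus> k i)"
      using *[OF v] by blast
    then have "v = x" using Nc[OF xk(1)] by (auto simp: free_mod_carrier fun_eq_iff)
    then show ?thesis using xk(1) by simp
  qed
  then show ?thesis by (intro equalityI subsetI N(1))
qed

subsection \<open>Minimal generators\<close>

text \<open>Minimal generators of \<open>H\<close> modulo \<open>S\<close>: among the finite sets
  that generate \<open>H\<close> together with \<open>S\<close>, one of least cardinality is taken.
  If a combination lying in \<open>S\<close> had a unit coefficient at \<open>j\<close>, it could be
  solved for \<open>y j\<close>, and \<open>y j\<close> could be discarded.\<close>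

lemma exists_minimal_generators:
  assumes M: "module R M" and S: "submodule S R M" and H: "submodule H R M" and SH: "S \<subseteq> H"
    and fg: "fin_gen R M H"
  obtains c y where "\<And>i. i < c \<Longrightarrow> y i \<in> H"
    "S <+>\<^bsub>M\<^esub> lin_comb M y c ` carrier (free_mod R c) = H"
    "\<And>k i. k \<in> carrier (free_mod R c) \<Longrightarrow> lin_comb M y c k \<in> S \<Longrightarrow> k i \<in> \<mm>"
proof -
  interpret M: module R M by fact
  note Hd = submoduleD[OF M H]
  define P where "P Y \<longleftrightarrow> finite Y \<and> Y \<subseteq> H \<and> (\<forall>N. submodule N R M \<longrightarrow> S \<subseteq> N \<longrightarrow> Y \<subseteq> N \<longrightarrow> H \<subseteq> N)" for Y
  have "\<exists>Y. P Y" using fg unfolding fin_gen_def P_def by metis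
  then obtain Y where Y: "P Y" and least: "\<And>Y'. P Y' \<Longrightarrow> card Y \<le> card Y'"
    using ex_has_least_nat[of P _ card] by metis
  have YN: "H \<subseteq> N" if "submodule N R M" "S \<subseteq> N" "Y \<subseteq> N" for N
    using Y that unfolding P_def by simp
  have fin: "finite Y" and YH: "Y \<subseteq> H" using Y by (auto simp: P_def)
  define c where "c = card Y"
  obtain y where y: "bij_betw y {..<c} Y"
    using ex_bij_betw_nat_finite[OF fin] by (auto simp: c_def lessThan_atLeast0)
  have yY: "y i \<in> Y" if "i < c" for i using y that by (auto simp: bij_betw_def)
  have yH: "y i \<in> H" if "i < c" for i using yY[OF that] YH by blast
  then have yM: "y i \<in> carrier M" if "i < c" for i using that Hd(1) by blast
  note hom = lin_comb_hom[OF M, of c y, OF yM]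
  let ?L = "lin_comb M y c ` carrier (free_mod R c)"
  have L: "submodule ?L R M"
    using submodule_image[OF free_mod_module M hom submodule_carrier[OF free_mod_module]] .
  show thesis
  proof
    show "y i \<in> H" if "i < c" for i using yH that .
    show "S <+>\<^bsub>M\<^esub> ?L = H"
    proof
      have "?L \<subseteq> H"
        using yH yM by (auto intro!: lin_comb_in_submodule[OF M H] simp: free_mod_carrier)
      then show "S <+>\<^bsub>M\<^esub> ?L \<subseteq> H" using SH Hd(3) unfolding set_add_iff subset_iff by blast
      have "Y \<subseteq> ?L"
      proof
        fix z assume "z \<in> Y"
        then obtain i where i: "i < c" "z = y i" using y by (auto simp: bij_betw_def)
        then show "z \<in> ?L"
          by (intro image_eqI[of _ _ "unit_vec R i"]) (auto simp: lin_comb_unit_vec[OF M yM])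
      qed
      then have "Y \<subseteq> S <+>\<^bsub>M\<^esub> ?L" using subset_set_add(2)[OF M S L] by (rule subset_trans)
      then show "H \<subseteq> S <+>\<^bsub>M\<^esub> ?L" by (intro YN submodule_sum[OF M S L] subset_set_add(1)[OF M S L])
    qed
    fix k j assume k: "k \<in> carrier (free_mod R c)" and kS: "lin_comb M y c k \<in> S"
    have kc: "k i \<in> carrier R" for i using k by (simp add: free_mod_carrier)
    show "k j \<in> \<mm>"
    proof (rule ccontr)
      assume nj: "k j \<notin> \<mm>"
      then have u: "k j \<in> Units R" using nonmember_unit kc by blast
      have j: "j < c" using nj k by (metis free_mod_carrier leI max_zero)
      have "P (Y - {y j})" unfolding P_def
      proof (intro conjI allI impI)
        show "finite (Y - {y j})" "Y - {y j} \<subseteq> H" using fin YH by auto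
        fix N assume N: "submodule N R M" and SN: "S \<subseteq> N" and YjN: "Y - {y j} \<subseteq> N"
        note Nd = submoduleD[OF M N]
        \<comment> \<open>The combination without its term at \<open>j\<close>; it involves only the
          remaining generators, so its value lies in \<open>N\<close>.\<close>
        define k' where "k' = k(j := \<zero>)"
        have k': "k' \<in> carrier (free_mod R c)" using k by (auto simp: k'_def free_mod_carrier)
        have "lin_comb M y c k' \<in> N"
        proof (rule lin_comb_in_submodule[OF M N yM])
          fix i assume i: "i < c" "k' i \<noteq> \<zero>"
          then have "i \<noteq> j" by (auto simp: k'_def)
          then have "y i \<noteq> y j" using y i(1) j by (auto simp: bij_betw_def inj_on_def)
          then show "y i \<in> N" using yY[OF i(1)] YjN by blast
        qed (use kc in \<open>auto simp: k'_def\<close>)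
        moreover have "lin_comb M y c k = lin_comb M y c k' \<oplus>\<^bsub>M\<^esub> k j \<odot>\<^bsub>M\<^esub> y j"
        proof -
          have "k = k' \<oplus>\<^bsub>free_mod R c\<^esub> k j \<odot>\<^bsub>free_mod R c\<^esub> unit_vec R j"
            using kc by (auto simp: k'_def unit_vec_def fun_eq_iff)
          moreover have "k j \<odot>\<^bsub>free_mod R c\<^esub> unit_vec R j \<in> carrier (free_mod R c)"
            using kc j by (intro module.smult_closed[OF free_mod_module]) auto
          ultimately show ?thesis
            using mod_hom_add[OF hom k', of "k j \<odot>\<^bsub>free_mod R c\<^esub> unit_vec R j"]
              mod_hom_smult[OF hom kc[of j] unit_vec_carrier[OF j]] lin_comb_unit_vec[OF M yM j] by simp
        qed
        moreover have "lin_comb M y c k' \<in> carrier M" "k j \<odot>\<^bsub>M\<^esub> y j \<in> carrier M"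
          using mod_hom_closed[OF hom k'] kc yM[OF j] by auto
        ultimately have "k j \<odot>\<^bsub>M\<^esub> y j = lin_comb M y c k \<ominus>\<^bsub>M\<^esub> lin_comb M y c k'"
          by (intro M.M.eq_minus_if_sum_eq)
        also have "\<dots> \<in> N" using kS SN \<open>lin_comb M y c k' \<in> N\<close> by (intro Nd(6)) auto
        finally have "inv (k j) \<odot>\<^bsub>M\<^esub> (k j \<odot>\<^bsub>M\<^esub> y j) \<in> N" using u by (intro Nd(4)[OF Units_inv_closed])
        moreover have "inv (k j) \<odot>\<^bsub>M\<^esub> (k j \<odot>\<^bsub>M\<^esub> y j) = y j"
          using u kc[of j] yM[OF j] M.smult_assoc1[of "inv (k j)" "k j" "y j"] by simp
        ultimately have "y j \<in> N" by simp
        then have "Y \<subseteq> N" using YjN by blast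
        then show "H \<subseteq> N" by (rule YN[OF N SN])
      qed
      then have "card Y \<le> card (Y - {y j})" by (rule least)
      moreover have "card (Y - {y j}) < card Y" using yY[OF j] fin by (intro psubset_card_mono) auto
      ultimately show False by simp
    qed
  qed
qed

text \<open>Minimal generators of \<open>S\<close> are followed by minimal generators of
  \<open>H\<close> modulo \<open>S\<close>. The two smallness conditions say that the cover is
  minimal on \<open>S\<close> and on the quotient of \<open>H\<close> by \<open>S\<close>; on
  \<open>H\<close> itself it may fail to be minimal. This is the minimality that belongs to the
  inclusion of \<open>S\<close> in \<open>H\<close> as an object of the category of
  homomorphisms.\<close>

lemma exists_filtered_cover:
  assumes M: "module R M" and S: "submodule S R M" and H: "submodule H R M" and SH: "S \<subseteq> H"
    and fg: "fin_gen R M S" "fin_gen R M H"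
  obtains a b q where "a \<le> b" "q \<in> mod_hom R (free_mod R b) M"
    "q ` carrier (free_mod R a) = S" "q ` carrier (free_mod R b) = H"
    "\<And>k i. k \<in> carrier (free_mod R a) \<Longrightarrow> q k = \<zero>\<^bsub>M\<^esub> \<Longrightarrow> k i \<in> \<mm>"
    "\<And>k i. k \<in> carrier (free_mod R b) \<Longrightarrow> q k \<in> S \<Longrightarrow> a \<le> i \<Longrightarrow> k i \<in> \<mm>"
proof -
  interpret M: module R M by fact
  note Hd = submoduleD[OF M H] note Sd = submoduleD[OF M S]
  obtain a x where x: "\<And>i. i < a \<Longrightarrow> x i \<in> S"
    and Sx: "{\<zero>\<^bsub>M\<^esub>} <+>\<^bsub>M\<^esub> lin_comb M x a ` carrier (free_mod R a) = S"
    and kx: "\<And>k i. k \<in> carrier (free_mod R a) \<Longrightarrow> lin_comb M x a k \<in> {\<zero>\<^bsub>M\<^esub>} \<Longrightarrow> k i \<in> \<mm>"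
    using exists_minimal_generators[OF M submodule_zero_set[OF M] S _ fg(1)] Sd(2) by auto
  obtain c y where y: "\<And>i. i < c \<Longrightarrow> y i \<in> H"
    and Hy: "S <+>\<^bsub>M\<^esub> lin_comb M y c ` carrier (free_mod R c) = H"
    and ky: "\<And>k i. k \<in> carrier (free_mod R c) \<Longrightarrow> lin_comb M y c k \<in> S \<Longrightarrow> k i \<in> \<mm>"
    using exists_minimal_generators[OF M S H SH fg(2)] by auto
  have xM: "x i \<in> carrier M" if "i < a" for i using x that Sd(1) by blast
  have yM: "y i \<in> carrier M" if "i < c" for i using y that Hd(1) by blast
  \<comment> \<open>The first \<open>a\<close> coordinates address the generators of
    \<open>S\<close>, the last \<open>c\<close> those of \<open>H\<close> modulo
    \<open>S\<close>.\<close>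
  define z where "z = (\<lambda>i. if i < a then x i else y (i - a))"
  have zM: "z i \<in> carrier M" if "i < a + c" for i using that xM yM by (auto simp: z_def)
  define q where "q = lin_comb M z (a + c)"
  have q: "q \<in> mod_hom R (free_mod R (a + c)) M" unfolding q_def using zM by (intro lin_comb_hom[OF M])
  have shift: "(\<lambda>i. v (a + i)) \<in> carrier (free_mod R c)" if "v \<in> carrier (free_mod R (a + c))" for v
    using that by (auto simp: free_mod_carrier)
  have split: "q v = lin_comb M x a v \<oplus>\<^bsub>M\<^esub> lin_comb M y c (\<lambda>i. v (a + i))"
    if "\<And>i. v i \<in> carrier R" for v
  proof -
    have "q v = lin_comb M z a v \<oplus>\<^bsub>M\<^esub> lin_comb M (\<lambda>i. z (a + i)) c (\<lambda>i. v (a + i))"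
      unfolding q_def using zM that by (intro lin_comb_append[OF M])
    moreover have "lin_comb M z a v = lin_comb M x a v"
      using xM that by (intro lin_comb_cong[OF M]) (auto simp: z_def)
    moreover have "lin_comb M (\<lambda>i. z (a + i)) c (\<lambda>i. v (a + i)) = lin_comb M y c (\<lambda>i. v (a + i))"
      using yM that by (intro lin_comb_cong[OF M]) (auto simp: z_def)
    ultimately show ?thesis by simp
  qed
  have xS: "lin_comb M x a v \<in> S" if "\<And>i. v i \<in> carrier R" for v
    using that x xM by (intro lin_comb_in_submodule[OF M S])
  have yc: "lin_comb M y c v \<in> carrier M" if "\<And>i. v i \<in> carrier R" for v
    using that yM by (intro lin_comb_closed[OF M])
  have qx: "q v = lin_comb M x a v" if "v \<in> carrier (free_mod R a)" for v
  proof -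
    have "lin_comb M y c (\<lambda>i. v (a + i)) = lin_comb M y c (\<lambda>_. \<zero>)"
      using that by (simp add: free_mod_carrier)
    also have "\<dots> = \<zero>\<^bsub>M\<^esub>"
      using mod_hom_zero[OF free_mod_module M lin_comb_hom[OF M yM]] by simp
    finally show ?thesis
      using split[of v] that xS[of v] Sd(1) by (simp add: free_mod_carrier)
  qed
  show thesis
  proof
    show "a \<le> a + c" by simp
    show "q \<in> mod_hom R (free_mod R (a + c)) M" by fact
    have "lin_comb M x a ` carrier (free_mod R a) = S"
    proof (intro equalityI subsetI)
      fix s assume "s \<in> S"
      then obtain t where "t \<in> lin_comb M x a ` carrier (free_mod R a)" "s = \<zero>\<^bsub>M\<^esub> \<oplus>\<^bsub>M\<^esub> t"
        unfolding Sx[symmetric] set_add_iff by blast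
      then show "s \<in> lin_comb M x a ` carrier (free_mod R a)"
        using mod_hom_closed[OF lin_comb_hom[OF M xM]] by auto
    qed (auto simp: free_mod_carrier intro: xS)
    then show qS: "q ` carrier (free_mod R a) = S" using qx by simp
    show "q ` carrier (free_mod R (a + c)) = H"
    proof (intro equalityI subsetI)
      fix h assume "h \<in> q ` carrier (free_mod R (a + c))"
      then obtain v where v: "v \<in> carrier (free_mod R (a + c))" "h = q v" by blast
      have "q v \<in> S <+>\<^bsub>M\<^esub> lin_comb M y c ` carrier (free_mod R c)"
        unfolding set_add_iff using split[of v] xS[of v] v(1)
        by (intro bexI[of _ "lin_comb M x a v"] bexI[of _ "lin_comb M y c (\<lambda>i. v (a + i))"]
            imageI shift[OF v(1)]) (auto simp: free_mod_carrier)
      then show "h \<in> H" using Hy v(2) by simp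
    next
      fix h assume "h \<in> H"
      then obtain s w where s: "s \<in> S" and w: "w \<in> carrier (free_mod R c)"
        and h: "h = s \<oplus>\<^bsub>M\<^esub> lin_comb M y c w"
        unfolding Hy[symmetric] set_add_iff by blast
      obtain v where v: "v \<in> carrier (free_mod R a)" "s = lin_comb M x a v" using s qS qx by force
      define u where "u = (\<lambda>i. if i < a then v i else w (i - a))"
      have u: "u \<in> carrier (free_mod R (a + c))" using v w by (auto simp: u_def free_mod_carrier)
      have "lin_comb M x a u = lin_comb M x a v"
        using xM v by (intro lin_comb_cong[OF M]) (auto simp: u_def free_mod_carrier)
      moreover have "(\<lambda>i. u (a + i)) = w" by (simp add: u_def)
      ultimately have "q u = h" using split[of u] u v(2) h by (simp add: free_mod_carrier)
      then show "h \<in> q ` carrier (free_mod R (a + c))" using u by blast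
    qed
    show "k i \<in> \<mm>" if "k \<in> carrier (free_mod R a)" "q k = \<zero>\<^bsub>M\<^esub>" for k i
      using that kx qx by simp
    show "k i \<in> \<mm>" if k: "k \<in> carrier (free_mod R (a + c))" "q k \<in> S" "a \<le> i" for k i
    proof -
      have kc: "k i \<in> carrier R" for i using k(1) by (simp add: free_mod_carrier)
      \<comment> \<open>Removing the part of \<open>q k\<close> that comes from the generators of
        \<open>S\<close> leaves a combination of the \<open>y i\<close> that still lies in
        \<open>S\<close>, and minimality modulo \<open>S\<close> applies to it.\<close>
      have "lin_comb M y c (\<lambda>i. k (a + i)) = q k \<ominus>\<^bsub>M\<^esub> lin_comb M x a k"
        by (rule M.M.eq_minus_if_sum_eq[OF split[OF kc] Sd(1)[OF xS[OF kc]] yc[OF kc]])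
      also have "\<dots> \<in> S" using k(2) xS[OF kc] by (rule Sd(6))
      finally have "k (a + (i - a)) \<in> \<mm>" using ky[OF shift[OF k(1)]] by blast
      then show ?thesis using k(3) by simp
    qed
  qed
qed

text \<open>Induction on the rank. The last coordinates of the vectors of \<open>K\<close> form an
  ideal, which is finitely generated, and the vectors with last coordinate zero form a submodule of
  a free module of smaller rank.\<close>

lemma submodule_free_mod_fin_gen:
  "submodule K R (free_mod R n) \<Longrightarrow> fin_gen R (free_mod R n) K"
proof (induction n arbitrary: K)
  case 0
  then have "K \<subseteq> {\<lambda>_. \<zero>}"
    using submodule_sub[OF free_mod_module 0] by (auto simp: free_mod_carrier)
  then show ?case unfolding fin_gen_def
    by (intro exI[of _ "{}"]) (use submodule_zero[OF free_mod_module] in fastforce)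
next
  case (Suc n)
  let ?F = "free_mod R (Suc n)"
  note K = submoduleD[OF free_mod_module Suc.prems]
  have Kc: "v i \<in> carrier R" if "v \<in> K" for v i using K(1)[OF that] by (simp add: free_mod_carrier)
  have lower: "submodule (N \<inter> carrier (free_mod R n)) R (free_mod R n)" if "submodule N R ?F" for N
  proof -
    have "submodule (N \<inter> carrier (free_mod R n)) R (?F\<lparr>carrier := carrier (free_mod R n)\<rparr>)"
      using submodule_Int[OF free_mod_module that submodule_free_mod] that
      by (auto simp: submodule_of_submodule[OF free_mod_module submodule_free_mod])
    then show ?thesis by (simp add: free_mod_carrier_update)
  qed
  obtain S0 where S0: "finite S0" "S0 \<subseteq> K \<inter> carrier (free_mod R n)"
    "\<And>N. submodule N R (free_mod R n) \<Longrightarrow> S0 \<subseteq> N \<Longrightarrow> K \<inter> carrier (free_mod R n) \<subseteq> N"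
    using Suc.IH[OF lower[OF Suc.prems]] unfolding fin_gen_def by metis
  have ideal: "ideal ((\<lambda>v. v n) ` L) R" if L: "submodule L R ?F" for L
  proof -
    note L = submoduleD[OF free_mod_module L]
    have Lc: "v i \<in> carrier R" if "v \<in> L" for v i using L(1)[OF that] by (simp add: free_mod_carrier)
    have add: "x \<oplus> y \<in> (\<lambda>v. v n) ` L" if xy: "x \<in> (\<lambda>v. v n) ` L" "y \<in> (\<lambda>v. v n) ` L" for x y
    proof -
      obtain v w where vw: "v \<in> L" "w \<in> L" "x = v n" "y = w n" using xy by blast
      then show ?thesis using L(3)[OF vw(1,2)] by force
    qed
    have sm: "r \<otimes> x \<in> (\<lambda>v. v n) ` L" if xy: "r \<in> carrier R" "x \<in> (\<lambda>v. v n) ` L" for x r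
    proof -
      obtain v where v: "v \<in> L" "x = v n" using xy by blast
      then show ?thesis using L(4)[OF xy(1) v(1)] by force
    qed
    have sub: "(\<lambda>v. v n) ` L \<subseteq> carrier R" using Lc by auto
    have z: "\<zero> \<in> (\<lambda>v. v n) ` L" using L(2) by force
    have neg: "\<ominus> x \<in> (\<lambda>v. v n) ` L" if "x \<in> (\<lambda>v. v n) ` L" for x
    proof -
      have "x \<in> carrier R" using sub that by blast
      then have "\<ominus> \<one> \<otimes> x = \<ominus> x" by (simp add: l_minus)
      then show ?thesis using sm[OF _ that, of "\<ominus> \<one>"] by simp
    qed
    show ?thesis
    proof (rule idealI[OF ring_axioms])
      show "subgroup ((\<lambda>v. v n) ` L) (add_monoid R)"
        by (rule add.subgroupI) (use sub z neg add in \<open>auto simp: a_inv_def\<close>)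
      show "x \<otimes> a \<in> (\<lambda>v. v n) ` L" if "a \<in> (\<lambda>v. v n) ` L" "x \<in> carrier R" for a x
        using sm that by blast
      show "a \<otimes> x \<in> (\<lambda>v. v n) ` L" if "a \<in> (\<lambda>v. v n) ` L" "x \<in> carrier R" for a x
        using sm[OF that(2,1)] sub that m_comm[of a x] by auto
    qed
  qed
  obtain A where A: "finite A" "A \<subseteq> carrier R" "(\<lambda>v. v n) ` K = Idl A"
    using finetely_gen[OF ideal[OF Suc.prems]] by blast
  have "A \<subseteq> (\<lambda>v. v n) ` K" unfolding A(3) using genideal_self[OF A(2)] .
  \<comment> \<open>The generators of the ideal of last coordinates are lifted to vectors of
    \<open>K\<close>.\<close>
  then obtain S1 where S1: "finite S1" "S1 \<subseteq> K" "A = (\<lambda>v. v n) ` S1"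
    using finite_subset_image[OF A(1)] by metis
  show ?case unfolding fin_gen_def
  proof (intro exI conjI allI impI)
    show "finite (S0 \<union> S1)" "S0 \<union> S1 \<subseteq> K" using S0 S1 by auto
    fix N assume N: "submodule N R ?F" "S0 \<union> S1 \<subseteq> N"
    note Nd = submoduleD[OF free_mod_module N(1)]
    \<comment> \<open>The last coordinates of \<open>N \<inter> K\<close> form an ideal that
      contains \<open>A\<close>; hence every last coordinate occurring in \<open>K\<close> already
      occurs in \<open>N \<inter> K\<close>.\<close>
    have "Idl A \<subseteq> (\<lambda>v. v n) ` (N \<inter> K)"
      using S1 N(2) submodule_Int[OF free_mod_module N(1) Suc.prems]
      by (intro genideal_minimal ideal) auto
    moreover have "K \<inter> carrier (free_mod R n) \<subseteq> N"
      using S0(3)[OF lower[OF N(1)]] S0(2) N(2) by blast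
    ultimately show "K \<subseteq> N"
    proof (intro subsetI)
      fix v assume *: "Idl A \<subseteq> (\<lambda>v. v n) ` (N \<inter> K)" "K \<inter> carrier (free_mod R n) \<subseteq> N" and v: "v \<in> K"
      then have "v n \<in> (\<lambda>v. v n) ` (N \<inter> K)" using A(3) by blast
      then obtain w where w: "w \<in> N" "w \<in> K" "v n = w n" by auto
      \<comment> \<open>The difference from a vector \<open>w\<close> of \<open>N \<inter> K\<close>
        with the same last coordinate lies in \<open>K\<close> and in \<open>F n\<close>, hence in
        \<open>N\<close>.\<close>
      have vw: "v \<ominus>\<^bsub>?F\<^esub> w \<in> K" using K(6)[OF v w(2)] .
      have eq: "v \<ominus>\<^bsub>?F\<^esub> w = (\<lambda>i. v i \<ominus> w i)" using v w K(1) by (intro free_mod_minus) auto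
      have "v i \<ominus> w i = \<zero>" if "n \<le> i" for i
        using that w(3) K(1)[OF v] K(1)[OF w(2)] Kc[OF w(2), of n]
        by (cases "i = n") (auto simp: free_mod_carrier a_minus_def r_neg)
      then have "v \<ominus>\<^bsub>?F\<^esub> w \<in> carrier (free_mod R n)"
        unfolding eq using Kc v w by (intro free_mod_carrierI) auto
      then have "v \<ominus>\<^bsub>?F\<^esub> w \<in> N" using vw *(2) by blast
      then have "(v \<ominus>\<^bsub>?F\<^esub> w) \<oplus>\<^bsub>?F\<^esub> w \<in> N" using w(1) by (intro Nd(3))
      moreover have "(v \<ominus>\<^bsub>?F\<^esub> w) \<oplus>\<^bsub>?F\<^esub> w = v"
        unfolding eq using Kc[OF v] Kc[OF w(2)] by (auto simp: fun_eq_iff a_minus_def a_assoc l_neg)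
      ultimately show "v \<in> N" by simp
    qed
  qed
qed

end

section \<open>Stable and torsionless modules\<close>

definition torsionless :: "('r, 'k) ring_scheme \<Rightarrow> ('r, 'a) module \<Rightarrow> bool" where
  "torsionless R M \<longleftrightarrow> (\<forall>x\<in>carrier M. x \<noteq> \<zero>\<^bsub>M\<^esub> \<longrightarrow> (\<exists>h \<in> mod_hom R M (self_module R). h x \<noteq> \<zero>\<^bsub>R\<^esub>))"

lemma torsionless_inj:
  assumes "module R M" "module R N" "h \<in> mod_hom R M N" "inj_on h (carrier M)" "torsionless R N"
  shows "torsionless R M"
  unfolding torsionless_def
proof (intro ballI impI)
  fix x assume x: "x \<in> carrier M" "x \<noteq> \<zero>\<^bsub>M\<^esub>"
  interpret M: module R M by fact
  have "h x \<noteq> h \<zero>\<^bsub>M\<^esub>" using x assms(4) by (auto dest: inj_onD)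
  then have "h x \<noteq> \<zero>\<^bsub>N\<^esub>" using mod_hom_zero[OF assms(1-3)] by simp
  then obtain g where g: "g \<in> mod_hom R N (self_module R)" "g (h x) \<noteq> \<zero>\<^bsub>R\<^esub>"
    using assms(5) mod_hom_closed[OF assms(3) x(1)] unfolding torsionless_def by blast
  show "\<exists>f\<in>mod_hom R M (self_module R). f x \<noteq> \<zero>\<^bsub>R\<^esub>"
    using mod_hom_compose[OF assms(3) g(1)] g(2) by (intro bexI[of _ "\<lambda>x. g (h x)"])
qed

context cring
begin

lemma free_mod_fg: "fg_module R (free_mod R n)"
  by (rule fg_module_image[OF free_mod_module mod_hom_id]) simp

lemma free_mod_projective: "projective_module R (free_mod R n)"
  unfolding projective_module_def
proof (intro conjI allI impI)
  show "fg_module R (free_mod R n)" by (rule free_mod_fg)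
  fix U V :: "('a, nat \<Rightarrow> 'a) module" and g h
  assume *: "fg_module R U \<and> fg_module R V \<and> g \<in> mod_hom R U V \<and> g ` carrier U = carrier V \<and>
    h \<in> mod_hom R (free_mod R n) V"
  then have U: "module R U" and V: "module R V" by (auto simp: fg_module_def)
  have g: "g \<in> mod_hom R U V" and surj: "g ` carrier U = carrier V"
    and h: "h \<in> mod_hom R (free_mod R n) V" using * by auto
  define u where "u i = inv_into (carrier U) g (h (unit_vec R i))" for i
  have u: "u i \<in> carrier U" "g (u i) = h (unit_vec R i)" if "i < n" for i
  proof -
    have "h (unit_vec R i) \<in> g ` carrier U"
      unfolding surj using mod_hom_closed[OF h unit_vec_carrier[OF that]] .
    then show "u i \<in> carrier U" "g (u i) = h (unit_vec R i)"
      by (simp_all add: u_def inv_into_into f_inv_into_f)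
  qed
  note k = lin_comb_hom[OF U, of n u, OF u(1)]
  have ku: "lin_comb U u n (unit_vec R i) = u i" if "i < n" for i
    using lin_comb_unit_vec[OF U _ that, of u] u(1) by simp
  show "\<exists>k\<in>mod_hom R (free_mod R n) U. \<forall>x\<in>carrier (free_mod R n). g (k x) = h x"
  proof (intro bexI[OF _ k] ballI)
    show "g (lin_comb U u n x) = h x" if "x \<in> carrier (free_mod R n)" for x
    proof (rule hom_eqI[OF V mod_hom_compose[OF k g] h _ that])
      fix i assume i: "i < n"
      show "g (lin_comb U u n (unit_vec R i)) = h (unit_vec R i)"
        unfolding ku[OF i] by (rule u(2)[OF i])
    qed
  qed
qed

lemma free_mod_torsionless: "torsionless R (free_mod R n)"
  unfolding torsionless_def
proof (intro ballI impI)
  fix v assume v: "v \<in> carrier (free_mod R n)" "v \<noteq> \<zero>\<^bsub>free_mod R n\<^esub>"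
  then obtain i where i: "v i \<noteq> \<zero>" by auto
  show "\<exists>h\<in>mod_hom R (free_mod R n) (self_module R). h v \<noteq> \<zero>"
    by (rule bexI[of _ "\<lambda>w. w i"]) (use i in \<open>auto intro!: mod_homI simp: free_mod_carrier\<close>)
qed

text \<open>If \<open>q v\<close> is nonzero, some functional \<open>h\<close> on \<open>M\<close>
  does not vanish there. The composite of \<open>q\<close> and \<open>h\<close> is the pairing with
  a vector \<open>w\<close>, which annihilates \<open>K\<close> because \<open>q\<close> does; so
  \<open>v\<close> is not annihilated by the annihilator of \<open>K\<close>.\<close>

lemma annihilator_annihilator:
  assumes M: "module R M" and q: "q \<in> mod_hom R (free_mod R n) M"
    and tl: "torsionless R M"
  defines "K \<equiv> {v \<in> carrier (free_mod R n). q v = \<zero>\<^bsub>M\<^esub>}"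
  shows "annihilator R n (annihilator R n K) = K"
proof (intro equalityI subsetI)
  fix v assume v: "v \<in> K"
  then have "pairing R n w v = \<zero>" if "w \<in> annihilator R n K" for w
    using that pairing_sym[of w n v] by (auto simp: K_def annihilator_def)
  then show "v \<in> annihilator R n (annihilator R n K)"
    using v by (auto simp: K_def annihilator_def)
next
  fix v assume v: "v \<in> annihilator R n (annihilator R n K)"
  then have vc: "v \<in> carrier (free_mod R n)" by (simp add: annihilator_def)
  show "v \<in> K"
  proof (rule ccontr)
    assume "v \<notin> K"
    then have "q v \<noteq> \<zero>\<^bsub>M\<^esub>" using vc by (simp add: K_def)
    then obtain h where h: "h \<in> mod_hom R M (self_module R)" "h (q v) \<noteq> \<zero>"
      using tl mod_hom_closed[OF q vc] unfolding torsionless_def by blast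
    obtain w where w: "w \<in> carrier (free_mod R n)"
      "\<And>v. v \<in> carrier (free_mod R n) \<Longrightarrow> h (q v) = pairing R n v w"
      using functional_pairing[OF mod_hom_compose[OF q h(1)]] by blast
    have "w \<in> annihilator R n K"
      using w mod_hom_zero[OF M self_module_module h(1)]
      by (auto simp: annihilator_def K_def simp flip: w(2))
    then have "pairing R n w v = \<zero>" using v by (simp add: annihilator_def)
    then show False using h(2) w(2)[OF vc] pairing_sym[OF vc w(1)] by simp
  qed
qed

end

section \<open>Functionals on stable modules, minimal covers, retracts of free modules\<close>

context noetherian_local_ring
begin

text \<open>A functional with a unit among its values takes the value one at some \<open>e\<close>,
  and then \<open>M\<close> is the direct sum of the free module spanned by \<open>e\<close> and the
  kernel of the functional. This contradicts stability.\<close>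

lemma functional_in_max:
  assumes M: "module R M" and st: "stable_module R M"
    and h: "h \<in> mod_hom R M (self_module R)" and x: "x \<in> carrier M"
  shows "h x \<in> \<mm>"
proof (rule ccontr)
  assume "h x \<notin> \<mm>"
  interpret M: module R M by fact
  note hd = mod_homD[OF h]
  have hR: "h y \<in> carrier R" if "y \<in> carrier M" for y using hd(1)[OF that] by simp
  have u: "h x \<in> Units R" using nonmember_unit hR x \<open>h x \<notin> \<mm>\<close> by blast
  define e where "e = inv (h x) \<odot>\<^bsub>M\<^esub> x"
  have e: "e \<in> carrier M" "h e = \<one>" using u x hd(3) by (auto simp: e_def)
  define N where "N = (\<lambda>r. r \<odot>\<^bsub>M\<^esub> e) ` carrier R"
  have hN: "h (r \<odot>\<^bsub>M\<^esub> e) = r" if "r \<in> carrier R" for r using hd(3) e that by simp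
  have N: "submodule N R M"
  proof (rule submoduleI'[OF M])
    show "\<zero>\<^bsub>M\<^esub> \<in> N" unfolding N_def using e by (intro image_eqI[of _ _ \<zero>]) auto
    show "x \<oplus>\<^bsub>M\<^esub> y \<in> N" if "x \<in> N" "y \<in> N" for x y
      using that e by (auto simp: N_def M.smult_l_distr[symmetric])
    show "r \<odot>\<^bsub>M\<^esub> x \<in> N" if "r \<in> carrier R" "x \<in> N" for r x
      using that e by (auto simp: N_def M.smult_assoc1[symmetric])
  qed (use e in \<open>auto simp: N_def\<close>)
  note mN = submodule_module[OF M N]
  define K where "K = {y \<in> carrier M. h y = \<zero>\<^bsub>self_module R\<^esub>}"
  have K: "submodule K R M" unfolding K_def by (rule submodule_kernel[OF M self_module_module h])
  have "N \<inter> K = {\<zero>\<^bsub>M\<^esub>}"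
  proof
    show "N \<inter> K \<subseteq> {\<zero>\<^bsub>M\<^esub>}" using hN e by (auto simp: N_def K_def)
    show "{\<zero>\<^bsub>M\<^esub>} \<subseteq> N \<inter> K" using submodule_zero[OF M N] submodule_zero[OF M K] by blast
  qed
  moreover have "N <+>\<^bsub>M\<^esub> K = carrier M"
  proof (intro equalityI subsetI)
    fix y assume "y \<in> N <+>\<^bsub>M\<^esub> K"
    then show "y \<in> carrier M" using submodule_sub[OF M submodule_sum[OF M N K]] by blast
  next
    fix y assume y: "y \<in> carrier M"
    \<comment> \<open>Subtracting \<open>h y\<close> times \<open>e\<close> projects
      \<open>y\<close> onto the kernel of \<open>h\<close>, as \<open>h e\<close> is one.\<close>
    let ?z = "y \<ominus>\<^bsub>M\<^esub> h y \<odot>\<^bsub>M\<^esub> e"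
    have z: "?z \<in> K"
      using y e hR[OF y] hN[OF hR[OF y]] mod_hom_minus[OF M self_module_module h, of y "h y \<odot>\<^bsub>M\<^esub> e"]
      by (simp add: K_def abelian_group.minus_eq_zero_iff[OF module.axioms(2)[OF self_module_module], simplified])
    have "y = h y \<odot>\<^bsub>M\<^esub> e \<oplus>\<^bsub>M\<^esub> ?z"
      using y e hR[OF y] by (simp add: a_minus_def M.M.a_lcomm M.M.r_neg)
    then show "y \<in> N <+>\<^bsub>M\<^esub> K" unfolding set_add_iff N_def using z hR[OF y] by blast
  qed
  ultimately have "direct_summand R M N" unfolding direct_summand_def using N K by blast
  moreover have "projective_module R (M\<lparr>carrier := N\<rparr>)"
    unfolding projective_module_def
  proof (intro conjI allI impI)
    have eN: "e \<in> N" unfolding N_def using e by (intro image_eqI[of _ _ \<one>]) auto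
    have "N \<subseteq> L" if "submodule L R M" "{e} \<subseteq> L" for L
      using that submodule_smult[OF M that(1)] by (auto simp: N_def)
    then have "fin_gen R M N" unfolding fin_gen_def using eN by (intro exI[of _ "{e}"]) simp
    then show "fg_module R (M\<lparr>carrier := N\<rparr>)" by (simp add: fin_gen_carrier_update[OF M N])
    fix U V :: "('a, nat \<Rightarrow> 'a) module" and g k
    assume *: "fg_module R U \<and> fg_module R V \<and> g \<in> mod_hom R U V \<and> g ` carrier U = carrier V \<and>
      k \<in> mod_hom R (M\<lparr>carrier := N\<rparr>) V"
    then interpret U: module R U by (simp add: fg_module_def)
    note g = mod_homD[OF conjunct1[OF conjunct2[OF conjunct2[OF *]]]]
    have k: "k \<in> mod_hom R (M\<lparr>carrier := N\<rparr>) V" using * by blast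
    have "k e \<in> g ` carrier U" using * mod_hom_closed[OF k] eN by simp
    \<comment> \<open>The functional \<open>h\<close> identifies \<open>N\<close> with
      \<open>R\<close>, with \<open>e\<close> corresponding to one. A map out of \<open>N\<close> is
      therefore lifted by choosing a preimage \<open>t\<close> of the image of \<open>e\<close> and
      sending \<open>y\<close> to \<open>h y\<close> times \<open>t\<close>.\<close>
    then obtain t where t: "t \<in> carrier U" "g t = k e" by auto
    have sub: "y \<in> carrier M" if "y \<in> N" for y using submodule_sub[OF M N that] .
    show "\<exists>l\<in>mod_hom R (M\<lparr>carrier := N\<rparr>) U. \<forall>y\<in>carrier (M\<lparr>carrier := N\<rparr>). g (l y) = k y"
    proof (intro bexI[of _ "\<lambda>y. h y \<odot>\<^bsub>U\<^esub> t"] ballI)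
      show "(\<lambda>y. h y \<odot>\<^bsub>U\<^esub> t) \<in> mod_hom R (M\<lparr>carrier := N\<rparr>) U"
        by (rule mod_homI) (use sub t hR hd in \<open>simp_all add: U.smult_l_distr U.smult_assoc1\<close>)
      fix y assume "y \<in> carrier (M\<lparr>carrier := N\<rparr>)"
      then obtain r where r: "r \<in> carrier R" "y = r \<odot>\<^bsub>M\<^esub> e" by (auto simp: N_def)
      then show "g (h y \<odot>\<^bsub>U\<^esub> t) = k y"
        using hN[OF r(1)] g(3)[OF r(1) t(1)] t(2) mod_hom_smult[OF k r(1), of e] eN by simp
    qed
  qed
  ultimately have "N = {\<zero>\<^bsub>M\<^esub>}" using st unfolding stable_module_def by blast
  moreover have "e \<in> N" unfolding N_def using e by (intro image_eqI[of _ _ \<one>]) auto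
  ultimately have "h \<zero>\<^bsub>M\<^esub> = \<one>" using e by auto
  then have "\<zero> = \<one>" using mod_hom_zero[OF M self_module_module h] by simp
  then show False using one_notin_max max_zero by metis
qed

text \<open>A vector annihilating the kernel of \<open>q\<close> induces a functional on
  \<open>M\<close>, and its coordinates are the values of that functional at the images of the unit
  vectors.\<close>

lemma annihilator_in_max:
  assumes M: "module R M" and st: "stable_module R M"
    and q: "q \<in> mod_hom R (free_mod R n) M" "q ` carrier (free_mod R n) = carrier M"
    and w: "w \<in> annihilator R n {v \<in> carrier (free_mod R n). q v = \<zero>\<^bsub>M\<^esub>}"
  shows "w i \<in> \<mm>"
proof (cases "i < n")
  case True
  have wc: "w \<in> carrier (free_mod R n)" using w by (simp add: annihilator_def)
  obtain h where h: "h \<in> mod_hom R M (self_module R)"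
    "\<And>v. v \<in> carrier (free_mod R n) \<Longrightarrow> h (q v) = pairing R n v w"
    by (rule mod_hom_factor[OF free_mod_module M self_module_module q(1) pairing_hom[OF wc] q(2)])
       (use w in \<open>auto simp: annihilator_def\<close>)
  have "h (q (unit_vec R (n - 1 - i))) = w i"
    using True by (simp add: h(2) pairing_unit_vec[OF wc])
  moreover have "q (unit_vec R (n - 1 - i)) \<in> carrier M"
    using True by (intro mod_hom_closed[OF q(1)]) simp
  ultimately show ?thesis using functional_in_max[OF M st h(1)] by metis
next
  case False
  then have "w i = \<zero>" using w by (simp add: annihilator_def free_mod_carrier)
  then show ?thesis by simp
qed

text \<open>The filtered cover with both submodules equal to \<open>H\<close>: its first block alone
  is a minimal cover of \<open>H\<close>.\<close>

lemma exists_minimal_cover: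
  assumes M: "module R M" and H: "submodule H R M" and fg: "fin_gen R M H"
  obtains n q where "q \<in> mod_hom R (free_mod R n) M" "q ` carrier (free_mod R n) = H"
    "\<And>k i. k \<in> carrier (free_mod R n) \<Longrightarrow> q k = \<zero>\<^bsub>M\<^esub> \<Longrightarrow> k i \<in> \<mm>"
proof -
  obtain a b q where "a \<le> b" "q \<in> mod_hom R (free_mod R b) M" "q ` carrier (free_mod R a) = H"
    "\<And>k i. k \<in> carrier (free_mod R a) \<Longrightarrow> q k = \<zero>\<^bsub>M\<^esub> \<Longrightarrow> k i \<in> \<mm>"
    using exists_filtered_cover[OF M H H subset_refl fg fg] by metis
  then show thesis by (intro that[of q a] mod_hom_free_mod_mono[of a b q]) auto
qed

text \<open>Lifting the identity along a surjection from a free module embeds \<open>P\<close> in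
  that free module. The carrier type is fixed because the lifting property in
  \<open>projective_module\<close> is stated for modules over this type, and here \<open>P\<close>
  itself is the target of the surjection.\<close>

lemma projective_torsionless:
  fixes P :: "('a, nat \<Rightarrow> 'a) module"
  assumes P: "projective_module R P"
  shows "torsionless R P"
proof -
  have fgP: "fg_module R P" using P by (simp add: projective_module_def)
  then have M: "module R P" and "fin_gen R P (carrier P)" by (auto simp: fg_module_iff)
  then obtain n q where q: "q \<in> mod_hom R (free_mod R n) P" "q ` carrier (free_mod R n) = carrier P"
    using exists_minimal_cover[OF M submodule_carrier[OF M]] by metis
  have "\<exists>k\<in>mod_hom R P (free_mod R n). \<forall>x\<in>carrier P. q (k x) = x"
    using P free_mod_fg fgP q mod_hom_id[of R P] unfolding projective_module_def by metis
  then obtain k where k: "k \<in> mod_hom R P (free_mod R n)" "\<And>x. x \<in> carrier P \<Longrightarrow> q (k x) = x"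
    by blast
  have "inj_on k (carrier P)" by (rule inj_on_inverseI[of _ q]) (rule k(2))
  then show ?thesis
    by (rule torsionless_inj[OF M free_mod_module k(1) _ free_mod_torsionless])
qed

end

section \<open>Cokernels and copies\<close>

lemma quot_module_simps [simp]:
  "carrier (quot_module M K) = a_rcosets\<^bsub>M\<^esub> K"
  "\<zero>\<^bsub>quot_module M K\<^esub> = K"
  "X \<oplus>\<^bsub>quot_module M K\<^esub> Y = X <+>\<^bsub>M\<^esub> Y"
  "r \<odot>\<^bsub>quot_module M K\<^esub> X = (\<Union>x\<in>X. K +>\<^bsub>M\<^esub> (r \<odot>\<^bsub>M\<^esub> x))"
  by (simp_all add: quot_module_def)

lemma submodule_abelian_subgroup:
  assumes "module R M" "submodule K R M"
  shows "abelian_subgroup K M"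
proof -
  interpret M: module R M by fact
  show ?thesis
    by (rule abelian_subgroupI3[OF additive_subgroup.intro[OF submodule.axioms(1)[OF assms(2)]] M.M.abelian_group_axioms])
qed

lemma coset_eq_iff:
  assumes "module R M" "submodule K R M" "x \<in> carrier M" "y \<in> carrier M"
  shows "K +>\<^bsub>M\<^esub> x = K +>\<^bsub>M\<^esub> y \<longleftrightarrow> x \<ominus>\<^bsub>M\<^esub> y \<in> K"
proof -
  interpret M: module R M by fact
  interpret K: abelian_subgroup K M by (rule submodule_abelian_subgroup[OF assms(1,2)])
  have "x \<in> K +>\<^bsub>M\<^esub> y \<longleftrightarrow> x \<ominus>\<^bsub>M\<^esub> y \<in> K"
    using K.a_rcos_module[OF assms(4,3)] by (simp add: a_minus_def)
  moreover have "K +>\<^bsub>M\<^esub> x = K +>\<^bsub>M\<^esub> y \<longleftrightarrow> x \<in> K +>\<^bsub>M\<^esub> y"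
    using K.a_rcos_self[OF assms(3)] K.a_repr_independence'[OF _ assms(4)] by metis
  ultimately show ?thesis by simp
qed

lemma quot_module_props:
  assumes "module R M" "submodule K R M"
  shows quot_module_module: "module R (quot_module M K)"
    and quot_module_hom: "(\<lambda>x. K +>\<^bsub>M\<^esub> x) \<in> mod_hom R M (quot_module M K)"
    and quot_module_surj: "(\<lambda>x. K +>\<^bsub>M\<^esub> x) ` carrier M = carrier (quot_module M K)"
    and quot_module_kernel: "x \<in> carrier M \<Longrightarrow> K +>\<^bsub>M\<^esub> x = \<zero>\<^bsub>quot_module M K\<^esub> \<longleftrightarrow> x \<in> K"
proof -
  interpret M: module R M by fact
  interpret K: abelian_subgroup K M by (rule submodule_abelian_subgroup[OF assms])
  note Kd = submoduleD[OF assms]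
  show surj: "(\<lambda>x. K +>\<^bsub>M\<^esub> x) ` carrier M = carrier (quot_module M K)"
    by (auto simp: A_RCOSETS_def')
  have z: "K +>\<^bsub>M\<^esub> \<zero>\<^bsub>M\<^esub> = K" using Kd(1) by (intro M.M.a_coset_add_zero) auto
  \<comment> \<open>The scalar multiple of a coset is defined as a union over its elements; all the
    cosets in this union coincide.\<close>
  have sm: "(\<Union>y\<in>K +>\<^bsub>M\<^esub> x. K +>\<^bsub>M\<^esub> (r \<odot>\<^bsub>M\<^esub> y)) = K +>\<^bsub>M\<^esub> (r \<odot>\<^bsub>M\<^esub> x)"
    if r: "r \<in> carrier R" and x: "x \<in> carrier M" for r x
  proof -
    have "K +>\<^bsub>M\<^esub> (r \<odot>\<^bsub>M\<^esub> y) = K +>\<^bsub>M\<^esub> (r \<odot>\<^bsub>M\<^esub> x)" if "y \<in> K +>\<^bsub>M\<^esub> x" for y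
    proof -
      obtain k where k: "k \<in> K" "y = k \<oplus>\<^bsub>M\<^esub> x" using \<open>y \<in> K +>\<^bsub>M\<^esub> x\<close> by (auto simp: a_r_coset_def')
      then have kc: "k \<in> carrier M" using Kd(1) by blast
      have "r \<odot>\<^bsub>M\<^esub> y \<ominus>\<^bsub>M\<^esub> r \<odot>\<^bsub>M\<^esub> x = r \<odot>\<^bsub>M\<^esub> k"
        using r x kc k(2) by (simp add: M.smult_r_distr a_minus_def M.M.a_assoc M.M.r_neg)
      then show ?thesis using coset_eq_iff[OF assms] Kd(4)[OF r k(1)] r x kc k(2) by simp
    qed
    moreover have "K +>\<^bsub>M\<^esub> x \<noteq> {}" using K.a_rcos_self[OF x] by blast
    ultimately show ?thesis by (simp add: SUP_eq_const)
  qed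
  show "module R (quot_module M K)" "(\<lambda>x. K +>\<^bsub>M\<^esub> x) \<in> mod_hom R M (quot_module M K)"
    using module_image[OF assms(1) surj] by (simp_all add: K.a_rcos_sum sm z)
  show "K +>\<^bsub>M\<^esub> x = \<zero>\<^bsub>quot_module M K\<^esub> \<longleftrightarrow> x \<in> K" if "x \<in> carrier M"
    using coset_eq_iff[OF assms that M.M.zero_closed] that
      M.M.eq_minus_if_sum_eq[of x "\<zero>\<^bsub>M\<^esub>" x, symmetric] by (simp add: z)
qed

text \<open>
  Cokernels are carried by sets of cosets, but the definitions ask for auxiliary modules over the
  type of \<open>F\<close>; hence the copy, on coset representatives.
\<close>

lemma exists_copy:
  fixes F :: "('r, 'f) module"
  assumes F: "module R F" and X: "module R X" and q: "q \<in> mod_hom R F X" "q ` carrier F = carrier X"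
  obtains T :: "('r, 'f) module" and q' g where "module R T" "q' \<in> mod_hom R F T"
    "q' ` carrier F = carrier T" "g \<in> mod_hom R T X" "bij_betw g (carrier T) (carrier X)"
    "\<And>x. x \<in> carrier F \<Longrightarrow> g (q' x) = q x"
proof -
  define s where "s = inv_into (carrier F) q"
  have s: "s y \<in> carrier F" "q (s y) = y" if "y \<in> carrier X" for y
    using that q(2) by (auto simp: s_def intro: inv_into_into f_inv_into_f)
  define T :: "('r, 'f) module" where "T = \<lparr>carrier = s ` carrier X,
     monoid.mult = (\<lambda>_ _. undefined), one = undefined, ring.zero = s \<zero>\<^bsub>X\<^esub>,
     add = (\<lambda>x y. s (q x \<oplus>\<^bsub>X\<^esub> q y)), smult = (\<lambda>r x. s (r \<odot>\<^bsub>X\<^esub> q x))\<rparr>"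
  have T: "module R T" and sT: "s \<in> mod_hom R X T"
    by (rule module_image[OF X]; simp add: T_def s)+
  have qT: "q \<in> mod_hom R T X"
  proof -
    interpret X: module R X by fact
    show ?thesis by (rule mod_homI) (auto simp: T_def s)
  qed
  show thesis
  proof (rule that[OF T _ _ qT])
    show "(\<lambda>x. s (q x)) \<in> mod_hom R F T" by (rule mod_hom_compose[OF q(1) sT])
    show "(\<lambda>x. s (q x)) ` carrier F = carrier T" by (auto simp: T_def simp flip: q(2))
    show "bij_betw q (carrier T) (carrier X)"
      by (rule bij_betw_byWitness[where f' = s]) (auto simp: T_def s)
    show "q (s (q x)) = q x" if "x \<in> carrier F" for x using mod_hom_closed[OF q(1) that] by (rule s(2))
  qed
qed

section \<open>Linkage of modules\<close>

lemma mod_ker_eq: "mod_ker P M h = P\<lparr>carrier := {x \<in> carrier P. h x = \<zero>\<^bsub>M\<^esub>}\<rparr>"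
  by (simp add: mod_ker_def a_kernel_def')

lemma mod_iso_refl: "module R M \<Longrightarrow> mod_iso R M M"
  unfolding mod_iso_def by (intro conjI bexI[OF _ mod_hom_id]) (auto simp: bij_betw_def)

text \<open>The identification of \<open>F n\<close> with its dual. The restriction makes the
  functionals extensional, as membership in the Hom module requires.\<close>

definition dual_vec :: "('r, 'k) ring_scheme \<Rightarrow> nat \<Rightarrow> (nat \<Rightarrow> 'r) \<Rightarrow> (nat \<Rightarrow> 'r) \<Rightarrow> 'r" where
  "dual_vec R n w = (\<lambda>v\<in>carrier (free_mod R n). pairing R n v w)"

context cring
begin

text \<open>Duals of free modules are known only through an isomorphism \<open>\<theta>\<close> from
  a free module. A cokernel of a map into such a dual is rewritten here as a quotient of the free
  module by the submodule \<open>H\<close> that corresponds to the image.\<close>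

lemma cokernel_presentation:
  assumes F: "module R F" and \<theta>: "module R D" "\<theta> \<in> mod_hom R F D" "\<theta> ` carrier F = carrier D"
    "inj_on \<theta> (carrier F)"
    and H: "submodule H R F" and h: "h ` carrier C = \<theta> ` H"
  shows "module R (mod_cok C D h)"
    and "(\<lambda>v. h ` carrier C +>\<^bsub>D\<^esub> \<theta> v) \<in> mod_hom R F (mod_cok C D h)"
    and "(\<lambda>v. h ` carrier C +>\<^bsub>D\<^esub> \<theta> v) ` carrier F = carrier (mod_cok C D h)"
    and "v \<in> carrier F \<Longrightarrow> h ` carrier C +>\<^bsub>D\<^esub> \<theta> v = \<zero>\<^bsub>mod_cok C D h\<^esub> \<longleftrightarrow> v \<in> H"
proof -
  have K: "submodule (h ` carrier C) R D" unfolding h by (rule submodule_image[OF F \<theta>(1,2) H])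
  note Q = quot_module_props[OF \<theta>(1) K, folded mod_cok_def]
  show "module R (mod_cok C D h)" by (rule Q(1))
  show "(\<lambda>v. h ` carrier C +>\<^bsub>D\<^esub> \<theta> v) \<in> mod_hom R F (mod_cok C D h)"
    by (rule mod_hom_compose[OF \<theta>(2) Q(2)])
  show "(\<lambda>v. h ` carrier C +>\<^bsub>D\<^esub> \<theta> v) ` carrier F = carrier (mod_cok C D h)"
    unfolding Q(3)[symmetric] \<theta>(3)[symmetric] by (simp add: image_image)
  show "h ` carrier C +>\<^bsub>D\<^esub> \<theta> v = \<zero>\<^bsub>mod_cok C D h\<^esub> \<longleftrightarrow> v \<in> H" if v: "v \<in> carrier F"
  proof -
    have "\<theta> v \<in> \<theta> ` H \<longleftrightarrow> v \<in> H"
      using inj_on_image_mem_iff[OF \<theta>(4) v] submodule_sub[OF F H] by blast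
    then show ?thesis using Q(4)[OF mod_hom_closed[OF \<theta>(2) v]] h by simp
  qed
qed

section \<open>The dual of a free module\<close>

lemma dual_vec_inj: "inj_on (dual_vec R n) (carrier (free_mod R n))"
proof (rule inj_onI)
  fix w w' assume w: "w \<in> carrier (free_mod R n)" "w' \<in> carrier (free_mod R n)"
    and eq: "dual_vec R n w = dual_vec R n w'"
  show "w = w'"
  proof (rule pairing_nondegenerate[OF w])
    show "pairing R n v w = pairing R n v w'" if "v \<in> carrier (free_mod R n)" for v
      using fun_cong[OF eq, of v] that by (simp add: dual_vec_def)
  qed
qed

lemma dual_vec_hom: "w \<in> carrier (free_mod R n) \<Longrightarrow> dual_vec R n w \<in> mod_hom R (free_mod R n) (self_module R)"
  by (rule mod_hom_cong[OF pairing_hom free_mod_module]) (simp_all add: dual_vec_def)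

lemma dual_vec_surj:
  assumes "h \<in> mod_hom R (free_mod R n) (self_module R)" "h \<in> extensional (carrier (free_mod R n))"
  obtains w where "w \<in> carrier (free_mod R n)" "h = dual_vec R n w"
proof -
  obtain w where w: "w \<in> carrier (free_mod R n)"
    "\<And>v. v \<in> carrier (free_mod R n) \<Longrightarrow> h v = pairing R n v w"
    using functional_pairing[OF assms(1)] by blast
  have "h = dual_vec R n w"
    by (rule extensionalityI[OF assms(2)]) (auto simp: dual_vec_def w(2))
  with w(1) show thesis by (rule that)
qed

lemma dual_vec_add:
  assumes "w \<in> carrier (free_mod R n)" "w' \<in> carrier (free_mod R n)" "v \<in> carrier (free_mod R n)"
  shows "dual_vec R n (w \<oplus>\<^bsub>free_mod R n\<^esub> w') v = dual_vec R n w v \<oplus> dual_vec R n w' v"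
  using mod_hom_add[OF pairing_hom_right[OF assms(3)] assms(1,2)] assms(3)
  by (simp add: dual_vec_def)

lemma dual_vec_smult:
  assumes "w \<in> carrier (free_mod R n)" "r \<in> carrier R" "v \<in> carrier (free_mod R n)"
  shows "dual_vec R n (r \<odot>\<^bsub>free_mod R n\<^esub> w) v = r \<otimes> dual_vec R n w v"
  using mod_hom_smult[OF pairing_hom_right[OF assms(3)] assms(2,1)] assms(3)
  by (simp add: dual_vec_def)

lemma dual_vec_zero:
  assumes "v \<in> carrier (free_mod R n)"
  shows "dual_vec R n (\<lambda>_. \<zero>) v = \<zero>"
  using mod_hom_zero[OF free_mod_module self_module_module pairing_hom_right[OF assms]] assms
  by (simp add: dual_vec_def)

lemma dual_vec_adjoint:
  assumes "d \<in> mod_hom R (free_mod R k) (free_mod R n)" "w \<in> carrier (free_mod R n)"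
  shows "dual_map (free_mod R k) d (dual_vec R n w) = dual_vec R k (adjoint R k n d w)"
  using pairing_adjoint[OF assms] mod_hom_closed[OF assms(1)]
  by (auto simp: dual_map_def dual_vec_def compose_def fun_eq_iff)

lemma dual_free_mod:
  shows "module R (dual R (free_mod R n))"
    and "dual_vec R n \<in> mod_hom R (free_mod R n) (dual R (free_mod R n))"
    and "dual_vec R n ` carrier (free_mod R n) = carrier (dual R (free_mod R n))"
proof -
  show im: "dual_vec R n ` carrier (free_mod R n) = carrier (dual R (free_mod R n))"
  proof (intro equalityI subsetI)
    fix h assume "h \<in> carrier (dual R (free_mod R n))"
    then show "h \<in> dual_vec R n ` carrier (free_mod R n)"
      using dual_vec_surj[of h n] by (auto simp: dual_def Hom_module_def)
  next
    fix h assume "h \<in> dual_vec R n ` carrier (free_mod R n)"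
    then obtain w where "w \<in> carrier (free_mod R n)" "h = dual_vec R n w" by blast
    then show "h \<in> carrier (dual R (free_mod R n))"
      using dual_vec_hom[of w n] by (auto simp: dual_def Hom_module_def dual_vec_def)
  qed
  have eq: "dual_vec R n w = restrict g (carrier (free_mod R n))"
    if "\<And>v. v \<in> carrier (free_mod R n) \<Longrightarrow> dual_vec R n w v = g v" for w g
    using that by (auto simp: fun_eq_iff dual_vec_def)
  have ops: "x \<oplus>\<^bsub>dual R (free_mod R n)\<^esub> y = (\<lambda>v\<in>carrier (free_mod R n). x v \<oplus> y v)"
    "r \<odot>\<^bsub>dual R (free_mod R n)\<^esub> x = (\<lambda>v\<in>carrier (free_mod R n). r \<otimes> x v)"
    "\<zero>\<^bsub>dual R (free_mod R n)\<^esub> = (\<lambda>v\<in>carrier (free_mod R n). \<zero>)" for x y r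
    by (simp_all add: dual_def Hom_module_def)
  have add: "dual_vec R n (x \<oplus>\<^bsub>free_mod R n\<^esub> y)
      = dual_vec R n x \<oplus>\<^bsub>dual R (free_mod R n)\<^esub> dual_vec R n y"
    if "x \<in> carrier (free_mod R n)" "y \<in> carrier (free_mod R n)" for x y
    unfolding ops by (rule eq) (rule dual_vec_add[OF that])
  have smult: "dual_vec R n (r \<odot>\<^bsub>free_mod R n\<^esub> x) = r \<odot>\<^bsub>dual R (free_mod R n)\<^esub> dual_vec R n x"
    if "r \<in> carrier R" "x \<in> carrier (free_mod R n)" for r x
    unfolding ops by (rule eq) (rule dual_vec_smult[OF that(2,1)])
  have zero: "dual_vec R n \<zero>\<^bsub>free_mod R n\<^esub> = \<zero>\<^bsub>dual R (free_mod R n)\<^esub>"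
    unfolding ops free_mod_simps by (rule eq) (rule dual_vec_zero)
  show "module R (dual R (free_mod R n))"
    by (rule module_image(1)[OF free_mod_module im]; intro add smult zero)
  show "dual_vec R n \<in> mod_hom R (free_mod R n) (dual R (free_mod R n))"
    by (rule module_image(2)[OF free_mod_module im]; intro add smult zero)
qed

end

section \<open>The operation lambda on modules\<close>

context noetherian_local_ring
begin

lemma superfluous_free_mod:
  assumes "K \<subseteq> carrier (free_mod R n)" "\<And>k i. k \<in> K \<Longrightarrow> k i \<in> \<mm>"
  shows "superfluous R (free_mod R n) K"
  unfolding superfluous_def
proof (intro allI impI, elim conjE)
  fix N assume N: "submodule N R (free_mod R n)" and eq: "N <+>\<^bsub>free_mod R n\<^esub> K = carrier (free_mod R n)"
  show "N = carrier (free_mod R n)"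
  proof (rule nakayama_free_mod[OF N])
    fix v assume "v \<in> carrier (free_mod R n)"
    then have "v \<in> N <+>\<^bsub>free_mod R n\<^esub> K" by (simp add: eq)
    then obtain x k where xk: "x \<in> N" "k \<in> K" "v = (\<lambda>i. x i \<oplus> k i)"
      by (auto simp: set_add_iff)
    moreover have "k \<in> carrier (free_mod R n)" using xk(2) assms(1) by (rule rev_subsetD)
    ultimately show "\<exists>x\<in>N. \<exists>k\<in>carrier (free_mod R n). (\<forall>i. k i \<in> \<mm>) \<and> v = (\<lambda>i. x i \<oplus> k i)"
      using assms(2)[OF xk(2)] by metis
  qed
qed

lemma projective_cover_free_mod:
  assumes "q \<in> mod_hom R (free_mod R n) M" "q ` carrier (free_mod R n) = carrier M"
    and "\<And>k i. k \<in> carrier (free_mod R n) \<Longrightarrow> q k = \<zero>\<^bsub>M\<^esub> \<Longrightarrow> k i \<in> \<mm>"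
  shows "projective_cover R (free_mod R n) q M"
  unfolding projective_cover_def
  using assms free_mod_projective by (auto simp: a_kernel_def' intro!: superfluous_free_mod)

text \<open>Each summand has a factor in \<open>\<mm>\<close>. The alternative with a zero
  coordinate is for functionals that vanish on a smaller free module \<open>F a\<close>: they do not
  see the coordinates of \<open>v\<close> below \<open>a\<close>, over which minimality may give no
  control.\<close>

lemma pairing_in_max:
  assumes "v \<in> carrier (free_mod R n)" "w \<in> carrier (free_mod R n)"
    and "\<And>i. i < n \<Longrightarrow> v i \<in> \<mm> \<or> w (n - 1 - i) = \<zero>"
  shows "pairing R n v w \<in> \<mm>"
  unfolding pairing_eq_sum[OF assms(1,2)]
proof (rule max_sum)
  fix i assume "i \<in> {..<n}"
  then show "v i \<otimes> w (n - 1 - i) \<in> \<mm>"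
    using assms(3)[of i] assms(1,2) by (auto simp: free_mod_carrier intro: max_mult)
qed simp

text \<open>Let \<open>d\<close> present \<open>M\<close> minimally. The transpose is the cokernel
  of the adjoint of \<open>d\<close>, and the columns of \<open>d\<close> lie in \<open>K\<close>,
  so the adjoint has its image in \<open>\<mm>\<close> times \<open>R^k\<close>. Hence
  \<open>R^k\<close> covers the transpose minimally, and the syzygy is the image of the adjoint. The
  conclusion describes it by the same data as \<open>M\<close>, with \<open>K\<close> replaced by
  its annihilator, so that the lemma can be iterated.\<close>

lemma exists_lambda_module:
  assumes M: "module R M" and q: "q \<in> mod_hom R (free_mod R n) M" "q ` carrier (free_mod R n) = carrier M"
    and K: "K = {v \<in> carrier (free_mod R n). q v = \<zero>\<^bsub>M\<^esub>}"
    and small: "\<And>k i. k \<in> K \<Longrightarrow> k i \<in> \<mm>"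
  obtains L :: "('a, nat \<Rightarrow> 'a) module" and q' where "is_lambda R M L" "module R L"
    "q' \<in> mod_hom R (free_mod R n) L" "q' ` carrier (free_mod R n) = carrier L"
    "annihilator R n K = {v \<in> carrier (free_mod R n). q' v = \<zero>\<^bsub>L\<^esub>}"
proof -
  let ?F = "free_mod R n"
  have Ksub: "submodule K R ?F" unfolding K by (rule submodule_kernel[OF free_mod_module M q(1)])
  obtain k d where d: "d \<in> mod_hom R (free_mod R k) ?F" "d ` carrier (free_mod R k) = K"
    and kd: "\<And>v i. v \<in> carrier (free_mod R k) \<Longrightarrow> d v = \<zero>\<^bsub>?F\<^esub> \<Longrightarrow> v i \<in> \<mm>"
    using exists_minimal_cover[OF free_mod_module Ksub submodule_free_mod_fin_gen[OF Ksub]] by metis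
  let ?Fk = "free_mod R k"
  let ?adj = "adjoint R k n d"
  note adj = adjoint_hom[OF d(1)]
  have mk: "mod_ker ?F M q = ?F\<lparr>carrier := K\<rparr>" by (simp add: mod_ker_eq K)
  have dK: "d \<in> mod_hom R ?Fk (?F\<lparr>carrier := K\<rparr>)"
    using mod_hom_carrier_update[OF d(1) subset_refl, of K] d(2) by simp
  have pres: "min_proj_presentation R ?Fk d ?F q M"
    unfolding min_proj_presentation_def mk
    using projective_cover_free_mod[OF q] projective_cover_free_mod[OF dK] small kd d(2) by (auto simp: K)
  let ?X = "mod_cok (dual R ?F) (dual R ?Fk) (dual_map ?Fk d)"
  have im: "dual_map ?Fk d ` carrier (dual R ?F) = dual_vec R k ` (?adj ` carrier ?F)"
    unfolding dual_free_mod(3)[symmetric] image_image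
    by (intro image_cong refl) (simp add: dual_vec_adjoint[OF d(1)])
  have H: "submodule (?adj ` carrier ?F) R ?Fk"
    by (rule submodule_image[OF free_mod_module free_mod_module adj submodule_carrier[OF free_mod_module]])
  note X = cokernel_presentation[OF free_mod_module dual_free_mod dual_vec_inj H im]
  obtain T :: "('a, nat \<Rightarrow> 'a) module" and t g where T: "module R T" "t \<in> mod_hom R ?Fk T"
    "t ` carrier ?Fk = carrier T" "g \<in> mod_hom R T ?X" "bij_betw g (carrier T) (carrier ?X)"
    and gt: "\<And>v. v \<in> carrier ?Fk \<Longrightarrow> g (t v) = dual_map ?Fk d ` carrier (dual R ?F) +>\<^bsub>dual R ?Fk\<^esub> dual_vec R k v"
    using exists_copy[OF free_mod_module X(1-3)] by metis
  have "mod_iso R T ?X" unfolding mod_iso_def using T X(1) by blast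
  with pres have "is_transpose R M T" unfolding is_transpose_def by blast
  moreover have kert: "t v = \<zero>\<^bsub>T\<^esub> \<longleftrightarrow> v \<in> ?adj ` carrier ?F" if v: "v \<in> carrier ?Fk" for v
  proof -
    have "t v = \<zero>\<^bsub>T\<^esub> \<longleftrightarrow> g (t v) = g \<zero>\<^bsub>T\<^esub>"
      using T(5) mod_hom_closed[OF T(2) v] submodule_zero[OF T(1) submodule_carrier[OF T(1)]]
      by (auto simp: bij_betw_def dest: inj_onD)
    also have "\<dots> \<longleftrightarrow> v \<in> ?adj ` carrier ?F"
      using X(4)[OF v] gt[OF v] mod_hom_zero[OF T(1) X(1) T(4)] by simp
    finally show ?thesis .
  qed
  \<comment> \<open>The kernel of the cover is the image of the adjoint; the adjoint itself serves
    as the new map \<open>q'\<close>.\<close>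
  let ?L = "?Fk\<lparr>carrier := ?adj ` carrier ?F\<rparr>"
  have Lk: "mod_ker ?Fk T t = ?L"
  proof -
    have "{v \<in> carrier ?Fk. t v = \<zero>\<^bsub>T\<^esub>} = ?adj ` carrier ?F"
      using kert mod_hom_closed[OF adj] by auto
    then show ?thesis by (simp add: mod_ker_eq)
  qed
  have mL: "module R ?L" by (rule submodule_module[OF free_mod_module H])
  have "projective_cover R ?Fk t T"
  proof (rule projective_cover_free_mod[OF T(2,3)])
    fix v i assume v: "v \<in> carrier ?Fk" "t v = \<zero>\<^bsub>T\<^esub>"
    then obtain w where w: "w \<in> carrier ?F" "v = ?adj w" using kert by blast
    show "v i \<in> \<mm>"
    proof (cases "i < k")
      case True
      \<comment> \<open>Coordinate \<open>i\<close> of the adjoint pairs \<open>w\<close> with this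
        column of \<open>d\<close>, whose entries lie in \<open>\<mm>\<close> because it belongs to
        \<open>K\<close>.\<close>
      then have "d (unit_vec R (k - 1 - i)) \<in> K" using d(2) by auto
      then have "pairing R n (d (unit_vec R (k - 1 - i))) w \<in> \<mm>"
        using w(1) small by (intro pairing_in_max) (auto simp: K)
      then show ?thesis using True by (simp add: w(2) adjoint_def)
    qed (simp add: w(2) adjoint_def)
  qed
  then have "is_syzygy R T ?L"
    unfolding is_syzygy_def using mod_iso_refl[OF mL] Lk by metis
  ultimately have "is_lambda R M ?L" unfolding is_lambda_def by blast
  then show thesis
  proof (rule that[OF _ mL])
    show "?adj \<in> mod_hom R ?F ?L" using mod_hom_carrier_update[OF adj subset_refl] by simp
    show "?adj ` carrier ?F = carrier ?L" by simp
    show "annihilator R n K = {v \<in> carrier ?F. ?adj v = \<zero>\<^bsub>?L\<^esub>}"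
      using adjoint_eq_zero_iff[OF d(1)] annihilator_sub[of n K] by (auto simp: d(2))
  qed
qed

theorem horizontally_linked_module_iff_torsionless:
  assumes fg: "fg_module R M" and st: "stable_module R M"
  shows "horizontally_linked_module R M \<longleftrightarrow> torsionless R M"
proof
  assume "horizontally_linked_module R M"
  then obtain L N :: "('a, nat \<Rightarrow> 'a) module" where LN: "is_lambda R L N" "mod_iso R M N"
    unfolding horizontally_linked_module_def by blast
  then obtain T P :: "('a, nat \<Rightarrow> 'a) module" and p where P: "projective_cover R P p T"
    and N: "mod_iso R N (mod_ker P T p)"
    unfolding is_lambda_def is_syzygy_def by blast
  have pP: "projective_module R P" using P by (simp add: projective_cover_def)
  then have mP: "module R P" by (simp add: projective_module_def fg_module_def)
  obtain h where h: "h \<in> mod_hom R M N" "bij_betw h (carrier M) (carrier N)"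
    using LN(2) unfolding mod_iso_def by blast
  obtain g where g: "g \<in> mod_hom R N (mod_ker P T p)" "bij_betw g (carrier N) (carrier (mod_ker P T p))"
    using N unfolding mod_iso_def by blast
  have mN: "module R N" and mK: "module R (mod_ker P T p)" using N by (auto simp: mod_iso_def)
  have "(\<lambda>x. x) \<in> mod_hom R (mod_ker P T p) P" by (rule mod_homI) (auto simp: mod_ker_eq)
  then have "torsionless R (mod_ker P T p)"
    by (rule torsionless_inj[OF mK mP _ _ projective_torsionless[OF pP]]) simp
  then have "torsionless R N" by (rule torsionless_inj[OF mN mK g(1) bij_betw_imp_inj_on[OF g(2)]])
  then show "torsionless R M"
    using fg by (intro torsionless_inj[OF _ mN h(1) bij_betw_imp_inj_on[OF h(2)]]) (simp_all add: fg_module_def)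
next
  assume tl: "torsionless R M"
  have M: "module R M" "fin_gen R M (carrier M)" using fg by (auto simp: fg_module_iff)
  obtain n q where q: "q \<in> mod_hom R (free_mod R n) M" "q ` carrier (free_mod R n) = carrier M"
    and small: "\<And>k i. k \<in> carrier (free_mod R n) \<Longrightarrow> q k = \<zero>\<^bsub>M\<^esub> \<Longrightarrow> k i \<in> \<mm>"
    using exists_minimal_cover[OF M(1) submodule_carrier[OF M(1)] M(2)] by metis
  define K where "K = {v \<in> carrier (free_mod R n). q v = \<zero>\<^bsub>M\<^esub>}"
  have sK: "k i \<in> \<mm>" if "k \<in> K" for k i using small that by (auto simp: K_def)
  obtain L :: "('a, nat \<Rightarrow> 'a) module" and l where L: "is_lambda R M L" "module R L"
    "l \<in> mod_hom R (free_mod R n) L" "l ` carrier (free_mod R n) = carrier L"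
    "annihilator R n K = {v \<in> carrier (free_mod R n). l v = \<zero>\<^bsub>L\<^esub>}"
    by (rule exists_lambda_module[OF M(1) q K_def]) (rule sK)
  \<comment> \<open>Stability of \<open>M\<close> makes the map from \<open>F n\<close> onto the
    first \<open>L\<close> minimal again, so the construction can be repeated over the same
    \<open>F n\<close>.\<close>
  have sA: "k i \<in> \<mm>" if "k \<in> annihilator R n K" for k i
    using annihilator_in_max[OF M(1) st q] that by (simp add: K_def)
  obtain N :: "('a, nat \<Rightarrow> 'a) module" and p where N: "is_lambda R L N" "module R N"
    "p \<in> mod_hom R (free_mod R n) N" "p ` carrier (free_mod R n) = carrier N"
    "annihilator R n (annihilator R n K) = {v \<in> carrier (free_mod R n). p v = \<zero>\<^bsub>N\<^esub>}"
    by (rule exists_lambda_module[OF L(2-5)]) (rule sA)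
  have ker: "q v = \<zero>\<^bsub>M\<^esub> \<longleftrightarrow> p v = \<zero>\<^bsub>N\<^esub>" if "v \<in> carrier (free_mod R n)" for v
    using N(5) annihilator_annihilator[OF M(1) q(1) tl] that by (auto simp: K_def)
  obtain h where "h \<in> mod_hom R M N" "bij_betw h (carrier M) (carrier N)"
    using mod_iso_from_equal_kernels[OF free_mod_module M(1) N(2) q(1) N(3) q(2) N(4) ker] by metis
  then have "mod_iso R M N" unfolding mod_iso_def using M(1) N(2) by blast
  then show "horizontally_linked_module R M"
    unfolding horizontally_linked_module_def using L(1) N(1) by blast
qed

end

section \<open>Linkage in the category of homomorphisms\<close>

text \<open>For \<open>a \<le> b\<close> a model of the projective object given by the identity of
  \<open>F a\<close> plus the map from zero to \<open>F (b - a)\<close>, without a product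
  type.\<close>

definition incl_arrow :: "('r, 'k) ring_scheme \<Rightarrow> nat \<Rightarrow> nat \<Rightarrow> 'r uarrow" where
  "incl_arrow R a b = \<lparr>Dom = free_mod R a, Cod = free_mod R b, Arr = (\<lambda>x. x)\<rparr>"

text \<open>Minimality is not included; it enters through smallness conditions on the kernels of
  \<open>p\<close> and \<open>q\<close>.\<close>

definition arrow_cover ::
    "('r, 'k) ring_scheme \<Rightarrow> nat \<Rightarrow> nat \<Rightarrow> ((nat \<Rightarrow> 'r) \<Rightarrow> 'a) \<Rightarrow> ((nat \<Rightarrow> 'r) \<Rightarrow> 'b) \<Rightarrow>
     ('r, 'a, 'b) arrow \<Rightarrow> bool" where
  "arrow_cover R a b p q G \<longleftrightarrow> is_arrow R G \<and> (p, q) \<in> arrow_hom R (incl_arrow R a b) G \<and>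
     p ` carrier (free_mod R a) = carrier (Dom G) \<and> q ` carrier (free_mod R b) = carrier (Cod G)"

text \<open>A morphism from the inclusion to the identity of \<open>R\<close>, or to the map from
  zero to \<open>R\<close>, is determined by its second component: the first one is the restriction
  to \<open>F a\<close>.\<close>

definition pair_vec ::
    "('r, 'k) ring_scheme \<Rightarrow> nat \<Rightarrow> nat \<Rightarrow> (nat \<Rightarrow> 'r) \<Rightarrow> ((nat \<Rightarrow> 'r) \<Rightarrow> 'r) \<times> ((nat \<Rightarrow> 'r) \<Rightarrow> 'r)" where
  "pair_vec R a b w = (restrict (dual_vec R b w) (carrier (free_mod R a)), dual_vec R b w)"

lemma incl_arrow_simps [simp]:
  "Dom (incl_arrow R a b) = free_mod R a" "Cod (incl_arrow R a b) = free_mod R b"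
  "Arr (incl_arrow R a b) = (\<lambda>x. x)"
  by (simp_all add: incl_arrow_def)

lemma arrow_coverD:
  assumes "arrow_cover R a b p q G"
  shows "module R (Dom G)" "module R (Cod G)" "Arr G \<in> mod_hom R (Dom G) (Cod G)"
    "p \<in> mod_hom R (free_mod R a) (Dom G)" "q \<in> mod_hom R (free_mod R b) (Cod G)"
    "p ` carrier (free_mod R a) = carrier (Dom G)" "q ` carrier (free_mod R b) = carrier (Cod G)"
    "\<And>v. v \<in> carrier (free_mod R a) \<Longrightarrow> Arr G (p v) = q v"
  using assms unfolding arrow_cover_def is_arrow_def arrow_hom_def by auto

lemma arrow_coverI:
  assumes "module R (Dom G)" "module R (Cod G)" "Arr G \<in> mod_hom R (Dom G) (Cod G)"
    "p \<in> mod_hom R (free_mod R a) (Dom G)" "q \<in> mod_hom R (free_mod R b) (Cod G)"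
    "p ` carrier (free_mod R a) = carrier (Dom G)" "q ` carrier (free_mod R b) = carrier (Cod G)"
    "\<And>v. v \<in> carrier (free_mod R a) \<Longrightarrow> Arr G (p v) = q v"
  shows "arrow_cover R a b p q G"
  using assms unfolding arrow_cover_def is_arrow_def arrow_hom_def by simp

lemma arrow_iso_refl: "is_arrow R F \<Longrightarrow> arrow_iso R F F"
  unfolding arrow_iso_def
  by (intro conjI bexI[of _ "(\<lambda>x. x, \<lambda>x. x)"]) (auto simp: arrow_hom_def mod_hom_id bij_betw_def)

lemma mod_dsum_simps [simp]:
  "carrier (mod_dsum M N) = carrier M \<times> carrier N"
  "\<zero>\<^bsub>mod_dsum M N\<^esub> = (\<zero>\<^bsub>M\<^esub>, \<zero>\<^bsub>N\<^esub>)"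
  "x \<oplus>\<^bsub>mod_dsum M N\<^esub> y = (fst x \<oplus>\<^bsub>M\<^esub> fst y, snd x \<oplus>\<^bsub>N\<^esub> snd y)"
  "r \<odot>\<^bsub>mod_dsum M N\<^esub> x = (r \<odot>\<^bsub>M\<^esub> fst x, r \<odot>\<^bsub>N\<^esub> snd x)"
  by (simp_all add: mod_dsum_def split_beta)

lemma torsionless_mod_dsum:
  assumes "torsionless R P" "torsionless R Q"
  shows "torsionless R (mod_dsum P Q)"
  unfolding torsionless_def
proof (intro ballI impI)
  fix z assume z: "z \<in> carrier (mod_dsum P Q)" "z \<noteq> \<zero>\<^bsub>mod_dsum P Q\<^esub>"
  have P: "fst \<in> mod_hom R (mod_dsum P Q) P" and Q: "snd \<in> mod_hom R (mod_dsum P Q) Q"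
    by (auto intro!: mod_homI)
  show "\<exists>h\<in>mod_hom R (mod_dsum P Q) (self_module R). h z \<noteq> \<zero>\<^bsub>R\<^esub>"
  proof (cases "fst z = \<zero>\<^bsub>P\<^esub>")
    case True
    then have "snd z \<in> carrier Q" "snd z \<noteq> \<zero>\<^bsub>Q\<^esub>" using z by (auto simp: prod_eq_iff)
    then obtain h where "h \<in> mod_hom R Q (self_module R)" "h (snd z) \<noteq> \<zero>\<^bsub>R\<^esub>"
      using assms(2) unfolding torsionless_def by blast
    then show ?thesis by (intro bexI[of _ "\<lambda>z. h (snd z)"] mod_hom_compose[OF Q])
  next
    case False
    have "fst z \<in> carrier P" using z by auto
    then obtain h where "h \<in> mod_hom R P (self_module R)" "h (fst z) \<noteq> \<zero>\<^bsub>R\<^esub>"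
      using assms(1) False unfolding torsionless_def by blast
    then show ?thesis by (intro bexI[of _ "\<lambda>z. h (fst z)"] mod_hom_compose[OF P])
  qed
qed

section \<open>The projective objects given by inclusions of free modules\<close>

context cring
begin

lemma incl_arrow_is_arrow: "a \<le> b \<Longrightarrow> is_arrow R (incl_arrow R a b)"
  unfolding is_arrow_def by (auto intro!: mod_homI simp: free_mod_module free_mod_mono)

lemma projective_incl_arrow:
  assumes ab: "a \<le> b"
  shows "projective_arrow R (incl_arrow R a b)"
proof -
  let ?P = "free_mod R a" and ?Q = "free_mod R (b - a)"
  let ?G = "arrow_dsum (id_arrow ?P) (zero_arrow ?Q)"
  define \<alpha> :: "(nat \<Rightarrow> 'a) \<Rightarrow> (nat \<Rightarrow> 'a) \<times> (nat \<Rightarrow> 'a)" where "\<alpha> v = (v, \<lambda>_. \<zero>)" for v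
  \<comment> \<open>Vectors of \<open>F b\<close> are cut at position \<open>a\<close>; on
    \<open>F a\<close> the second piece is zero, which gives the compatible map
    \<open>\<alpha>\<close>.\<close>
  define \<beta> where "\<beta> v = (truncate R a v, \<lambda>i. v (a + i))" for v
  have D: "Dom ?G = mod_dsum ?P (zero_submodule ?Q)" "Cod ?G = mod_dsum ?P ?Q"
    "Arr ?G = map_prod (\<lambda>x. x) (\<lambda>x. x)"
    by (simp_all add: arrow_dsum_def id_arrow_def zero_arrow_def)
  have zq: "carrier (zero_submodule ?Q) = {\<lambda>_. \<zero>}" "\<zero>\<^bsub>zero_submodule ?Q\<^esub> = (\<lambda>_. \<zero>)"
    "x \<oplus>\<^bsub>zero_submodule ?Q\<^esub> y = (\<lambda>i. x i \<oplus> y i)" "r \<odot>\<^bsub>zero_submodule ?Q\<^esub> x = (\<lambda>i. r \<otimes> x i)" for x y r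
    by (simp_all add: zero_submodule_def free_mod_def)
  have im\<alpha>: "\<alpha> ` carrier ?P = carrier (Dom ?G)" by (auto simp: D zq \<alpha>_def)
  have \<alpha>: "module R (Dom ?G)" "\<alpha> \<in> mod_hom R ?P (Dom ?G)"
    by (rule module_image(1)[OF free_mod_module im\<alpha>] module_image(2)[OF free_mod_module im\<alpha>];
        simp add: D zq \<alpha>_def)+
  have im\<beta>: "\<beta> ` carrier (free_mod R b) = carrier (Cod ?G)"
  proof (intro equalityI subsetI)
    fix z assume "z \<in> \<beta> ` carrier (free_mod R b)"
    then show "z \<in> carrier (Cod ?G)"
      using ab by (auto simp: D \<beta>_def truncate_def free_mod_carrier)
  next
    fix z assume z: "z \<in> carrier (Cod ?G)"
    define v where "v = (\<lambda>i. if i < a then fst z i else snd z (i - a))"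
    have "v \<in> carrier (free_mod R b)" using z ab by (auto simp: D v_def free_mod_carrier)
    moreover have "z = \<beta> v"
      using z by (auto simp: D \<beta>_def v_def truncate_def free_mod_carrier prod_eq_iff fun_eq_iff)
    ultimately show "z \<in> \<beta> ` carrier (free_mod R b)" by blast
  qed
  have \<beta>: "module R (Cod ?G)" "\<beta> \<in> mod_hom R (free_mod R b) (Cod ?G)"
    by (rule module_image(1)[OF free_mod_module im\<beta>] module_image(2)[OF free_mod_module im\<beta>];
        auto simp: D \<beta>_def truncate_def fun_eq_iff)+
  have "inj_on \<beta> (carrier (free_mod R b))"
  proof (rule inj_onI)
    fix v w assume "\<beta> v = \<beta> w"
    then have *: "truncate R a v = truncate R a w" "\<And>i. v (a + i) = w (a + i)"
      by (auto simp: \<beta>_def fun_eq_iff)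
    show "v = w"
    proof
      show "v i = w i" for i
        using fun_cong[OF *(1), of i] *(2)[of "i - a"] by (cases "i < a") (auto simp: truncate_def)
    qed
  qed
  moreover have "inj_on \<alpha> (carrier ?P)" by (auto simp: inj_on_def \<alpha>_def)
  moreover have "(\<alpha>, \<beta>) \<in> arrow_hom R (incl_arrow R a b) ?G"
    using \<alpha>(2) \<beta>(2)
    by (auto simp: arrow_hom_def D \<alpha>_def \<beta>_def truncate_id free_mod_carrier fun_eq_iff truncate_def)
  moreover have "Arr ?G \<in> mod_hom R (Dom ?G) (Cod ?G)"
    by (rule mod_homI) (auto simp: D zq free_mod_carrier)
  ultimately have "arrow_iso R (incl_arrow R a b) ?G"
    unfolding arrow_iso_def using incl_arrow_is_arrow[OF ab] \<alpha>(1) \<beta>(1) im\<alpha> im\<beta>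
    by (intro conjI bexI[of _ "(\<alpha>, \<beta>)"]) (auto simp: is_arrow_def bij_betw_def)
  then show ?thesis unfolding projective_arrow_def using free_mod_projective by blast
qed

lemma arrow_ker_incl_arrow:
  "arrow_ker (incl_arrow R a b) G (p, q) =
     \<lparr>Dom = free_mod R a\<lparr>carrier := {v \<in> carrier (free_mod R a). p v = \<zero>\<^bsub>Dom G\<^esub>}\<rparr>,
      Cod = free_mod R b\<lparr>carrier := {v \<in> carrier (free_mod R b). q v = \<zero>\<^bsub>Cod G\<^esub>}\<rparr>,
      Arr = (\<lambda>x. x)\<rparr>"
  by (simp add: arrow_ker_def mod_ker_eq)

section \<open>The dual object of an inclusion of free modules\<close>

lemma pair_vec_inj: "inj_on (pair_vec R a b) (carrier (free_mod R b))"
  using dual_vec_inj[of b] by (auto simp: inj_on_def pair_vec_def)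

text \<open>The formulas are the same for both targets. The source and the target of
  \<open>arrow_star\<close> thus share their operations, and a sum formed in one of them can be read
  in the other.\<close>

lemma arrow_Hom_ops:
  fixes a b :: nat
  assumes "G = zero_arrow (self_module R) \<or> G = id_arrow (self_module R)"
  defines "H \<equiv> arrow_Hom R (incl_arrow R a b) G"
  shows "x \<oplus>\<^bsub>H\<^esub> y = (\<lambda>v\<in>carrier (free_mod R a). fst x v \<oplus> fst y v, \<lambda>v\<in>carrier (free_mod R b). snd x v \<oplus> snd y v)"
    and "r \<odot>\<^bsub>H\<^esub> x = (\<lambda>v\<in>carrier (free_mod R a). r \<otimes> fst x v, \<lambda>v\<in>carrier (free_mod R b). r \<otimes> snd x v)"
    and "\<zero>\<^bsub>H\<^esub> = (\<lambda>v\<in>carrier (free_mod R a). \<zero>, \<lambda>v\<in>carrier (free_mod R b). \<zero>)"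
  using assms(1) unfolding H_def
  by (auto simp: arrow_Hom_def Let_def mod_dsum_def Hom_module_def zero_arrow_def id_arrow_def
      zero_submodule_def self_module_def split_beta)

text \<open>Once the image is known, the module structure of \<open>H\<close> is carried over from a
  free module. The rank \<open>c\<close> will be \<open>b\<close> for the identity of
  \<open>R\<close> and \<open>b - a\<close> for the map from zero to \<open>R\<close>.\<close>

lemma pair_vec_image:
  assumes ab: "a \<le> b" and G: "G = zero_arrow (self_module R) \<or> G = id_arrow (self_module R)"
    and c: "c \<le> b"
  defines "H \<equiv> arrow_Hom R (incl_arrow R a b) G"
  assumes im: "pair_vec R a b ` carrier (free_mod R c) = carrier H"
  shows "module R H" "pair_vec R a b \<in> mod_hom R (free_mod R c) H"
proof -
  note ops = arrow_Hom_ops[where a = a and b = b, OF G, folded H_def]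
  have eq: "pair_vec R a b w = (restrict g (carrier (free_mod R a)), restrict g (carrier (free_mod R b)))"
    if "\<And>v. v \<in> carrier (free_mod R b) \<Longrightarrow> dual_vec R b w v = g v" for w g
    using that ab free_mod_mono[OF ab, of _ R] by (auto simp: fun_eq_iff pair_vec_def dual_vec_def)
  have restr: "(\<lambda>v\<in>carrier (free_mod R a). h (restrict g (carrier (free_mod R a)) v))
      = (\<lambda>v\<in>carrier (free_mod R a). h (g v))" for g :: "(nat \<Rightarrow> 'a) \<Rightarrow> 'a" and h :: "'a \<Rightarrow> 'a"
    by (auto simp: fun_eq_iff)
  have restr2: "(\<lambda>v\<in>carrier (free_mod R a). restrict g (carrier (free_mod R a)) v \<oplus> restrict g' (carrier (free_mod R a)) v)
      = (\<lambda>v\<in>carrier (free_mod R a). g v \<oplus> g' v)" for g g' :: "(nat \<Rightarrow> 'a) \<Rightarrow> 'a"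
    by (auto simp: fun_eq_iff)
  have cb: "x \<in> carrier (free_mod R b)" if "x \<in> carrier (free_mod R c)" for x
    using free_mod_mono[OF c that] .
  have add: "pair_vec R a b (x \<oplus>\<^bsub>free_mod R c\<^esub> y) = pair_vec R a b x \<oplus>\<^bsub>H\<^esub> pair_vec R a b y"
    if "x \<in> carrier (free_mod R c)" "y \<in> carrier (free_mod R c)" for x y
    using dual_vec_add[OF cb[OF that(1)] cb[OF that(2)]]
    by (subst eq[of _ "\<lambda>v. dual_vec R b x v \<oplus> dual_vec R b y v"]) (auto simp: ops pair_vec_def restr2)
  have smult: "pair_vec R a b (r \<odot>\<^bsub>free_mod R c\<^esub> x) = r \<odot>\<^bsub>H\<^esub> pair_vec R a b x"
    if "r \<in> carrier R" "x \<in> carrier (free_mod R c)" for r x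
    using dual_vec_smult[OF cb[OF that(2)] that(1)]
    by (subst eq[of _ "\<lambda>v. r \<otimes> dual_vec R b x v"]) (auto simp: ops pair_vec_def restr)
  have zero: "pair_vec R a b \<zero>\<^bsub>free_mod R c\<^esub> = \<zero>\<^bsub>H\<^esub>"
    using dual_vec_zero[of _ b] by (subst eq[of _ "\<lambda>_. \<zero>"]) (auto simp: ops)
  show "module R H" by (rule module_image(1)[OF free_mod_module im]; intro add smult zero)
  show "pair_vec R a b \<in> mod_hom R (free_mod R c) H"
    by (rule module_image(2)[OF free_mod_module im]; intro add smult zero)
qed

lemma arrow_Hom_carrier:
  "(g, h) \<in> carrier (arrow_Hom R (incl_arrow R a b) G) \<longleftrightarrow>
     g \<in> mod_hom R (free_mod R a) (Dom G) \<and> g \<in> extensional (carrier (free_mod R a)) \<and>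
     h \<in> mod_hom R (free_mod R b) (Cod G) \<and> h \<in> extensional (carrier (free_mod R b)) \<and>
     (\<forall>x\<in>carrier (free_mod R a). Arr G (g x) = h x)"
  by (auto simp: arrow_Hom_def Let_def Hom_module_def arrow_hom_def)

lemma arrow_star_cod:
  assumes ab: "a \<le> b"
  defines "H \<equiv> arrow_Hom R (incl_arrow R a b) (id_arrow (self_module R))"
  shows "module R H" "pair_vec R a b \<in> mod_hom R (free_mod R b) H"
    "pair_vec R a b ` carrier (free_mod R b) = carrier H"
proof -
  show im: "pair_vec R a b ` carrier (free_mod R b) = carrier H"
  proof (intro equalityI subsetI)
    fix z assume "z \<in> pair_vec R a b ` carrier (free_mod R b)"
    then obtain w where w: "w \<in> carrier (free_mod R b)" "z = pair_vec R a b w" by blast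
    have "restrict (dual_vec R b w) (carrier (free_mod R a)) \<in> mod_hom R (free_mod R a) (self_module R)"
      by (rule mod_hom_cong[OF mod_hom_free_mod_mono[OF ab dual_vec_hom[OF w(1)]] free_mod_module]) simp
    then show "z \<in> carrier H"
      using dual_vec_hom[OF w(1)]
      by (simp add: w(2) H_def pair_vec_def arrow_Hom_carrier id_arrow_def) (simp add: dual_vec_def)
  next
    fix z assume z: "z \<in> carrier H"
    obtain g h where gh: "z = (g, h)" by (cases z)
    note c = z[unfolded gh H_def arrow_Hom_carrier, unfolded id_arrow_def, simplified]
    obtain w where w: "w \<in> carrier (free_mod R b)" "h = dual_vec R b w"
      using dual_vec_surj[of h b] c by blast
    have "g = restrict h (carrier (free_mod R a))"
      using c by (auto simp: fun_eq_iff extensional_def)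
    then show "z \<in> pair_vec R a b ` carrier (free_mod R b)"
      using w gh by (auto simp: pair_vec_def)
  qed
  show "module R H" "pair_vec R a b \<in> mod_hom R (free_mod R b) H"
    using pair_vec_image[OF ab disjI2[OF refl] order_refl im[unfolded H_def]] unfolding H_def by blast+
qed

text \<open>A morphism to the map from zero to \<open>R\<close> is a functional on
  \<open>F b\<close> that vanishes on \<open>F a\<close>, and by the reversed pairing these form
  \<open>F (b - a)\<close>. Together with \<open>arrow_star_cod\<close>, the dual of the inclusion
  of \<open>F a\<close> in \<open>F b\<close> becomes the inclusion of \<open>F (b - a)\<close> in
  \<open>F b\<close>.\<close>

lemma arrow_star_dom:
  assumes ab: "a \<le> b"
  defines "H \<equiv> arrow_Hom R (incl_arrow R a b) (zero_arrow (self_module R))"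
  shows "module R H" "pair_vec R a b \<in> mod_hom R (free_mod R (b - a)) H"
    "pair_vec R a b ` carrier (free_mod R (b - a)) = carrier H"
proof -
  show im: "pair_vec R a b ` carrier (free_mod R (b - a)) = carrier H"
  proof (intro equalityI subsetI)
    fix z assume "z \<in> pair_vec R a b ` carrier (free_mod R (b - a))"
    then obtain w where w: "w \<in> annihilator R b (carrier (free_mod R a))" "z = pair_vec R a b w"
      unfolding free_mod_annihilator[OF ab] by blast
    then have wb: "w \<in> carrier (free_mod R b)" by (simp add: annihilator_def)
    have d0: "dual_vec R b w v = \<zero>" if "v \<in> carrier (free_mod R a)" for v
      using w(1) that free_mod_mono[OF ab that] by (auto simp: annihilator_def dual_vec_def)
    have "restrict (dual_vec R b w) (carrier (free_mod R a))
        \<in> mod_hom R (free_mod R a) (zero_submodule (self_module R))"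
    proof (rule mod_homI)
      interpret F: module R "free_mod R a" by (rule free_mod_module)
      show "restrict (dual_vec R b w) (carrier (free_mod R a)) (x \<oplus>\<^bsub>free_mod R a\<^esub> y) =
         restrict (dual_vec R b w) (carrier (free_mod R a)) x \<oplus>\<^bsub>zero_submodule (self_module R)\<^esub>
         restrict (dual_vec R b w) (carrier (free_mod R a)) y"
        if "x \<in> carrier (free_mod R a)" "y \<in> carrier (free_mod R a)" for x y
        using that F.M.add.m_closed[OF that] by (simp add: d0 zero_submodule_def del: free_mod_simps)
      show "restrict (dual_vec R b w) (carrier (free_mod R a)) (r \<odot>\<^bsub>free_mod R a\<^esub> x) =
         r \<odot>\<^bsub>zero_submodule (self_module R)\<^esub> restrict (dual_vec R b w) (carrier (free_mod R a)) x"
        if "r \<in> carrier R" "x \<in> carrier (free_mod R a)" for x r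
        using that F.smult_closed[OF that] by (simp add: d0 zero_submodule_def del: free_mod_simps)
    qed (simp add: d0 zero_submodule_def)
    then show "z \<in> carrier H"
      using dual_vec_hom[OF wb]
      by (simp add: w(2) H_def pair_vec_def arrow_Hom_carrier zero_arrow_def) (simp add: dual_vec_def)
  next
    fix z assume z: "z \<in> carrier H"
    obtain g h where gh: "z = (g, h)" by (cases z)
    note c = z[unfolded gh H_def arrow_Hom_carrier, unfolded zero_arrow_def, simplified]
    obtain w where w: "w \<in> carrier (free_mod R b)" "h = dual_vec R b w"
      using dual_vec_surj[of h b] c by blast
    have "g = restrict h (carrier (free_mod R a))"
      using c by (auto simp: fun_eq_iff extensional_def)
    moreover have "w \<in> annihilator R b (carrier (free_mod R a))"
    proof -
      have "pairing R b v w = \<zero>" if v: "v \<in> carrier (free_mod R a)" for v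
      proof -
        have "g v = \<zero>" using c mod_hom_closed[of g R _ _ v] v by (force simp: zero_submodule_def)
        then have "h v = \<zero>" using c v by metis
        then show ?thesis using w(2) free_mod_mono[OF ab v] by (simp add: dual_vec_def)
      qed
      then show ?thesis using w(1) by (simp add: annihilator_def)
    qed
    ultimately show "z \<in> pair_vec R a b ` carrier (free_mod R (b - a))"
      using w gh unfolding free_mod_annihilator[OF ab] by (auto simp: pair_vec_def)
  qed
  show "module R H" "pair_vec R a b \<in> mod_hom R (free_mod R (b - a)) H"
    using pair_vec_image[OF ab disjI1[OF refl] diff_le_self im[unfolded H_def]] unfolding H_def by blast+
qed

text \<open>Precomposition with \<open>d\<close> in both components becomes the adjoint of
  \<open>d\<close>. For the first component this uses that \<open>d\<close> maps \<open>F k\<close>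
  into \<open>F a\<close>, where the restricted functional is defined by its values.\<close>

lemma pair_vec_adjoint:
  assumes d: "d \<in> mod_hom R (free_mod R l) (free_mod R b)"
    and da: "d ` carrier (free_mod R k) \<subseteq> carrier (free_mod R a)"
    and kl: "k \<le> l" and w: "w \<in> carrier (free_mod R b)"
  shows "map_prod (dual_map (free_mod R k) d) (dual_map (free_mod R l) d) (pair_vec R a b w)
    = pair_vec R k l (adjoint R l b d w)"
proof -
  have "dual_map (free_mod R k) d (restrict (dual_vec R b w) (carrier (free_mod R a))) v
      = restrict (dual_vec R l (adjoint R l b d w)) (carrier (free_mod R k)) v" for v
  proof (cases "v \<in> carrier (free_mod R k)")
    case True
    then have vl: "v \<in> carrier (free_mod R l)" by (rule free_mod_mono[OF kl])
    have "d v \<in> carrier (free_mod R a)" using True da by blast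
    then show ?thesis
      using True vl mod_hom_closed[OF d vl] pairing_adjoint[OF d w vl]
      by (simp add: dual_map_def compose_def dual_vec_def)
  qed (simp add: dual_map_def compose_def)
  then show ?thesis by (simp add: pair_vec_def dual_vec_adjoint[OF d w] fun_eq_iff)
qed

end

section \<open>Minimal covers and copies in the category of homomorphisms\<close>

context noetherian_local_ring
begin

lemma projective_cover_incl_arrow:
  assumes ab: "a \<le> b" and cov: "arrow_cover R a b p q G"
    and kp: "\<And>k i. k \<in> carrier (free_mod R a) \<Longrightarrow> p k = \<zero>\<^bsub>Dom G\<^esub> \<Longrightarrow> k i \<in> \<mm>"
    and kq: "\<And>k i. k \<in> carrier (free_mod R b) \<Longrightarrow> q k = \<zero>\<^bsub>Cod G\<^esub> \<Longrightarrow> a \<le> i \<Longrightarrow> k i \<in> \<mm>"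
  shows "projective_cover_arrow R (incl_arrow R a b) (p, q) G"
proof -
  let ?Fa = "free_mod R a" and ?Fb = "free_mod R b"
  have "superfluous_arrow R (incl_arrow R a b) (a_kernel ?Fa (Dom G) p) (a_kernel ?Fb (Cod G) q)"
    unfolding superfluous_arrow_def subarrow_def incl_arrow_simps
  proof (intro allI impI, elim conjE)
    fix M N assume M: "submodule M R ?Fa" and N: "submodule N R ?Fb" and MN: "(\<lambda>x. x) ` M \<subseteq> N"
      and Me: "M <+>\<^bsub>?Fa\<^esub> a_kernel ?Fa (Dom G) p = carrier ?Fa"
      and Ne: "N <+>\<^bsub>?Fb\<^esub> a_kernel ?Fb (Cod G) q = carrier ?Fb"
    note Nd = submoduleD[OF free_mod_module N]
    have "superfluous R ?Fa (a_kernel ?Fa (Dom G) p)"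
      by (rule superfluous_free_mod) (auto simp: a_kernel_def' intro: kp)
    then have Ma: "M = carrier ?Fa" using M Me unfolding superfluous_def by blast
    have "N = carrier ?Fb"
    proof (rule nakayama_free_mod[OF N])
      fix v assume "v \<in> carrier ?Fb"
      then have "v \<in> N <+>\<^bsub>?Fb\<^esub> a_kernel ?Fb (Cod G) q" by (simp add: Ne)
      then obtain x k where x: "x \<in> N" and k: "k \<in> carrier ?Fb" "q k = \<zero>\<^bsub>Cod G\<^esub>"
        and v: "v = (\<lambda>i. x i \<oplus> k i)"
        by (auto simp: set_add_iff a_kernel_def')
      have kc: "k i \<in> carrier R" "x i \<in> carrier R" for i
        using k(1) Nd(1)[OF x] by (auto simp: free_mod_carrier)
      \<comment> \<open>The part of \<open>k\<close> inside \<open>F a\<close> moves to the element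
        of \<open>N\<close>; the rest \<open>l\<close> has all its coordinates in
        \<open>\<mm>\<close>.\<close>
      define y where "y = (\<lambda>i. x i \<oplus> truncate R a k i)"
      define l where "l = (\<lambda>i. if i < a then \<zero> else k i)"
      have "truncate R a k \<in> N" using truncate_carrier(1)[OF k(1)] MN Ma by auto
      then have "y \<in> N" using Nd(3)[OF x] by (simp add: y_def)
      moreover have "l \<in> carrier ?Fb" using k(1) by (auto simp: l_def free_mod_carrier)
      moreover have "\<forall>i. l i \<in> \<mm>" using kq[OF k] by (auto simp: l_def)
      moreover have "v = (\<lambda>i. y i \<oplus> l i)"
        using kc by (auto simp: v y_def l_def truncate_def fun_eq_iff)
      ultimately show "\<exists>x\<in>N. \<exists>k\<in>carrier ?Fb. (\<forall>i. k i \<in> \<mm>) \<and> v = (\<lambda>i. x i \<oplus> k i)" by blast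
    qed
    with Ma show "M = carrier ?Fa \<and> N = carrier ?Fb" by blast
  qed
  then show ?thesis
    unfolding projective_cover_arrow_def
    using projective_incl_arrow[OF ab] cov by (simp add: arrow_cover_def)
qed

text \<open>Source and target are copied separately; the map between the copies is then induced by
  factoring through \<open>p'\<close>, and the kernels of the covers stay the same.\<close>

lemma exists_arrow_copy:
  assumes ab: "a \<le> b" and cov: "arrow_cover R a b p q G"
  obtains T :: "'a uarrow" and p' q' where "arrow_cover R a b p' q' T" "arrow_iso R T G"
    "\<And>v. v \<in> carrier (free_mod R a) \<Longrightarrow> p' v = \<zero>\<^bsub>Dom T\<^esub> \<longleftrightarrow> p v = \<zero>\<^bsub>Dom G\<^esub>"
    "\<And>v. v \<in> carrier (free_mod R b) \<Longrightarrow> q' v = \<zero>\<^bsub>Cod T\<^esub> \<longleftrightarrow> q v = \<zero>\<^bsub>Cod G\<^esub>"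
proof -
  let ?Fa = "free_mod R a" and ?Fb = "free_mod R b"
  note c = arrow_coverD[OF cov]
  obtain T0 :: "('a, nat \<Rightarrow> 'a) module" and p' g where T0: "module R T0" "p' \<in> mod_hom R ?Fa T0"
    "p' ` carrier ?Fa = carrier T0" "g \<in> mod_hom R T0 (Dom G)" "bij_betw g (carrier T0) (carrier (Dom G))"
    "\<And>v. v \<in> carrier ?Fa \<Longrightarrow> g (p' v) = p v"
    using exists_copy[OF free_mod_module c(1,4,6)] by metis
  obtain T1 :: "('a, nat \<Rightarrow> 'a) module" and q' h where T1: "module R T1" "q' \<in> mod_hom R ?Fb T1"
    "q' ` carrier ?Fb = carrier T1" "h \<in> mod_hom R T1 (Cod G)" "bij_betw h (carrier T1) (carrier (Cod G))"
    "\<And>v. v \<in> carrier ?Fb \<Longrightarrow> h (q' v) = q v"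
    using exists_copy[OF free_mod_module c(2,5,7)] by metis
  have zero_iff: "x = \<zero>\<^bsub>M\<^esub> \<longleftrightarrow> k x = \<zero>\<^bsub>N\<^esub>"
    if "module R M" "module R N" "k \<in> mod_hom R M N" "bij_betw k (carrier M) (carrier N)" "x \<in> carrier M"
    for M :: "('a, 'x) module" and N :: "('a, 'y) module" and k x
    using that(4,5) submodule_zero[OF that(1) submodule_carrier[OF that(1)]] mod_hom_zero[OF that(1-3)]
    by (metis bij_betw_inv_into_left)
  have kp: "p' v = \<zero>\<^bsub>T0\<^esub> \<longleftrightarrow> p v = \<zero>\<^bsub>Dom G\<^esub>" if "v \<in> carrier ?Fa" for v
    using zero_iff[OF T0(1) c(1) T0(4,5) mod_hom_closed[OF T0(2) that]] T0(6)[OF that] by simp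
  have kq: "q' v = \<zero>\<^bsub>T1\<^esub> \<longleftrightarrow> q v = \<zero>\<^bsub>Cod G\<^esub>" if "v \<in> carrier ?Fb" for v
    using zero_iff[OF T1(1) c(2) T1(4,5) mod_hom_closed[OF T1(2) that]] T1(6)[OF that] by simp
  \<comment> \<open>The kernel containment that allows \<open>q'\<close>, restricted to
    \<open>F a\<close>, to be factored through \<open>p'\<close>.\<close>
  have "q' v = \<zero>\<^bsub>T1\<^esub>" if "v \<in> carrier ?Fa" "p' v = \<zero>\<^bsub>T0\<^esub>" for v
  proof -
    have "q v = Arr G \<zero>\<^bsub>Dom G\<^esub>" using c(8)[OF that(1)] kp that by simp
    then show ?thesis
      using kq[OF free_mod_mono[OF ab that(1)]] mod_hom_zero[OF c(1-3)] by simp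
  qed
  then obtain t where t: "t \<in> mod_hom R T0 T1" "\<And>v. v \<in> carrier ?Fa \<Longrightarrow> t (p' v) = q' v"
    using mod_hom_factor[OF free_mod_module T0(1) T1(1) T0(2) mod_hom_free_mod_mono[OF ab T1(2)] T0(3)]
    by metis
  define T :: "'a uarrow" where "T = \<lparr>Dom = T0, Cod = T1, Arr = t\<rparr>"
  have covT: "arrow_cover R a b p' q' T"
    by (rule arrow_coverI) (use T0 T1 t in \<open>auto simp: T_def\<close>)
  have "Arr G (g x) = h (t x)" if "x \<in> carrier T0" for x
  proof -
    obtain v where v: "v \<in> carrier ?Fa" "x = p' v" using T0(3) \<open>x \<in> carrier T0\<close> by blast
    then show ?thesis using T0(6) c(8) t(2) T1(6) free_mod_mono[OF ab v(1)] by simp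
  qed
  then have "(g, h) \<in> arrow_hom R T G" using T0(4) T1(4) by (simp add: arrow_hom_def T_def)
  then have "arrow_iso R T G"
    unfolding arrow_iso_def using covT cov T0(5) T1(5)
    by (intro conjI bexI[of _ "(g, h)"]) (auto simp: T_def arrow_cover_def)
  then show thesis using that[OF covT] kp kq by (simp add: T_def)
qed

end

section \<open>The transpose in the category of homomorphisms\<close>

context cring
begin

text \<open>Since \<open>d\<close> maps \<open>F k\<close> into \<open>F a\<close>, the adjoint
  takes functionals vanishing on \<open>F a\<close> to functionals vanishing on \<open>F k\<close>,
  i.e. \<open>F (b - a)\<close> into \<open>F (l - k)\<close>.\<close>

lemma adjoint_hom_restrict:
  assumes ab: "a \<le> b" and kl: "k \<le> l"
    and d: "d \<in> mod_hom R (free_mod R l) (free_mod R b)"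
    and da: "d ` carrier (free_mod R k) \<subseteq> carrier (free_mod R a)"
  shows "adjoint R l b d \<in> mod_hom R (free_mod R (b - a)) (free_mod R (l - k))"
proof -
  note adj = adjoint_hom[OF d]
  have closed: "adjoint R l b d w \<in> carrier (free_mod R (l - k))" if w: "w \<in> carrier (free_mod R (b - a))" for w
  proof -
    have wb: "w \<in> carrier (free_mod R b)" using w by (rule free_mod_mono[OF diff_le_self])
    have wa: "w \<in> annihilator R b (carrier (free_mod R a))" using w free_mod_annihilator[OF ab] by simp
    have "pairing R l v (adjoint R l b d w) = \<zero>" if "v \<in> carrier (free_mod R k)" for v
    proof -
      have "d v \<in> carrier (free_mod R a)" using da that by blast
      then show ?thesis
        using wa pairing_adjoint[OF d wb free_mod_mono[OF kl that]] by (simp add: annihilator_def)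
    qed
    then have "adjoint R l b d w \<in> annihilator R l (carrier (free_mod R k))"
      using mod_hom_closed[OF adj wb] by (simp add: annihilator_def)
    then show ?thesis using free_mod_annihilator[OF kl] by simp
  qed
  note D = mod_homD[OF mod_hom_free_mod_mono[OF diff_le_self adj, of a]]
  show ?thesis by (rule mod_homI) (use closed D(2,3) in simp_all)
qed

text \<open>The cokernel is formed componentwise. Through \<open>pair_vec\<close> its components are
  quotients of \<open>F (l - k)\<close> and \<open>F l\<close> by the images of
  \<open>F (b - a)\<close> and \<open>F b\<close> under one and the same adjoint map, so the
  inclusion of \<open>F (l - k)\<close> in \<open>F l\<close> covers it.\<close>

lemma arrow_cok_star_cover:
  assumes ab: "a \<le> b" and kl: "k \<le> l"
    and d: "d \<in> mod_hom R (free_mod R l) (free_mod R b)"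
    and da: "d ` carrier (free_mod R k) \<subseteq> carrier (free_mod R a)"
  defines "X \<equiv> arrow_cok (arrow_star R (incl_arrow R a b)) (arrow_star R (incl_arrow R k l))
      (arrow_star_map (incl_arrow R k l) (d, d))"
    and "adj \<equiv> adjoint R l b d"
  obtains p q where "arrow_cover R (l - k) l p q X"
    "\<And>v. v \<in> carrier (free_mod R (l - k)) \<Longrightarrow>
      p v = \<zero>\<^bsub>Dom X\<^esub> \<longleftrightarrow> v \<in> adj ` carrier (free_mod R (b - a))"
    "\<And>v. v \<in> carrier (free_mod R l) \<Longrightarrow> q v = \<zero>\<^bsub>Cod X\<^esub> \<longleftrightarrow> v \<in> adj ` carrier (free_mod R b)"
proof -
  define pre where "pre = map_prod (dual_map (free_mod R k) d) (dual_map (free_mod R l) d)"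
  define C0 where "C0 = arrow_Hom R (incl_arrow R a b) (zero_arrow (self_module R))"
  define C1 where "C1 = arrow_Hom R (incl_arrow R a b) (id_arrow (self_module R))"
  define D0 where "D0 = arrow_Hom R (incl_arrow R k l) (zero_arrow (self_module R))"
  define D1 where "D1 = arrow_Hom R (incl_arrow R k l) (id_arrow (self_module R))"
  note C0 = arrow_star_dom[OF ab, folded C0_def] note C1 = arrow_star_cod[OF ab, folded C1_def]
  note D0 = arrow_star_dom[OF kl, folded D0_def] note D1 = arrow_star_cod[OF kl, folded D1_def]
  let ?\<theta> = "pair_vec R k l"
  let ?c = "free_mod R (b - a)" and ?m = "free_mod R (l - k)"
  have X: "Dom X = mod_cok C0 D0 pre" "Cod X = mod_cok C1 D1 pre"
    "Arr X = (\<lambda>Y. \<Union>x\<in>Y. pre ` carrier C1 +>\<^bsub>D1\<^esub> x)"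
    by (simp_all add: X_def arrow_cok_def arrow_star_def arrow_star_map_def pre_def Let_def
        C0_def C1_def D0_def D1_def)
  note adj = adjoint_hom[OF d, folded adj_def]
  have cb: "w \<in> carrier (free_mod R b)" if "w \<in> carrier ?c" for w
    using free_mod_mono[OF diff_le_self that] .
  have ml: "v \<in> carrier (free_mod R l)" if "v \<in> carrier ?m" for v
    using free_mod_mono[OF diff_le_self that] .
  have pre: "pre (pair_vec R a b w) = ?\<theta> (adj w)" if "w \<in> carrier (free_mod R b)" for w
    unfolding pre_def adj_def by (rule pair_vec_adjoint[OF d da kl that])
  have im1: "pre ` carrier C1 = ?\<theta> ` (adj ` carrier (free_mod R b))"
    unfolding C1(3)[symmetric] image_image by (intro image_cong refl) (rule pre)
  have im0: "pre ` carrier C0 = ?\<theta> ` (adj ` carrier ?c)"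
    unfolding C0(3)[symmetric] image_image by (intro image_cong refl) (rule pre[OF cb])
  have H1: "submodule (adj ` carrier (free_mod R b)) R (free_mod R l)"
    by (rule submodule_image[OF free_mod_module free_mod_module adj submodule_carrier[OF free_mod_module]])
  note adj0 = adjoint_hom_restrict[OF ab kl d da, folded adj_def]
  have H0: "submodule (adj ` carrier ?c) R ?m"
    by (rule submodule_image[OF free_mod_module free_mod_module adj0 submodule_carrier[OF free_mod_module]])
  have inj0: "inj_on ?\<theta> (carrier ?m)" using pair_vec_inj by (rule inj_on_subset) (auto intro: ml)
  let ?p = "\<lambda>v. pre ` carrier C0 +>\<^bsub>D0\<^esub> ?\<theta> v" and ?q = "\<lambda>v. pre ` carrier C1 +>\<^bsub>D1\<^esub> ?\<theta> v"
  note Q0 = cokernel_presentation[OF free_mod_module D0 inj0 H0 im0]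
  note Q1 = cokernel_presentation[OF free_mod_module D1 pair_vec_inj H1 im1]
  have K1: "submodule (pre ` carrier C1) R D1"
    unfolding im1 by (rule submodule_image[OF free_mod_module D1(1,2) H1])
  \<comment> \<open>The structure map of a cokernel is defined as a union over the elements of a
    coset. The union collapses because the submodule divided out in the source is contained in the
    one divided out in the target.\<close>
  have Arr: "Arr X (?p v) = ?q v" if v: "v \<in> carrier ?m" for v
  proof -
    interpret D1: module R D1 by (rule D1(1))
    have coset: "pre ` carrier C1 +>\<^bsub>D1\<^esub> x = ?q v" if x: "x \<in> ?p v" for x
    proof -
      obtain y where y: "y \<in> pre ` carrier C0" "x = y \<oplus>\<^bsub>D0\<^esub> ?\<theta> v"
        using x unfolding a_r_coset_def' by blast
      have "y \<oplus>\<^bsub>D0\<^esub> ?\<theta> v = y \<oplus>\<^bsub>D1\<^esub> ?\<theta> v"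
        by (simp add: D0_def D1_def arrow_Hom_ops)
      then have xD: "x = y \<oplus>\<^bsub>D1\<^esub> ?\<theta> v" using y(2) by simp
      have "y \<in> pre ` carrier C1" using y(1) cb unfolding im0 im1 by blast
      moreover have t: "?\<theta> v \<in> carrier D1" by (rule mod_hom_closed[OF D1(2) ml[OF v]])
      ultimately have yD: "y \<in> carrier D1" "y \<in> pre ` carrier C1" using submodule_sub[OF D1(1) K1] by auto
      have "y = x \<ominus>\<^bsub>D1\<^esub> ?\<theta> v"
        using yD(1) t by (intro D1.M.eq_minus_if_sum_eq) (auto simp: xD D1.M.a_comm)
      then show ?thesis using coset_eq_iff[OF D1(1) K1 _ t, of x] yD t xD by simp
    qed
    have "?\<theta> v \<in> ?p v"
      using submodule_zero[OF D0(1) submodule_image[OF free_mod_module D0(1,2) H0]]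
        mod_hom_closed[OF D0(2) v] abelian_subgroup.a_rcos_self[OF submodule_abelian_subgroup[OF D0(1)]]
        submodule_image[OF free_mod_module D0(1,2) H0] im0 by metis
    then have "?p v \<noteq> {}" by blast
    then show ?thesis using coset by (simp add: X(3) SUP_eq_const)
  qed
  have "pre ` carrier C1 +>\<^bsub>D1\<^esub> ?\<theta> v = \<zero>\<^bsub>Cod X\<^esub>"
    if v: "v \<in> carrier ?m" "?p v = \<zero>\<^bsub>Dom X\<^esub>" for v
    using Q0(4)[OF v(1)] Q1(4)[OF ml[OF v(1)]] v(2) cb by (auto simp: X(1,2))
  then obtain h where h: "h \<in> mod_hom R (Dom X) (Cod X)" "\<And>v. v \<in> carrier ?m \<Longrightarrow> h (?p v) = ?q v"
    using mod_hom_factor[OF free_mod_module Q0(1) Q1(1) Q0(2) mod_hom_free_mod_mono[OF diff_le_self Q1(2)] Q0(3)]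
    unfolding X(1,2) by metis
  \<comment> \<open>Linearity of the structure map is inherited from the induced map
    \<open>h\<close>, with which it agrees on the carrier.\<close>
  have "h x = Arr X x" if x: "x \<in> carrier (Dom X)" for x
  proof -
    have "x \<in> ?p ` carrier ?m" using x by (simp only: X(1) Q0(3))
    then obtain v where "v \<in> carrier ?m" "x = ?p v" by blast
    then show ?thesis using h(2) Arr by simp
  qed
  then have AX: "Arr X \<in> mod_hom R (Dom X) (Cod X)"
    using Q0(1) by (intro mod_hom_cong[OF h(1)]) (simp_all add: X(1))
  show thesis
  proof (rule that)
    show "arrow_cover R (l - k) l ?p ?q X"
      by (rule arrow_coverI[OF _ _ AX]) (use Q0(1-3) Q1(1-3) Arr in \<open>simp_all add: X(1,2)\<close>)
    show "?p v = \<zero>\<^bsub>Dom X\<^esub> \<longleftrightarrow> v \<in> adj ` carrier ?c" if "v \<in> carrier ?m" for v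
      using Q0(4)[OF that] by (simp add: X(1))
    show "?q v = \<zero>\<^bsub>Cod X\<^esub> \<longleftrightarrow> v \<in> adj ` carrier (free_mod R b)" if "v \<in> carrier (free_mod R l)" for v
      using Q1(4)[OF that] by (simp add: X(2))
  qed
qed

end

section \<open>The operation lambda on monomorphisms, and linkage\<close>

context noetherian_local_ring
begin

text \<open>The hypothesis on \<open>p\<close> and \<open>q\<close> says that \<open>G\<close> is a
  monomorphism, so that \<open>K\<close> determines both kernels. The smallness conditions on
  \<open>K\<close> are those for a minimal cover of \<open>G\<close>, and they return, with
  exchanged roles, as the conditions for the cover of the transpose. The conclusion has the form of
  the hypotheses, with \<open>a\<close> replaced by \<open>b - a\<close> and \<open>K\<close> by its
  annihilator; smallness of the annihilator remains to be supplied before the lemma is applied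
  again.\<close>

lemma exists_lambda_arrow:
  assumes ab: "a \<le> b" and cov: "arrow_cover R a b p q G"
    and K: "K = {v \<in> carrier (free_mod R b). q v = \<zero>\<^bsub>Cod G\<^esub>}"
    and pK: "\<And>v. v \<in> carrier (free_mod R a) \<Longrightarrow> q v = \<zero>\<^bsub>Cod G\<^esub> \<Longrightarrow> p v = \<zero>\<^bsub>Dom G\<^esub>"
    and small: "\<And>k i. k \<in> K \<Longrightarrow> a \<le> i \<Longrightarrow> k i \<in> \<mm>"
      "\<And>k i. k \<in> K \<Longrightarrow> k \<in> carrier (free_mod R a) \<Longrightarrow> k i \<in> \<mm>"
  obtains L :: "'a uarrow" and p' q' where "is_lambda_arrow R G L" "arrow_cover R (b - a) b p' q' L"
    "annihilator R b K = {v \<in> carrier (free_mod R b). q' v = \<zero>\<^bsub>Cod L\<^esub>}"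
    "\<And>v. v \<in> carrier (free_mod R (b - a)) \<Longrightarrow> q' v = \<zero>\<^bsub>Cod L\<^esub> \<Longrightarrow> p' v = \<zero>\<^bsub>Dom L\<^esub>"
proof -
  let ?Fa = "free_mod R a" and ?Fb = "free_mod R b"
  note c = arrow_coverD[OF cov]
  have pq: "p v = \<zero>\<^bsub>Dom G\<^esub> \<longleftrightarrow> q v = \<zero>\<^bsub>Cod G\<^esub>" if "v \<in> carrier ?Fa" for v
    using pK[OF that] c(8)[OF that] mod_hom_zero[OF c(1-3)] by metis
  have Kb: "submodule K R ?Fb" unfolding K by (rule submodule_kernel[OF free_mod_module c(2,5)])
  define K0 where "K0 = K \<inter> carrier ?Fa"
  have K0b: "submodule K0 R ?Fb"
    unfolding K0_def by (rule submodule_Int[OF free_mod_module Kb submodule_free_mod[OF ab]])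
  have K0p: "{v \<in> carrier ?Fa. p v = \<zero>\<^bsub>Dom G\<^esub>} = K0"
    using pq free_mod_mono[OF ab] by (auto simp: K0_def K)
  have K0a: "submodule K0 R ?Fa"
    unfolding K0p[symmetric] by (rule submodule_kernel[OF free_mod_module c(1,4)])
  \<comment> \<open>A filtered cover of \<open>K0\<close> inside \<open>K\<close> presents both
    components of the kernel by a single map \<open>d\<close>.\<close>
  obtain k l d where kl: "k \<le> l" and d: "d \<in> mod_hom R (free_mod R l) ?Fb"
    "d ` carrier (free_mod R k) = K0" "d ` carrier (free_mod R l) = K"
    and kd: "\<And>v i. v \<in> carrier (free_mod R k) \<Longrightarrow> d v = \<zero>\<^bsub>?Fb\<^esub> \<Longrightarrow> v i \<in> \<mm>"
      "\<And>v i. v \<in> carrier (free_mod R l) \<Longrightarrow> d v \<in> K0 \<Longrightarrow> k \<le> i \<Longrightarrow> v i \<in> \<mm>"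
    using exists_filtered_cover[OF free_mod_module K0b Kb _ submodule_free_mod_fin_gen[OF K0b]
        submodule_free_mod_fin_gen[OF Kb]] unfolding K0_def by (metis Int_lower1)
  let ?Fk = "free_mod R k" and ?Fl = "free_mod R l"
  define KG :: "'a uarrow"
    where "KG = \<lparr>Dom = ?Fa\<lparr>carrier := K0\<rparr>, Cod = ?Fb\<lparr>carrier := K\<rparr>, Arr = (\<lambda>x. x)\<rparr>"
  have ker: "arrow_ker (incl_arrow R a b) G (p, q) = KG"
    unfolding arrow_ker_incl_arrow KG_def K0p K[symmetric] ..
  have "arrow_cover R k l d d KG"
  proof (rule arrow_coverI)
    show "module R (Dom KG)" "module R (Cod KG)"
      using submodule_module[OF free_mod_module K0a] submodule_module[OF free_mod_module Kb]
      by (simp_all add: KG_def)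
    show "Arr KG \<in> mod_hom R (Dom KG) (Cod KG)"
      by (rule mod_homI) (auto simp: KG_def K0_def)
    show "d \<in> mod_hom R ?Fk (Dom KG)"
      by (rule mod_homI) (use mod_homD[OF mod_hom_free_mod_mono[OF kl d(1)]] d(2) in \<open>auto simp: KG_def\<close>)
    show "d \<in> mod_hom R ?Fl (Cod KG)"
      by (rule mod_homI) (use mod_homD[OF d(1)] d(3) in \<open>auto simp: KG_def\<close>)
  qed (simp_all add: KG_def d)
  then have "projective_cover_arrow R (incl_arrow R k l) (d, d) KG"
  proof (rule projective_cover_incl_arrow[OF kl])
    show "v i \<in> \<mm>" if "v \<in> carrier ?Fk" "d v = \<zero>\<^bsub>Dom KG\<^esub>" for v i
      using kd(1) that by (simp add: KG_def)
    show "v i \<in> \<mm>" if "v \<in> carrier ?Fl" "d v = \<zero>\<^bsub>Cod KG\<^esub>" "k \<le> i" for v i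
      using kd(2) that submodule_zero[OF free_mod_module K0b] by (simp add: KG_def)
  qed
  moreover have "projective_cover_arrow R (incl_arrow R a b) (p, q) G"
  proof (rule projective_cover_incl_arrow[OF ab cov])
    show "v i \<in> \<mm>" if "v \<in> carrier ?Fa" "p v = \<zero>\<^bsub>Dom G\<^esub>" for v i
      using small(2) that pq free_mod_mono[OF ab that(1)] by (simp add: K)
    show "v i \<in> \<mm>" if "v \<in> carrier ?Fb" "q v = \<zero>\<^bsub>Cod G\<^esub>" "a \<le> i" for v i
      using small(1) that by (simp add: K)
  qed
  ultimately have pres: "min_proj_presentation_arrow R (incl_arrow R k l) (d, d) (incl_arrow R a b) (p, q) G"
    unfolding min_proj_presentation_arrow_def ker by blast
  let ?X = "arrow_cok (arrow_star R (incl_arrow R a b)) (arrow_star R (incl_arrow R k l))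
      (arrow_star_map (incl_arrow R k l) (d, d))"
  let ?adj = "adjoint R l b d"
  let ?c = "free_mod R (b - a)" and ?m = "free_mod R (l - k)"
  have da: "d ` carrier ?Fk \<subseteq> carrier ?Fa" by (auto simp: d(2) K0_def)
  obtain x y where X: "arrow_cover R (l - k) l x y ?X"
    "\<And>v. v \<in> carrier ?m \<Longrightarrow> x v = \<zero>\<^bsub>Dom ?X\<^esub> \<longleftrightarrow> v \<in> ?adj ` carrier ?c"
    "\<And>v. v \<in> carrier ?Fl \<Longrightarrow> y v = \<zero>\<^bsub>Cod ?X\<^esub> \<longleftrightarrow> v \<in> ?adj ` carrier ?Fb"
    by (rule arrow_cok_star_cover[OF ab kl d(1) da]) (rule that)
  obtain T :: "'a uarrow" and s t where T: "arrow_cover R (l - k) l s t T" "arrow_iso R T ?X"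
    and kx: "\<And>v. v \<in> carrier ?m \<Longrightarrow> s v = \<zero>\<^bsub>Dom T\<^esub> \<longleftrightarrow> x v = \<zero>\<^bsub>Dom ?X\<^esub>"
    and ky: "\<And>v. v \<in> carrier ?Fl \<Longrightarrow> t v = \<zero>\<^bsub>Cod T\<^esub> \<longleftrightarrow> y v = \<zero>\<^bsub>Cod ?X\<^esub>"
    by (rule exists_arrow_copy[OF diff_le_self X(1)]) (rule that)
  have tr: "is_transpose_arrow R G T"
    unfolding is_transpose_arrow_def using pres T(2) by blast
  note adj = adjoint_hom[OF d(1)]
  note adjc = adjoint_hom_restrict[OF ab kl d(1) da]
  have "projective_cover_arrow R (incl_arrow R (l - k) l) (s, t) T"
  proof (rule projective_cover_incl_arrow[OF diff_le_self T(1)])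
    fix v i assume v: "v \<in> carrier ?m" "s v = \<zero>\<^bsub>Dom T\<^esub>"
    then obtain w where w: "w \<in> carrier ?c" "v = ?adj w" using kx X(2) by blast
    show "v i \<in> \<mm>"
    proof (cases "i < l")
      case True
      \<comment> \<open>On this block \<open>w\<close> lies in \<open>F (b - a)\<close>, so it pairs
        only with the coordinates from \<open>a\<close> on of a column in \<open>K\<close>, which
        lie in \<open>\<mm>\<close> by the first smallness condition.\<close>
      then have dK: "d (unit_vec R (l - 1 - i)) \<in> K" using d(3) by auto
      have "pairing R b (d (unit_vec R (l - 1 - i))) w \<in> \<mm>"
      proof (rule pairing_in_max)
        show "d (unit_vec R (l - 1 - i)) \<in> carrier ?Fb" using dK by (simp add: K)
        show "w \<in> carrier ?Fb" using w(1) by (rule free_mod_mono[OF diff_le_self])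
        show "d (unit_vec R (l - 1 - i)) j \<in> \<mm> \<or> w (b - 1 - j) = \<zero>" if "j < b" for j
          using small(1)[OF dK, of j] w(1) that by (cases "a \<le> j") (auto simp: free_mod_carrier)
      qed
      then show ?thesis using True by (simp add: w(2) adjoint_def)
    qed (simp add: w(2) adjoint_def)
  next
    fix v i assume v: "v \<in> carrier ?Fl" "t v = \<zero>\<^bsub>Cod T\<^esub>" and i: "l - k \<le> i"
    then obtain w where w: "w \<in> carrier ?Fb" "v = ?adj w" using ky X(3) by blast
    show "v i \<in> \<mm>"
    proof (cases "i < l")
      case True
      \<comment> \<open>From \<open>l - k \<le> i\<close> the unit vector has index below
        \<open>k\<close>, so the column lies in \<open>K0\<close>; the second smallness condition
        puts all its coordinates in \<open>\<mm>\<close>, and \<open>w\<close> may be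
        arbitrary.\<close>
      then have "d (unit_vec R (l - 1 - i)) \<in> K0"
        unfolding d(2)[symmetric] using i by (intro imageI unit_vec_carrier) auto
      then have dK: "d (unit_vec R (l - 1 - i)) \<in> K" "d (unit_vec R (l - 1 - i)) \<in> carrier ?Fa"
        by (auto simp: K0_def)
      have "pairing R b (d (unit_vec R (l - 1 - i))) w \<in> \<mm>"
        using small(2)[OF dK] dK w(1) by (intro pairing_in_max) (auto simp: K)
      then show ?thesis using True by (simp add: w(2) adjoint_def)
    qed (simp add: w(2) adjoint_def)
  qed
  moreover define L :: "'a uarrow" where
    "L = \<lparr>Dom = ?m\<lparr>carrier := ?adj ` carrier ?c\<rparr>, Cod = ?Fl\<lparr>carrier := ?adj ` carrier ?Fb\<rparr>, Arr = (\<lambda>x. x)\<rparr>"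
  have Lker: "arrow_ker (incl_arrow R (l - k) l) T (s, t) = L"
  proof -
    have "{v \<in> carrier ?m. s v = \<zero>\<^bsub>Dom T\<^esub>} = ?adj ` carrier ?c"
      using kx X(2) mod_hom_closed[OF adjc] by auto
    moreover have "{v \<in> carrier ?Fl. t v = \<zero>\<^bsub>Cod T\<^esub>} = ?adj ` carrier ?Fb"
      using ky X(3) mod_hom_closed[OF adj] by auto
    ultimately show ?thesis by (simp add: arrow_ker_incl_arrow L_def)
  qed
  have cb: "w \<in> carrier ?Fb" if "w \<in> carrier ?c" for w using free_mod_mono[OF diff_le_self that] .
  have covL: "arrow_cover R (b - a) b ?adj ?adj L"
  proof (rule arrow_coverI)
    show "module R (Dom L)"
      unfolding L_def arrow.simps
      by (rule submodule_module[OF free_mod_module submodule_image[OF free_mod_module free_mod_module adjc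
          submodule_carrier[OF free_mod_module]]])
    show "module R (Cod L)"
      unfolding L_def arrow.simps
      by (rule submodule_module[OF free_mod_module submodule_image[OF free_mod_module free_mod_module adj
          submodule_carrier[OF free_mod_module]]])
    show "Arr L \<in> mod_hom R (Dom L) (Cod L)"
      by (rule mod_homI) (use cb in \<open>auto simp: L_def\<close>)
    show "?adj \<in> mod_hom R ?c (Dom L)"
      by (rule mod_homI) (use mod_homD[OF adjc] in \<open>auto simp: L_def\<close>)
    show "?adj \<in> mod_hom R ?Fb (Cod L)"
      by (rule mod_homI) (use mod_homD[OF adj] in \<open>auto simp: L_def\<close>)
  qed (simp_all add: L_def)
  ultimately have "is_syzygy_arrow R T L"
    unfolding is_syzygy_arrow_def using arrow_iso_refl[of R L] Lker by (metis arrow_cover_def)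
  then have "is_lambda_arrow R G L" unfolding is_lambda_arrow_def using tr by blast
  then show thesis
  proof (rule that[OF _ covL])
    show "annihilator R b K = {v \<in> carrier ?Fb. ?adj v = \<zero>\<^bsub>Cod L\<^esub>}"
      using adjoint_eq_zero_iff[OF d(1)] annihilator_sub[of b K] by (auto simp: d(3) L_def)
  qed (simp add: L_def)
qed

text \<open>A filtered cover for the image of \<open>A\<close> inside \<open>B\<close>; as the map
  is injective, its inverse on the image turns the first block into a cover of
  \<open>A\<close>.\<close>

lemma S_obj_cover:
  assumes S: "S_obj R F"
  obtains a b p q where "a \<le> b" "arrow_cover R a b p q F"
    "\<And>v. v \<in> carrier (free_mod R a) \<Longrightarrow> q v = \<zero>\<^bsub>Cod F\<^esub> \<Longrightarrow> p v = \<zero>\<^bsub>Dom F\<^esub>"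
    "\<And>k i. k \<in> carrier (free_mod R b) \<Longrightarrow> q k = \<zero>\<^bsub>Cod F\<^esub> \<Longrightarrow> a \<le> i \<Longrightarrow> k i \<in> \<mm>"
    "\<And>k i. k \<in> carrier (free_mod R a) \<Longrightarrow> q k = \<zero>\<^bsub>Cod F\<^esub> \<Longrightarrow> k i \<in> \<mm>"
proof -
  let ?A = "Dom F" and ?B = "Cod F" and ?f = "Arr F"
  have A: "module R ?A" "fin_gen R ?A (carrier ?A)" and B: "module R ?B" "fin_gen R ?B (carrier ?B)"
    and f: "?f \<in> mod_hom R ?A ?B" and inj: "inj_on ?f (carrier ?A)"
    using S by (auto simp: S_obj_def M_obj_def is_arrow_def fg_module_iff)
  let ?I = "?f ` carrier ?A"
  have I: "submodule ?I R ?B" by (rule submodule_image[OF A(1) B(1) f submodule_carrier[OF A(1)]])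
  \<comment> \<open>Any cover of \<open>A\<close> by a free module serves here: its composite with
    the map shows that the image is finitely generated inside \<open>B\<close>.\<close>
  obtain n r where r: "r \<in> mod_hom R (free_mod R n) ?A" "r ` carrier (free_mod R n) = carrier ?A"
    using exists_minimal_cover[OF A(1) submodule_carrier[OF A(1)] A(2)] by metis
  have fgI: "fin_gen R ?B ?I"
    using fin_gen_image[OF B(1) mod_hom_compose[OF r(1) f]] by (simp add: image_image flip: r(2))
  have IB: "?I \<subseteq> carrier ?B" using mod_hom_closed[OF f] by blast
  obtain a b q where ab: "a \<le> b" and q: "q \<in> mod_hom R (free_mod R b) ?B"
    "q ` carrier (free_mod R a) = ?I" "q ` carrier (free_mod R b) = carrier ?B"
    and kq: "\<And>k i. k \<in> carrier (free_mod R a) \<Longrightarrow> q k = \<zero>\<^bsub>?B\<^esub> \<Longrightarrow> k i \<in> \<mm>"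
      "\<And>k i. k \<in> carrier (free_mod R b) \<Longrightarrow> q k \<in> ?I \<Longrightarrow> a \<le> i \<Longrightarrow> k i \<in> \<mm>"
    by (rule exists_filtered_cover[OF B(1) I submodule_carrier[OF B(1)] IB fgI B(2)]) (rule that)
  have fI: "?f \<in> mod_hom R ?A (?B\<lparr>carrier := ?I\<rparr>)"
    by (rule mod_homI) (use mod_homD[OF f] in auto)
  have bij: "bij_betw ?f (carrier ?A) (carrier (?B\<lparr>carrier := ?I\<rparr>))"
    using inj by (simp add: bij_betw_def)
  define g where "g = inv_into (carrier ?A) ?f"
  have g: "g \<in> mod_hom R (?B\<lparr>carrier := ?I\<rparr>) ?A"
    unfolding g_def by (rule mod_hom_inv[OF A(1) fI bij])
  have gf: "g (?f x) = x" if "x \<in> carrier ?A" for x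
    unfolding g_def using inv_into_f_f[OF inj that] .
  have fg: "?f (g y) = y" if "y \<in> ?I" for y unfolding g_def using that by (rule f_inv_into_f)
  have qI: "q \<in> mod_hom R (free_mod R a) (?B\<lparr>carrier := ?I\<rparr>)"
    by (rule mod_homI) (use mod_homD[OF mod_hom_free_mod_mono[OF ab q(1)]] q(2) in auto)
  have p: "(\<lambda>v. g (q v)) \<in> mod_hom R (free_mod R a) ?A" by (rule mod_hom_compose[OF qI g])
  have p0: "g (q v) = \<zero>\<^bsub>?A\<^esub>" if "q v = \<zero>\<^bsub>?B\<^esub>" for v
    using gf[OF submodule_zero[OF A(1) submodule_carrier[OF A(1)]]] mod_hom_zero[OF A(1) B(1) f] that by simp
  have "arrow_cover R a b (\<lambda>v. g (q v)) q F"
  proof (rule arrow_coverI[OF A(1) B(1) f p q(1) _ q(3)])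
    show "(\<lambda>v. g (q v)) ` carrier (free_mod R a) = carrier ?A"
    proof -
      have "(\<lambda>v. g (q v)) ` carrier (free_mod R a) = g ` ?I"
        unfolding q(2)[symmetric] by (simp add: image_image)
      also have "\<dots> = carrier ?A" using gf by force
      finally show ?thesis .
    qed
    show "?f (g (q v)) = q v" if "v \<in> carrier (free_mod R a)" for v
      by (rule fg) (use that q(2) in blast)
  qed
  then show thesis
  proof (rule that[OF ab])
    show "k i \<in> \<mm>" if "k \<in> carrier (free_mod R b)" "q k = \<zero>\<^bsub>?B\<^esub>" "a \<le> i" for k i
      using kq(2)[OF that(1) _ that(3)] that(2) submodule_zero[OF B(1) I] by simp
    show "k i \<in> \<mm>" if "k \<in> carrier (free_mod R a)" "q k = \<zero>\<^bsub>?B\<^esub>" for k i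
      using kq(1) that .
  qed (rule p0)
qed

theorem horizontally_linked_arrow_iff_torsionless:
  assumes S: "S_obj R F" and st: "stable_module R (Cod F)"
  shows "horizontally_linked_arrow R F \<longleftrightarrow> torsionless R (Cod F)"
proof
  assume "horizontally_linked_arrow R F"
  then obtain L N :: "'a uarrow" where LN: "is_lambda_arrow R L N" "arrow_iso R F N"
    unfolding horizontally_linked_arrow_def by blast
  then obtain T P :: "'a uarrow" and \<pi> where P: "projective_cover_arrow R P \<pi> T"
    and N: "arrow_iso R N (arrow_ker P T \<pi>)"
    unfolding is_lambda_arrow_def is_syzygy_arrow_def by blast
  obtain U V :: "('a, nat \<Rightarrow> 'a) module" where UV: "projective_module R U" "projective_module R V"
    "arrow_iso R P (arrow_dsum (id_arrow U) (zero_arrow V))"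
    using P unfolding projective_cover_arrow_def projective_arrow_def by blast
  \<comment> \<open>Only the target matters for torsionlessness: for a projective object it is a
    direct sum of two projective modules.\<close>
  have D: "Cod (arrow_dsum (id_arrow U) (zero_arrow V)) = mod_dsum U V"
    by (simp add: arrow_dsum_def id_arrow_def zero_arrow_def)
  have step: "torsionless R (Cod G)" if iso: "arrow_iso R G H" and tH: "torsionless R (Cod H)"
    for G :: "('a, 'x, 'y) arrow" and H :: "('a, 'u, 'v) arrow"
  proof -
    obtain h where "h \<in> mod_hom R (Cod G) (Cod H)" "bij_betw h (carrier (Cod G)) (carrier (Cod H))"
      using iso by (auto simp: arrow_iso_def arrow_hom_def)
    moreover have "module R (Cod G)" "module R (Cod H)" using iso by (auto simp: arrow_iso_def is_arrow_def)
    ultimately show ?thesis using torsionless_inj[OF _ _ _ _ tH] bij_betw_imp_inj_on by blast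
  qed
  have "torsionless R (mod_dsum U V)"
    using UV(1,2) by (intro torsionless_mod_dsum projective_torsionless)
  then have tP: "torsionless R (Cod P)" by (intro step[OF UV(3)]) (simp add: D)
  have ck: "Cod (arrow_ker P T \<pi>) = mod_ker (Cod P) (Cod T) (snd \<pi>)"
    by (simp add: arrow_ker_def split_beta)
  have "(\<lambda>x. x) \<in> mod_hom R (Cod (arrow_ker P T \<pi>)) (Cod P)"
    by (rule mod_homI) (auto simp: ck mod_ker_eq)
  moreover have "module R (Cod (arrow_ker P T \<pi>))" using N by (auto simp: arrow_iso_def is_arrow_def)
  moreover have "module R (Cod P)" using UV(3) by (auto simp: arrow_iso_def is_arrow_def)
  ultimately have "torsionless R (Cod (arrow_ker P T \<pi>))"
    by (intro torsionless_inj[OF _ _ _ _ tP]) auto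
  then show "torsionless R (Cod F)" by (intro step[OF LN(2)] step[OF N])
next
  assume tl: "torsionless R (Cod F)"
  obtain a b p q where ab: "a \<le> b" and cov: "arrow_cover R a b p q F"
    and pq: "\<And>v. v \<in> carrier (free_mod R a) \<Longrightarrow> q v = \<zero>\<^bsub>Cod F\<^esub> \<Longrightarrow> p v = \<zero>\<^bsub>Dom F\<^esub>"
    and kq: "\<And>k i. k \<in> carrier (free_mod R b) \<Longrightarrow> q k = \<zero>\<^bsub>Cod F\<^esub> \<Longrightarrow> a \<le> i \<Longrightarrow> k i \<in> \<mm>"
      "\<And>k i. k \<in> carrier (free_mod R a) \<Longrightarrow> q k = \<zero>\<^bsub>Cod F\<^esub> \<Longrightarrow> k i \<in> \<mm>"
    by (rule S_obj_cover[OF S]) (rule that)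
  note c = arrow_coverD[OF cov]
  define K where "K = {v \<in> carrier (free_mod R b). q v = \<zero>\<^bsub>Cod F\<^esub>}"
  obtain L :: "'a uarrow" and p1 q1 where L: "is_lambda_arrow R F L" "arrow_cover R (b - a) b p1 q1 L"
    "annihilator R b K = {v \<in> carrier (free_mod R b). q1 v = \<zero>\<^bsub>Cod L\<^esub>}"
    "\<And>v. v \<in> carrier (free_mod R (b - a)) \<Longrightarrow> q1 v = \<zero>\<^bsub>Cod L\<^esub> \<Longrightarrow> p1 v = \<zero>\<^bsub>Dom L\<^esub>"
  proof (rule exists_lambda_arrow[OF ab cov K_def])
    show "p v = \<zero>\<^bsub>Dom F\<^esub>" if "v \<in> carrier (free_mod R a)" "q v = \<zero>\<^bsub>Cod F\<^esub>" for v
      using pq[OF that] .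
    show "k i \<in> \<mm>" if "k \<in> K" "a \<le> i" for k i using kq(1) that by (simp add: K_def)
    show "k i \<in> \<mm>" if "k \<in> K" "k \<in> carrier (free_mod R a)" for k i using kq(2) that by (simp add: K_def)
  qed (rule that)
  \<comment> \<open>Stability of the target puts every coordinate of the annihilator in
    \<open>\<mm>\<close>, which gives both smallness conditions for the new rank
    \<open>b - a\<close> at once.\<close>
  have sA: "k i \<in> \<mm>" if "k \<in> annihilator R b K" for k i
    using annihilator_in_max[OF c(2) st c(5,7)] that by (simp add: K_def)
  obtain N :: "'a uarrow" and p2 q2 where N: "is_lambda_arrow R L N"
    "arrow_cover R (b - (b - a)) b p2 q2 N"
    "annihilator R b (annihilator R b K) = {v \<in> carrier (free_mod R b). q2 v = \<zero>\<^bsub>Cod N\<^esub>}"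
    "\<And>v. v \<in> carrier (free_mod R (b - (b - a))) \<Longrightarrow> q2 v = \<zero>\<^bsub>Cod N\<^esub> \<Longrightarrow> p2 v = \<zero>\<^bsub>Dom N\<^esub>"
  proof (rule exists_lambda_arrow[OF diff_le_self L(2,3)])
    show "p1 v = \<zero>\<^bsub>Dom L\<^esub>" if "v \<in> carrier (free_mod R (b - a))" "q1 v = \<zero>\<^bsub>Cod L\<^esub>" for v
      using L(4)[OF that] .
    show "k i \<in> \<mm>" if "k \<in> annihilator R b K" "b - a \<le> i" for k i using sA[OF that(1)] .
    show "k i \<in> \<mm>" if "k \<in> annihilator R b K" "k \<in> carrier (free_mod R (b - a))" for k i using sA[OF that(1)] .
  qed (rule that)
  \<comment> \<open>The second application of lambda restores the rank of the source, so
    \<open>F\<close> and \<open>N\<close> are covered by the same inclusion of free modules.\<close>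
  have baa: "b - (b - a) = a" using ab by simp
  note covN = N(2)[unfolded baa]
  note n = arrow_coverD[OF covN]
  have kerq: "q v = \<zero>\<^bsub>Cod F\<^esub> \<longleftrightarrow> q2 v = \<zero>\<^bsub>Cod N\<^esub>" if "v \<in> carrier (free_mod R b)" for v
    using N(3) annihilator_annihilator[OF c(2,5) tl] that by (auto simp: K_def)
  \<comment> \<open>Both \<open>F\<close> and \<open>N\<close> are monomorphisms, so the kernels in
    the first component are the traces on \<open>F a\<close> of those in the second, and equality of
    the latter suffices.\<close>
  have kerp: "p v = \<zero>\<^bsub>Dom F\<^esub> \<longleftrightarrow> p2 v = \<zero>\<^bsub>Dom N\<^esub>" if v: "v \<in> carrier (free_mod R a)" for v
  proof -
    have "p v = \<zero>\<^bsub>Dom F\<^esub> \<longleftrightarrow> q v = \<zero>\<^bsub>Cod F\<^esub>"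
      using pq[OF v] c(8)[OF v] mod_hom_zero[OF c(1-3)] by metis
    moreover have "p2 v = \<zero>\<^bsub>Dom N\<^esub> \<longleftrightarrow> q2 v = \<zero>\<^bsub>Cod N\<^esub>"
      using N(4)[unfolded baa, OF v] n(8)[OF v] mod_hom_zero[OF n(1-3)] by metis
    ultimately show ?thesis using kerq[OF free_mod_mono[OF ab v]] by simp
  qed
  obtain g where g: "g \<in> mod_hom R (Dom F) (Dom N)" "bij_betw g (carrier (Dom F)) (carrier (Dom N))"
    "\<And>v. v \<in> carrier (free_mod R a) \<Longrightarrow> g (p v) = p2 v"
    by (rule mod_iso_from_equal_kernels[OF free_mod_module c(1) n(1) c(4) n(4) c(6) n(6) kerp]) (assumption | rule that)+
  obtain h where h: "h \<in> mod_hom R (Cod F) (Cod N)" "bij_betw h (carrier (Cod F)) (carrier (Cod N))"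
    "\<And>v. v \<in> carrier (free_mod R b) \<Longrightarrow> h (q v) = q2 v"
    by (rule mod_iso_from_equal_kernels[OF free_mod_module c(2) n(2) c(5) n(5) c(7) n(7) kerq]) (assumption | rule that)+
  have "Arr N (g x) = h (Arr F x)" if "x \<in> carrier (Dom F)" for x
  proof -
    obtain v where v: "v \<in> carrier (free_mod R a)" "x = p v" using c(6) \<open>x \<in> carrier (Dom F)\<close> by blast
    then show ?thesis using g(3) n(8) c(8) h(3) free_mod_mono[OF ab v(1)] by simp
  qed
  then have "(g, h) \<in> arrow_hom R F N" using g(1) h(1) by (simp add: arrow_hom_def)
  then have "arrow_iso R F N"
    unfolding arrow_iso_def using cov covN g(2) h(2)
    by (intro conjI bexI[of _ "(g, h)"]) (auto simp: arrow_cover_def)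
  then show "horizontally_linked_arrow R F"
    unfolding horizontally_linked_arrow_def using L(1) N(1) by blast
qed

end

theorem theorem4p6:
  fixes R :: "'r ring"
    and A :: "('r, 'a) module" and B :: "('r, 'b) module" and f :: "'a \<Rightarrow> 'b"
  assumes "local_ring R" and "noetherian_ring R" and "finite_krull_dim R"
    and "S_obj R \<lparr>Dom = A, Cod = B, Arr = f\<rparr>"
    and "stable_module R A" and "stable_module R B"
  shows "horizontally_linked_arrow R \<lparr>Dom = A, Cod = B, Arr = f\<rparr> \<longleftrightarrow>
    horizontally_linked_module R A \<and> horizontally_linked_module R B"
proof -
  obtain m where "noetherian_local_ring R m" using noetherian_local_ringI[OF assms(1,2)] by blast
  then interpret noetherian_local_ring R m .
  have A: "fg_module R A" "module R A" and B: "fg_module R B" "module R B"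
    and f: "f \<in> mod_hom R A B" "inj_on f (carrier A)"
    using assms(4) by (auto simp: S_obj_def M_obj_def is_arrow_def)
  show ?thesis
    using horizontally_linked_arrow_iff_torsionless[OF assms(4)] assms(6)
      horizontally_linked_module_iff_torsionless[OF A(1) assms(5)]
      horizontally_linked_module_iff_torsionless[OF B(1) assms(6)]
      torsionless_inj[OF A(2) B(2) f]
    by auto
qed

end
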